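(* Consider the correlated Gaussian sequence model $U=\beta_0+\Sigma_0^{1/2}\mathsf Z_n\in\mathbb R^n$ described in the context. Suppose there exists $M>1$ such that $\mathrm{supp}(G_0)\subset[-M,M]$ and $\sigma_{0,j}^2\in[1/M,M]$ for all $j\in[n]$. In addition, suppose that $G_0$ has a Lebesgue density $g_0$ supported on $[-M_0,M_0]$, on which $g_0(\cdot)\in[1/M,M]$. Let $\hat G_n\in\arg\max_{G\in\mathscr G}\frac1n\sum_{j}\log\varphi_{G;\sigma_{0,j}}(U_j)$ be the exact maximum composite marginal likelihood estimator. Fix $\gamma\in(0,1)$ and let $$\widehat C_j(U;\gamma)=\big[Q_{\hat G_n,\sigma_{0,j}}(\gamma/2\mid U_j),\,Q_{\hat G_n,\sigma_{0,j}}(1-\gamma/2\mid U_j)\big],\qquad j\in[n].$$ Then there exists $c_1=c_1(\gamma,M,M_0)>1$ such that for $n_\ast\ge(\log n)^{c_1}$, $$\Big|\mathbb P\big(\beta_{0,\pi_n}\in\widehat C_{\pi_n}(U;\gamma)\big)-(1-\gamma)\Big|\le\log^{-1/c_1}(e\,n_\ast),$$ where $\pi_n\sim\mathrm{Unif}([n])$ is independent of all other variables.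
   Context: $\mathscr G$ is the set of all probability distributions on $\mathbb R$. $\varphi_\sigma$ is the density of $\mathcal N(0,\sigma^2)$ and $\varphi_{G;\sigma}(x)=\int\varphi_\sigma(x-u)\,G(\mathrm du)$. Model. $\beta_0\in\mathbb R^n$ has i.i.d. entries with distribution $G_0\in\mathscr G$, $\mathsf Z_n\sim\mathcal N(0,I_n)$ is independent of $\beta_0$, $\Sigma_0\in\mathbb R^{n\times n}$ is a (deterministic, otherwise arbitrary) covariance matrix, and $U=\beta_0+\Sigma_0^{1/2}\mathsf Z_n$. $\sigma_{0,j}^2=(\Sigma_0)_{jj}$; $\mathrm{Cor}_{\Sigma_0}=\mathfrak D^{-1/2}\Sigma_0\mathfrak D^{-1/2}$ with $\mathfrak D$ the diagonal part of $\Sigma_0$; $n_\ast=n/\|\mathrm{Cor}_{\Sigma_0}\|_{\mathrm{op}}$. Posterior quantiles. For $G\in\mathscr G$, $s>0$, $u,t\in\mathbb R$: $\Pi_{G,s}(t\mid u)=\frac1{\varphi_{G;s}(u)}\int_{-\infty}^t\varphi_s(u-\theta)\,G(\mathrm d\theta)$, and for $a\in(0,1)$, $Q_{G,s}(a\mid u)=\inf\{t\in\mathbb R:\Pi_{G,s}(t\mid u)\ge a\}$. *)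

theory Defs
  imports "HOL-Probability.Probability" "Jordan_Normal_Form.Matrix"
begin

definition psd_mat :: "nat \<Rightarrow> real mat \<Rightarrow> bool" where
  "psd_mat n A \<longleftrightarrow> A \<in> carrier_mat n n \<and> transpose_mat A = A \<and>
     (\<forall>v\<in>carrier_vec n. 0 \<le> scalar_prod v (A *\<^sub>v v))"

text \<open>For positive semidefinite \<open>A\<close> exactly one \<open>S\<close> satisfies the following predicate.\<close>

definition is_psd_sqrt :: "nat \<Rightarrow> real mat \<Rightarrow> real mat \<Rightarrow> bool" where
  "is_psd_sqrt n S A \<longleftrightarrow> psd_mat n S \<and> S * S = A"

text \<open>The operator norm with respect to Euclidean norms. The supremum is taken in the reals,
  so this is meaningful only for matrices with at least one column.\<close>

definition op_norm :: "real mat \<Rightarrow> real" where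
  "op_norm A = (SUP v\<in>{v \<in> carrier_vec (dim_col A). scalar_prod v v = 1}.
     sqrt (scalar_prod (A *\<^sub>v v) (A *\<^sub>v v)))"

definition cor_mat :: "real mat \<Rightarrow> real mat" where
  "cor_mat \<Sigma> =
     (let D = mat_diag (dim_row \<Sigma>) (\<lambda>i. 1 / sqrt (\<Sigma> $$ (i, i))) in D * \<Sigma> * D)"

definition n_star :: "real mat \<Rightarrow> real" where
  "n_star \<Sigma> = real (dim_row \<Sigma>) / op_norm (cor_mat \<Sigma>)"

definition sd :: "real mat \<Rightarrow> nat \<Rightarrow> real" where
  "sd \<Sigma> j = sqrt (\<Sigma> $$ (j, j))"

abbreviation prob_distributions :: "real measure set" where
  "prob_distributions \<equiv> space (prob_algebra borel)"

definition measure_support :: "real measure \<Rightarrow> real set" where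
  "measure_support G = {x. \<forall>e>0. 0 < measure G (ball x e)}"

definition mixture_density :: "real measure \<Rightarrow> real \<Rightarrow> real \<Rightarrow> real" where
  "mixture_density G s x = (LINT u|G. normal_density 0 s (x - u))"

definition posterior_cdf :: "real measure \<Rightarrow> real \<Rightarrow> real \<Rightarrow> real \<Rightarrow> real" where
  "posterior_cdf G s u t =
     1 / mixture_density G s u * (LINT \<theta>:{..t}|G. normal_density 0 s (u - \<theta>))"

definition posterior_quantile :: "real measure \<Rightarrow> real \<Rightarrow> real \<Rightarrow> real \<Rightarrow> real" where
  "posterior_quantile G s u a = Inf {t. a \<le> posterior_cdf G s u t}"

text \<open>Vectors in \<open>\<real>\<^sup>n\<close> are extensional functions on \<open>{..<n}\<close>; coordinates are numbered from \<open>0\<close>.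
  The sample space below carries the joint law of \<open>(\<beta>\<^sub>0, Z, \<pi>)\<close>: i.i.d. effects with law \<open>G\<^sub>0\<close>,
  standard Gaussian noise, and a uniform index, all three independent.\<close>

abbreviation Rn :: "nat \<Rightarrow> (nat \<Rightarrow> real) measure" where
  "Rn n \<equiv> PiM {..<n} (\<lambda>_. borel)"

definition sequence_model ::
    "nat \<Rightarrow> real measure \<Rightarrow> ((nat \<Rightarrow> real) \<times> (nat \<Rightarrow> real) \<times> nat) measure" where
  "sequence_model n G0 =
     PiM {..<n} (\<lambda>_. G0) \<Otimes>\<^sub>M
     (PiM {..<n} (\<lambda>_. density lborel (\<lambda>x. ennreal (std_normal_density x))) \<Otimes>\<^sub>M
      uniform_count_measure {..<n})"

definition observation :: "nat \<Rightarrow> real mat \<Rightarrow> (nat \<Rightarrow> real) \<Rightarrow> (nat \<Rightarrow> real) \<Rightarrow> nat \<Rightarrow> real" where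
  "observation n S \<beta> z = (\<lambda>j\<in>{..<n}. \<beta> j + vec_index (S *\<^sub>v Matrix.vec n z) j)"

definition composite_loglik :: "nat \<Rightarrow> real mat \<Rightarrow> (nat \<Rightarrow> real) \<Rightarrow> real measure \<Rightarrow> real" where
  "composite_loglik n \<Sigma> u G = 1 / real n * (\<Sum>j<n. ln (mixture_density G (sd \<Sigma> j) (u j)))"

text \<open>An estimator is a measurable function of the data, with the set of probability
  distributions carrying the sigma-algebra generated by the evaluations \<open>G \<mapsto> G A\<close>. The maximizer
  need not be unique, so this is a predicate.\<close>

definition is_composite_mle ::
    "nat \<Rightarrow> real mat \<Rightarrow> ((nat \<Rightarrow> real) \<Rightarrow> real measure) \<Rightarrow> bool" where
  "is_composite_mle n \<Sigma> Ghat \<longleftrightarrow> Ghat \<in> Rn n \<rightarrow>\<^sub>M prob_algebra borel \<and>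
     (\<forall>u\<in>space (Rn n).
        is_arg_max (composite_loglik n \<Sigma> u) (\<lambda>G. G \<in> prob_distributions) (Ghat u))"

definition credible_interval ::
    "real mat \<Rightarrow> ((nat \<Rightarrow> real) \<Rightarrow> real measure) \<Rightarrow> real \<Rightarrow> (nat \<Rightarrow> real) \<Rightarrow> nat \<Rightarrow> real set" where
  "credible_interval \<Sigma> Ghat \<gamma> u j =
     {posterior_quantile (Ghat u) (sd \<Sigma> j) (u j) (\<gamma> / 2) ..
      posterior_quantile (Ghat u) (sd \<Sigma> j) (u j) (1 - \<gamma> / 2)}"

definition coverage ::
    "nat \<Rightarrow> real measure \<Rightarrow> real mat \<Rightarrow> real mat \<Rightarrow> ((nat \<Rightarrow> real) \<Rightarrow> real measure) \<Rightarrow> real \<Rightarrow> real" where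
  "coverage n G0 \<Sigma> S Ghat \<gamma> = measure (sequence_model n G0)
     {(\<beta>, z, j) \<in> space (sequence_model n G0).
        \<beta> j \<in> credible_interval \<Sigma> Ghat \<gamma> (observation n S \<beta> z) j}"

end

theory Submission
  imports Defs
begin

text \<open>Write \<open>p\<^sub>j\<close> and \<open>q\<^sub>j\<close> for the marginal densities of coordinate \<open>j\<close> under the true prior \<open>G0\<close> and
  under the estimate \<open>G\<close>. Comparing the likelihood of \<open>G\<close> with that of the midpoint of \<open>G0\<close> and \<open>G\<close>,
  together with \<open>1 - 1 / x \<le> ln x\<close>, shows that the harmonic ratios \<open>2 p\<^sub>j / (p\<^sub>j + q\<^sub>j)\<close> have empirical
  mean at most \<open>1\<close>, whereas their population mean is at least \<open>1 + \<parallel>p\<^sub>j - q\<^sub>j\<parallel>\<^sub>1\<^sup>2 / 4\<close>.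

  The two means differ little, uniformly in \<open>G\<close>: these functions take values in \<open>[0, 2]\<close> and are
  Lipschitz with constant of order \<open>1 / p\<^sub>j\<close>, so after truncation and Gaussian smoothing they are Fourier
  integrals, and only the empirical characteristic functions of the data have to be controlled. By
  Schur's argument for Hadamard powers of the correlation matrix their variance is at most
  \<open>2 / n\<^sub>*\<close>. Hence the characteristic functions of \<open>G\<close> and \<open>G0\<close> differ at \<open>w\<close> by at most
  \<open>n\<^sub>*\<^sup>-\<^sup>c exp (M w\<^sup>2 / 2)\<close>.

  Smoothing once more turns this into closeness, at a logarithmic rate, of the posterior distribution
  functions. Under \<open>G0\<close> the posterior distribution function evaluated at the effect is uniformly
  distributed, so a uniform perturbation by \<open>\<eta>\<close> changes the coverage by at most \<open>4\<eta>\<close>.\<close>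

section \<open>Gaussian kernels and mixture densities\<close>

text \<open>Two obstacles shape the argument. The estimate ranges over all of
  \<open>prob_distributions\<close>, so neither a lower bound on its marginal densities nor control
  of its tails is at hand; ratios to the midpoint density have a size and a modulus of continuity
  governed by the true prior alone. Moreover the coordinates may depend on each other in an
  arbitrary way, which blocks chaining and concentration for independent samples. Only second
  moments are used: a smoothed function enters the deviation through its L1 norm alone, multiplied
  by one random integral over frequencies. As the noise levels differ, this is done separately for
  groups of coordinates with nearly equal level.

  Two scales coexist. The empirical step has polynomial rates in \<open>nstar\<close>, written as
  powers of \<open>k\<close>. Undoing the Gaussian factor is exponentially expensive in the
  frequency, so after deconvolution only powers of \<open>z\<close> survive, a small power of
  \<open>1 / ln (exp 1 * nstar)\<close>. The exponents 1/64 and 1/32 are chosen for convenience,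
  since the claim leaves the power of the logarithm open.\<close>

lemma normal_density_zero_eq:
  "0 < s \<Longrightarrow> normal_density 0 s x = exp (- (x / s)\<^sup>2 / 2) / (sqrt (2 * pi) * s)"
  by (simp add: normal_density_def real_sqrt_mult power_divide)

lemma abs_mult_exp_le: "\<bar>y\<bar> * exp (- y\<^sup>2 / 2) \<le> (1::real)"
proof -
  have "\<bar>y\<bar> \<le> 1 + y\<^sup>2 / 2"
    using sum_squares_bound[of "\<bar>y\<bar>" 1] zero_le_power2[of "\<bar>y\<bar> - 1"] by (simp add: power2_eq_square algebra_simps)
  also have "\<dots> \<le> exp (y\<^sup>2 / 2)" by (rule exp_ge_add_one_self)
  finally show ?thesis by (simp add: exp_minus field_simps)
qed

lemma abs_square_mult_exp_le: "\<bar>y\<^sup>2 - 1\<bar> * exp (- y\<^sup>2 / 2) \<le> (2::real)"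
proof -
  have "\<bar>y\<^sup>2 - 1\<bar> \<le> 2 * (1 + y\<^sup>2 / 2)" by (simp add: abs_if)
  also have "\<dots> \<le> 2 * exp (y\<^sup>2 / 2)" by (rule mult_left_mono[OF exp_ge_add_one_self]) simp
  finally show ?thesis by (simp add: exp_minus field_simps)
qed

lemma two_le_sqrt_2pi: "2 \<le> sqrt (2 * pi)"
  by (rule real_le_rsqrt) (use pi_ge_two in simp)

lemma normal_density_zero_le:
  assumes "0 < s" shows "normal_density 0 s x \<le> 1 / (2 * s)"
proof -
  have "normal_density 0 s x \<le> 1 / (sqrt (2 * pi) * s)"
    using assms by (simp add: normal_density_zero_eq divide_right_mono)
  also have "\<dots> \<le> 1 / (2 * s)"
    using assms two_le_sqrt_2pi by (intro divide_left_mono mult_right_mono mult_pos_pos) auto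
  finally show ?thesis .
qed

text \<open>The scale varies too, because coordinates with slightly different noise levels will
  share one function. Both partial derivatives are a polynomial in \<open>x / s\<close> times the
  Gaussian factor over \<open>s\<^sup>2\<close>, which \<open>abs_mult_exp_le\<close> and
  \<open>abs_square_mult_exp_le\<close> control.\<close>

lemma normal_density_lipschitz:
  assumes m: "0 < m" "m \<le> s" "m \<le> s'"
  shows "\<bar>normal_density 0 s x - normal_density 0 s' x'\<bar> \<le> (\<bar>x - x'\<bar> + \<bar>s - s'\<bar>) / m\<^sup>2"
proof -
  let ?f = "\<lambda>s x. exp (- (x / s)\<^sup>2 / 2) / (sqrt (2 * pi) * s)"
  have 1: "\<bar>?f s x - ?f s x'\<bar> \<le> 1 / m\<^sup>2 * \<bar>x - x'\<bar>"
  proof (rule field_differentiable_bound[where S=UNIV and f="?f s"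
        and f'="\<lambda>x. - (x / s) * exp (- (x / s)\<^sup>2 / 2) / (sqrt (2 * pi) * s\<^sup>2)", unfolded real_norm_def])
    fix z :: real
    show "(?f s has_field_derivative - (z / s) * exp (- (z / s)\<^sup>2 / 2) / (sqrt (2 * pi) * s\<^sup>2)) (at z within UNIV)"
      using m by (auto intro!: derivative_eq_intros simp: power2_eq_square field_simps)
    have "\<bar>- (z / s) * exp (- (z / s)\<^sup>2 / 2) / (sqrt (2 * pi) * s\<^sup>2)\<bar> =
        (\<bar>z / s\<bar> * exp (- (z / s)\<^sup>2 / 2)) / (sqrt (2 * pi) * s\<^sup>2)"
      by (simp add: abs_mult)
    also have "\<dots> \<le> 1 / (1 * m\<^sup>2)"
      using m order_trans[OF one_le_numeral two_le_sqrt_2pi] abs_mult_exp_le[of "z / s"]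
      by (intro frac_le mult_mono power_mono) (simp_all del: real_sqrt_ge_1_iff)
    finally show "\<bar>- (z / s) * exp (- (z / s)\<^sup>2 / 2) / (sqrt (2 * pi) * s\<^sup>2)\<bar> \<le> 1 / m\<^sup>2" by simp
  qed auto
  have 2: "\<bar>?f s x' - ?f s' x'\<bar> \<le> 1 / m\<^sup>2 * \<bar>s - s'\<bar>"
  proof (rule field_differentiable_bound[where S="{m..}" and f="\<lambda>s. ?f s x'"
        and f'="\<lambda>s. ((x' / s)\<^sup>2 - 1) * exp (- (x' / s)\<^sup>2 / 2) / (sqrt (2 * pi) * s\<^sup>2)", unfolded real_norm_def])
    fix z :: real assume "z \<in> {m..}"
    then have z: "m \<le> z" "0 < z" using m by auto
    have c: "((\<lambda>s. exp (- (x' / s)\<^sup>2 / 2) / (c * s)) has_field_derivative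
        ((x' / z)\<^sup>2 - 1) * exp (- (x' / z)\<^sup>2 / 2) / (c * z\<^sup>2)) (at z within {m..})" if "c \<noteq> 0" for c :: real
      using z that by (auto intro!: derivative_eq_intros simp: power2_eq_square field_simps)
    show "((\<lambda>s. ?f s x') has_field_derivative ((x' / z)\<^sup>2 - 1) * exp (- (x' / z)\<^sup>2 / 2) / (sqrt (2 * pi) * z\<^sup>2)) (at z within {m..})"
      by (rule c) simp
    have "\<bar>((x' / z)\<^sup>2 - 1) * exp (- (x' / z)\<^sup>2 / 2) / (sqrt (2 * pi) * z\<^sup>2)\<bar> =
        (\<bar>(x' / z)\<^sup>2 - 1\<bar> * exp (- (x' / z)\<^sup>2 / 2)) / (sqrt (2 * pi) * z\<^sup>2)"
      by (simp add: abs_mult)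
    also have "\<dots> \<le> 2 / (2 * m\<^sup>2)"
      using m z two_le_sqrt_2pi abs_square_mult_exp_le[of "x' / z"]
      by (intro frac_le mult_mono power_mono) auto
    finally show "\<bar>((x' / z)\<^sup>2 - 1) * exp (- (x' / z)\<^sup>2 / 2) / (sqrt (2 * pi) * z\<^sup>2)\<bar> \<le> 1 / m\<^sup>2" by simp
  qed (use m in auto)
  have "\<bar>?f s x - ?f s' x'\<bar> \<le> 1 / m\<^sup>2 * \<bar>x - x'\<bar> + 1 / m\<^sup>2 * \<bar>s - s'\<bar>"
    using 1 2 by linarith
  then show ?thesis using m by (simp add: normal_density_zero_eq add_divide_distrib)
qed

lemma mem_prob_distributions_iff: "G \<in> prob_distributions \<longleftrightarrow> real_distribution G"
  by (auto simp: space_prob_algebra real_distribution_def real_distribution_axioms_def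
      dest: sets_eq_imp_space_eq)

context real_distribution
begin

lemma integrable_normal_kernel [intro]:
  assumes "0 < s" shows "integrable M (\<lambda>u. normal_density 0 s (x - u))"
  by (rule integrable_const_bound[of _ "1 / (2 * s)"])
     (use normal_density_zero_le[OF assms] in auto)

lemma mixture_density_pos:
  assumes "0 < s" shows "0 < mixture_density M s x"
proof -
  have "(LINT u|M. 0) < mixture_density M s x"
    unfolding mixture_density_def
    using integrable_normal_kernel[OF assms] normal_density_pos[OF assms] emeasure_space_1
    by (intro integral_less_AE_space) auto
  then show ?thesis by simp
qed

lemma mixture_density_lipschitz:
  assumes m: "0 < m" "m \<le> s" "m \<le> s'"
  shows "\<bar>mixture_density M s x - mixture_density M s' x'\<bar> \<le> (\<bar>x - x'\<bar> + \<bar>s - s'\<bar>) / m\<^sup>2"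
proof -
  have i: "integrable M (\<lambda>u. normal_density 0 s (x - u))" "integrable M (\<lambda>u. normal_density 0 s' (x' - u))"
    using m by auto
  have "mixture_density M s x - mixture_density M s' x' =
      (LINT u|M. normal_density 0 s (x - u) - normal_density 0 s' (x' - u))"
    unfolding mixture_density_def using i by simp
  also have "\<bar>\<dots>\<bar> \<le> (LINT u|M. \<bar>normal_density 0 s (x - u) - normal_density 0 s' (x' - u)\<bar>)"
    by simp
  also have "\<dots> \<le> (LINT u|M. (\<bar>x - x'\<bar> + \<bar>s - s'\<bar>) / m\<^sup>2)"
  proof (intro integral_mono)
    show "\<bar>normal_density 0 s (x - u) - normal_density 0 s' (x' - u)\<bar> \<le> (\<bar>x - x'\<bar> + \<bar>s - s'\<bar>) / m\<^sup>2" for u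
      using normal_density_lipschitz[OF m, of "x - u" "x' - u"] by simp
  qed (use i in auto)
  finally show ?thesis by (simp add: prob_space del: space_eq_univ)
qed

lemma measurable_mixture_density [measurable]: "mixture_density M s \<in> borel_measurable borel"
  unfolding mixture_density_def by measurable

lemma nn_integral_kernel:
  assumes "0 < s"
  shows "(\<integral>\<^sup>+u. ennreal (normal_density 0 s (x - u)) \<partial>M) = ennreal (mixture_density M s x)"
  unfolding mixture_density_def by (rule nn_integral_eq_integral) (use assms in auto)

end

section \<open>The likelihood comparison\<close>

text \<open>The likelihood comparison needs a competitor inside the class, and this is the only one
  used. It is realised as a bind over a fair coin, so it is a probability measure by construction
  and its integrals split into two halves.\<close>

lemma mixture_density_midpoint:
  assumes "real_distribution G" "real_distribution G'"
  obtains H where "real_distribution H"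
    "\<And>s x. 0 < s \<Longrightarrow> mixture_density H s x = (mixture_density G s x + mixture_density G' s x) / 2"
proof -
  interpret G: real_distribution G by fact
  interpret G': real_distribution G' by fact
  define N where "N b = (if b then G else G')" for b
  define H where "H = measure_pmf (bernoulli_pmf (1/2)) \<bind> N"
  have N: "N \<in> measure_pmf (bernoulli_pmf (1/2)) \<rightarrow>\<^sub>M prob_algebra borel"
    using assms by (auto simp: N_def space_prob_algebra measurable_def real_distribution_def prob_space_axioms_def
        mem_prob_distributions_iff[unfolded space_prob_algebra])
  then have N': "N \<in> measure_pmf (bernoulli_pmf (1/2)) \<rightarrow>\<^sub>M subprob_algebra borel"
    by (rule measurable_prob_algebraD)
  have "H \<in> prob_distributions"
    unfolding H_def space_prob_algebra using N prob_space_bind'[OF _ N, of "bernoulli_pmf (1/2)"] sets_bind'[OF _ N]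
    by (auto simp: space_prob_algebra measure_pmf.prob_space_axioms)
  then interpret H: real_distribution H by (simp add: mem_prob_distributions_iff)
  show thesis
  proof
    show "real_distribution H" by unfold_locales
    fix s x :: real assume s: "0 < s"
    have "ennreal (mixture_density H s x) = (\<integral>\<^sup>+u. ennreal (normal_density 0 s (x - u)) \<partial>H)"
      using H.nn_integral_kernel[OF s] by simp
    also have "\<dots> = (\<integral>\<^sup>+b. (\<integral>\<^sup>+u. ennreal (normal_density 0 s (x - u)) \<partial>N b) \<partial>bernoulli_pmf (1/2))"
      unfolding H_def by (rule nn_integral_bind[OF _ N']) simp
    also have "\<dots> = ennreal (mixture_density G s x) * ennreal (1/2) + ennreal (mixture_density G' s x) * ennreal (1/2)"
      using G.nn_integral_kernel[OF s] G'.nn_integral_kernel[OF s] by (simp add: N_def)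
    also have "\<dots> = ennreal ((mixture_density G s x + mixture_density G' s x) / 2)"
      using G.mixture_density_pos[OF s, of x] G'.mixture_density_pos[OF s, of x]
      by (simp only: ennreal_mult''[of "1/2", symmetric] ennreal_plus[symmetric] mult_nonneg_nonneg less_imp_le
          divide_nonneg_nonneg zero_le_one zero_le_numeral) (simp add: add_divide_distrib)
    finally show "mixture_density H s x = (mixture_density G s x + mixture_density G' s x) / 2"
      using G.mixture_density_pos[OF s, of x] G'.mixture_density_pos[OF s, of x]
        H.mixture_density_pos[OF s, of x] by (subst (asm) ennreal_inj) auto
  qed
qed

text \<open>The true density over the midpoint density, that is, over the marginal density of the
  competitor from \<open>mixture_density_midpoint\<close>. Unlike p / q it is bounded whatever
  \<open>G\<close> is.\<close>

definition harmonic_ratio :: "real measure \<Rightarrow> real measure \<Rightarrow> real \<Rightarrow> real \<Rightarrow> real" where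
  "harmonic_ratio G0 G s x =
     2 * mixture_density G0 s x / (mixture_density G0 s x + mixture_density G s x)"

lemma mle_harmonic_ratio_le:
  assumes "real_distribution G0" "is_arg_max (composite_loglik n \<Sigma> u) (\<lambda>G. G \<in> prob_distributions) G"
    and n: "1 \<le> n" and sd: "\<And>j. j < n \<Longrightarrow> 0 < sd \<Sigma> j"
  shows "(\<Sum>j<n. harmonic_ratio G0 G (sd \<Sigma> j) (u j)) \<le> n"
proof -
  interpret G0: real_distribution G0 by fact
  have "real_distribution G" using assms(2) by (simp add: is_arg_max_def mem_prob_distributions_iff)
  then interpret G: real_distribution G .
  obtain H where H: "real_distribution H"
    "\<And>s x. 0 < s \<Longrightarrow> mixture_density H s x = (mixture_density G0 s x + mixture_density G s x) / 2"
    using mixture_density_midpoint[OF assms(1) \<open>real_distribution G\<close>] by blast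
  have "composite_loglik n \<Sigma> u H \<le> composite_loglik n \<Sigma> u G"
    using assms(2) H(1) by (auto simp: is_arg_max_def mem_prob_distributions_iff not_less)
  then have "(\<Sum>j<n. ln (mixture_density H (sd \<Sigma> j) (u j))) \<le> (\<Sum>j<n. ln (mixture_density G (sd \<Sigma> j) (u j)))"
    using n by (simp add: composite_loglik_def divide_le_cancel)
  moreover have "harmonic_ratio G0 G (sd \<Sigma> j) (u j) - 1 \<le>
      ln (mixture_density H (sd \<Sigma> j) (u j)) - ln (mixture_density G (sd \<Sigma> j) (u j))" if "j < n" for j
  proof -
    define p where "p = mixture_density G0 (sd \<Sigma> j) (u j)"
    define q where "q = mixture_density G (sd \<Sigma> j) (u j)"
    have pos: "0 < p" "0 < q" unfolding p_def q_def
      using G0.mixture_density_pos G.mixture_density_pos sd[OF that] by auto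
    \<comment> \<open>Applied to \<open>q\<close> over the midpoint density. This ratio and the
      harmonic ratio add up to 2, so the right side is 1 minus the harmonic ratio.\<close>
    have "ln (2 * q / (p + q)) \<le> 2 * q / (p + q) - 1"
      using pos by (intro ln_le_minus_one) auto
    moreover have "ln (2 * q / (p + q)) = ln q - ln ((p + q) / 2)"
      using pos by (simp add: ln_div ln_mult)
    moreover have "2 * p / (p + q) + 2 * q / (p + q) = 2"
      using pos by (simp only: add_divide_distrib[symmetric] distrib_left[symmetric]) (simp add: divide_eq_eq)
    moreover have "mixture_density H (sd \<Sigma> j) (u j) = (p + q) / 2"
      using H(2)[OF sd[OF that], of "u j"] by (simp add: p_def q_def)
    moreover have "harmonic_ratio G0 G (sd \<Sigma> j) (u j) = 2 * p / (p + q)"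
      by (simp add: harmonic_ratio_def p_def q_def)
    ultimately show ?thesis unfolding q_def[symmetric] by (simp del: eq_divide_eq_numeral1)
  qed
  then have "(\<Sum>j<n. harmonic_ratio G0 G (sd \<Sigma> j) (u j) - 1) \<le>
      (\<Sum>j<n. ln (mixture_density H (sd \<Sigma> j) (u j)) - ln (mixture_density G (sd \<Sigma> j) (u j)))"
    by (intro sum_mono) auto
  ultimately show ?thesis by (simp add: sum_subtractf)
qed

text \<open>Only \<open>p\<close> may remain in the denominator, since \<open>q\<close> comes from
  the estimate and has no lower bound. The factors \<open>q'\<close> and \<open>p'\<close> of the
  numerator are absorbed by \<open>p' + q'\<close>, and then \<open>p + q\<close> is at least
  \<open>p\<close>.\<close>

lemma ratio_diff_le:
  fixes p q p' q' :: real
  assumes "0 < p" "0 < q" "0 < p'" "0 < q'"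
  shows "\<bar>p / (p + q) - p' / (p' + q')\<bar> \<le> (\<bar>p - p'\<bar> + \<bar>q - q'\<bar>) / p"
proof -
  have "p / (p + q) - p' / (p' + q') = ((p - p') * q' + p' * (q' - q)) / ((p + q) * (p' + q'))"
    using assms by (simp add: field_simps)
  also have "\<bar>\<dots>\<bar> = \<bar>(p - p') * q' + p' * (q' - q)\<bar> / ((p + q) * (p' + q'))"
    using assms by (simp add: abs_mult)
  also have "\<dots> \<le> ((\<bar>p - p'\<bar> + \<bar>q - q'\<bar>) * (p' + q')) / ((p + q) * (p' + q'))"
  proof (rule divide_right_mono)
    have "\<bar>(p - p') * q' + p' * (q' - q)\<bar> \<le> \<bar>p - p'\<bar> * q' + p' * \<bar>q - q'\<bar>"
      using assms abs_triangle_ineq[of "(p - p') * q'" "p' * (q' - q)"]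
      by (simp add: abs_mult abs_minus_commute)
    also have "\<dots> \<le> (\<bar>p - p'\<bar> + \<bar>q - q'\<bar>) * (p' + q')"
      using assms by (simp add: algebra_simps)
    finally show "\<bar>(p - p') * q' + p' * (q' - q)\<bar> \<le> (\<bar>p - p'\<bar> + \<bar>q - q'\<bar>) * (p' + q')" .
  qed (use assms in auto)
  also have "\<dots> = (\<bar>p - p'\<bar> + \<bar>q - q'\<bar>) / (p + q)" using assms by simp
  also have "\<dots> \<le> (\<bar>p - p'\<bar> + \<bar>q - q'\<bar>) / p"
    using assms by (intro divide_left_mono) auto
  finally show ?thesis .
qed

locale two_distributions = G0: real_distribution G0 + G: real_distribution G for G0 G
begin

lemma harmonic_ratio_bounds:
  assumes "0 < s" shows "0 \<le> harmonic_ratio G0 G s x" "harmonic_ratio G0 G s x \<le> 2"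
  using G0.mixture_density_pos[OF assms, of x] G.mixture_density_pos[OF assms, of x]
  by (auto simp: harmonic_ratio_def field_simps)

lemma harmonic_ratio_lipschitz:
  assumes m: "0 < m" "m \<le> s" "m \<le> s'"
  shows "\<bar>harmonic_ratio G0 G s x - harmonic_ratio G0 G s' x'\<bar>
    \<le> 4 * (\<bar>x - x'\<bar> + \<bar>s - s'\<bar>) / m\<^sup>2 / mixture_density G0 s x"
proof -
  have s: "0 < s" "0 < s'" using m by auto
  note pos = G0.mixture_density_pos[OF s(1), of x] G.mixture_density_pos[OF s(1), of x]
    G0.mixture_density_pos[OF s(2), of x'] G.mixture_density_pos[OF s(2), of x']
  let ?d = "(\<bar>x - x'\<bar> + \<bar>s - s'\<bar>) / m\<^sup>2"
  have "\<bar>harmonic_ratio G0 G s x - harmonic_ratio G0 G s' x'\<bar> = 2 *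
      \<bar>mixture_density G0 s x / (mixture_density G0 s x + mixture_density G s x) -
       mixture_density G0 s' x' / (mixture_density G0 s' x' + mixture_density G s' x')\<bar>"
    by (simp add: harmonic_ratio_def abs_if)
  also have "\<dots> \<le> 2 * ((\<bar>mixture_density G0 s x - mixture_density G0 s' x'\<bar> +
      \<bar>mixture_density G s x - mixture_density G s' x'\<bar>) / mixture_density G0 s x)"
    by (rule mult_left_mono[OF ratio_diff_le[OF pos]]) simp
  also have "\<dots> \<le> 2 * ((?d + ?d) / mixture_density G0 s x)"
    using pos G0.mixture_density_lipschitz[OF m, of x x'] G.mixture_density_lipschitz[OF m, of x x']
    by (intro mult_left_mono divide_right_mono add_mono) auto
  finally show ?thesis by (simp add: algebra_simps)
qed

lemma measurable_harmonic_ratio [measurable]: "harmonic_ratio G0 G s \<in> borel_measurable borel"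
  unfolding harmonic_ratio_def by measurable

end

section \<open>Population mean of the harmonic ratio\<close>

context real_distribution
begin

lemma nn_integral_mixture:
  assumes s: "0 < s" and [measurable]: "f \<in> borel_measurable borel"
  shows "(\<integral>\<^sup>+x. ennreal (mixture_density M s x) * f x \<partial>lborel) =
    (\<integral>\<^sup>+u. (\<integral>\<^sup>+x. ennreal (normal_density 0 s (x - u)) * f x \<partial>lborel) \<partial>M)"
proof -
  interpret pair_sigma_finite M lborel by unfold_locales
  have "(\<integral>\<^sup>+x. ennreal (mixture_density M s x) * f x \<partial>lborel) =
     (\<integral>\<^sup>+x. (\<integral>\<^sup>+u. ennreal (normal_density 0 s (x - u)) * f x \<partial>M) \<partial>lborel)"
    by (intro nn_integral_cong) (simp add: nn_integral_multc nn_integral_kernel[OF s, symmetric])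
  also have "\<dots> = (\<integral>\<^sup>+u. (\<integral>\<^sup>+x. ennreal (normal_density 0 s (x - u)) * f x \<partial>lborel) \<partial>M)"
    by (rule Fubini') measurable
  finally show ?thesis .
qed

lemma has_integral_mixture_density:
  assumes "0 < s"
  shows "integrable lborel (mixture_density M s)" "(LBINT x. mixture_density M s x) = 1"
proof -
  have "(\<integral>\<^sup>+x. ennreal (mixture_density M s x) \<partial>lborel) =
    (\<integral>\<^sup>+u. (\<integral>\<^sup>+x. ennreal (normal_density u s x) \<partial>lborel) \<partial>M)"
    using nn_integral_mixture[OF assms, of "\<lambda>_. 1"] by (simp add: normal_density_def)
  also have "\<dots> = 1"
    using assms by (simp add: nn_integral_eq_integral emeasure_space_1 del: space_eq_univ)
  finally have *: "(\<integral>\<^sup>+x. ennreal (mixture_density M s x) \<partial>lborel) = 1" .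
  show "integrable lborel (mixture_density M s)"
    using * mixture_density_pos[OF assms] by (intro integrableI_nonneg) (auto simp: less_imp_le)
  show "(LBINT x. mixture_density M s x) = 1"
    using * mixture_density_pos[OF assms] by (subst integral_eq_nn_integral) (auto simp: less_imp_le)
qed

end

context two_distributions
begin

lemma integrable_harmonic_ratio:
  assumes "0 < s"
  shows "integrable lborel (\<lambda>x. harmonic_ratio G0 G s x * mixture_density G0 s x)"
proof (rule Bochner_Integration.integrable_bound)
  show "integrable lborel (\<lambda>x. 2 * mixture_density G0 s x)"
    using G0.has_integral_mixture_density[OF assms] by simp
  show "AE x in lborel. norm (harmonic_ratio G0 G s x * mixture_density G0 s x) \<le> norm (2 * mixture_density G0 s x)"
    using harmonic_ratio_bounds[OF assms] by (auto simp: abs_mult intro!: mult_right_mono)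
qed simp

text \<open>Pointwise, \<open>2p\<^sup>2 / (p + q) = p + (p - q) / 2 + (p - q)\<^sup>2 / (2 (p + q))\<close>, and the last summand is at
  least \<open>\<lambda>\<bar>p - q\<bar> - \<lambda>\<^sup>2 (p + q) / 2\<close>; the choice \<open>\<lambda> = L / 2\<close> is optimal after integration.\<close>

lemma harmonic_ratio_population:
  assumes s: "0 < s"
  defines "L \<equiv> (LBINT x. \<bar>mixture_density G0 s x - mixture_density G s x\<bar>)"
  shows "1 + L\<^sup>2 / 4 \<le> (LBINT x. harmonic_ratio G0 G s x * mixture_density G0 s x)"
proof -
  let ?p = "mixture_density G0 s" and ?q = "mixture_density G s"
  note mix = G0.has_integral_mixture_density[OF s] G.has_integral_mixture_density[OF s]
  define d where "d x = \<bar>?p x - ?q x\<bar>" for x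
  have d: "integrable lborel d" unfolding d_def using mix by (intro integrable_abs Bochner_Integration.integrable_diff)
  define I where "I x = ?p x + (?p x - ?q x) / 2 + (L * d x - (L/2)\<^sup>2 * (?p x + ?q x)) / 2" for x
  have I: "has_bochner_integral lborel I (1 + (1 - 1) / 2 + (L * L - (L/2)\<^sup>2 * (1 + 1)) / 2)"
    unfolding I_def using mix d
    by (intro has_bochner_integral_add has_bochner_integral_diff has_bochner_integral_divide_zero
        has_bochner_integral_mult_right) (auto simp: has_bochner_integral_iff L_def d_def)
  have "(LBINT x. I x) \<le> (LBINT x. harmonic_ratio G0 G s x * ?p x)"
  proof (rule integral_mono)
    fix x
    define p q l where "p = ?p x" "q = ?q x" "l = L / 2"
    have pos: "0 < p" "0 < q" unfolding p_q_l_def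
      using G0.mixture_density_pos[OF s] G.mixture_density_pos[OF s] by auto
    have "0 \<le> (\<bar>p - q\<bar> - l * (p + q))\<^sup>2" by simp
    also have "\<dots> = (p - q)\<^sup>2 - 2 * l * \<bar>p - q\<bar> * (p + q) + l\<^sup>2 * (p + q)\<^sup>2"
      by (simp add: power2_diff power_mult_distrib)
    finally have "(2 * l * \<bar>p - q\<bar> - l\<^sup>2 * (p + q)) * (p + q) \<le> (p - q)\<^sup>2"
      by (simp add: algebra_simps power2_eq_square)
    then have "2 * l * \<bar>p - q\<bar> - l\<^sup>2 * (p + q) \<le> (p - q)\<^sup>2 / (p + q)"
      using pos by (simp add: pos_le_divide_eq)
    then have "(2 * l * \<bar>p - q\<bar> - l\<^sup>2 * (p + q)) / 2 \<le> (p - q)\<^sup>2 / (p + q) / 2"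
      by (rule divide_right_mono) simp
    moreover have "2 * p / (p + q) * p = p + (p - q) / 2 + (p - q)\<^sup>2 / (p + q) / 2"
      using pos by (simp add: field_simps power2_eq_square)
    then have "harmonic_ratio G0 G s x * ?p x = p + (p - q) / 2 + (p - q)\<^sup>2 / (p + q) / 2"
      unfolding harmonic_ratio_def p_q_l_def(1,2)[symmetric] by (simp only:)
    ultimately have "p + (p - q) / 2 + (2 * l * \<bar>p - q\<bar> - l\<^sup>2 * (p + q)) / 2 \<le> harmonic_ratio G0 G s x * ?p x"
      by (simp only: add_left_mono)
    then show "I x \<le> harmonic_ratio G0 G s x * ?p x"
      by (simp add: I_def d_def p_q_l_def)
  qed (use I integrable_harmonic_ratio[OF s] has_bochner_integral_iff in blast)+
  moreover have "(LBINT x. I x) = 1 + L\<^sup>2 / 4"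
    using I by (simp add: has_bochner_integral_iff power2_eq_square)
  ultimately show ?thesis by simp
qed

end

section \<open>Gaussian smoothing on the Fourier side\<close>

definition gaussian_smoothing :: "real \<Rightarrow> (real \<Rightarrow> real) \<Rightarrow> real \<Rightarrow> real" where
  "gaussian_smoothing \<tau> f x = (LBINT y. f y * normal_density 0 \<tau> (x - y))"

lemma normal_density_zero_diff: "normal_density 0 \<tau> (x - y) = normal_density x \<tau> y"
  by (simp add: normal_density_def power2_commute)

text \<open>The hypothesis is integrated against the normal law with mean \<open>x\<close> and
  deviation \<tau>. Three kinds of error are anticipated: \<open>a\<close> for a fixed discrepancy
  such as that between noise levels, \<open>B\<close> for the modulus of continuity, and
  \<open>D\<close> for truncation, whose cost is made quadratic in \<open>y\<close>.\<close>

lemma gaussian_smoothing_close: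
  assumes \<tau>: "0 < \<tau>" and [measurable]: "f \<in> borel_measurable borel" and B: "0 \<le> B"
    and f: "\<And>y. \<bar>f y - c\<bar> \<le> a + B * \<bar>x - y\<bar> + D * y\<^sup>2"
  shows "\<bar>gaussian_smoothing \<tau> f x - c\<bar> \<le> a + B * \<tau> + D * (x\<^sup>2 + \<tau>\<^sup>2)"
proof -
  let ?n = "normal_density x \<tau>"
  have n0: "has_bochner_integral lborel ?n 1"
    using \<tau> by (simp add: has_bochner_integral_iff)
  have n1: "has_bochner_integral lborel (\<lambda>y. ?n y * \<bar>y - x\<bar>) (\<tau> * sqrt (2 / pi))"
    using normal_moment_abs_odd[OF \<tau>, of x 0] by simp
  have "has_bochner_integral lborel (\<lambda>y. ?n y * (y - x)\<^sup>2) (\<tau>\<^sup>2)"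
    using normal_moment_even[OF \<tau>, of x 1] by (simp add: fact_numeral power2_eq_square)
  \<comment> \<open>The raw second moment, from y^2 = (y - x)^2 + 2 x y - x^2.\<close>
  from has_bochner_integral_add[OF this has_bochner_integral_diff[OF
      has_bochner_integral_mult_right[OF normal_moment_nz_1[OF \<tau>, of x], of "2 * x"]
      has_bochner_integral_mult_right[OF n0, of "x\<^sup>2"]]]
  have n2: "has_bochner_integral lborel (\<lambda>y. ?n y * y\<^sup>2) (x\<^sup>2 + \<tau>\<^sup>2)"
    by (simp add: power2_eq_square algebra_simps)
  define g where "g y = a * ?n y + B * (?n y * \<bar>y - x\<bar>) + D * (?n y * y\<^sup>2)" for y
  have g: "has_bochner_integral lborel g (a * 1 + B * (\<tau> * sqrt (2 / pi)) + D * (x\<^sup>2 + \<tau>\<^sup>2))"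
    unfolding g_def by (intro has_bochner_integral_add has_bochner_integral_mult_right n0 n1 n2)
  have le: "\<bar>f y * ?n y - c * ?n y\<bar> \<le> g y" for y
  proof -
    have "\<bar>f y * ?n y - c * ?n y\<bar> = \<bar>f y - c\<bar> * ?n y"
      by (simp add: left_diff_distrib[symmetric] abs_mult)
    also have "\<dots> \<le> (a + B * \<bar>x - y\<bar> + D * y\<^sup>2) * ?n y"
      by (rule mult_right_mono[OF f]) simp
    finally show ?thesis by (simp add: g_def algebra_simps abs_minus_commute)
  qed
  have int: "integrable lborel (\<lambda>y. f y * ?n y - c * ?n y)"
  proof (rule Bochner_Integration.integrable_bound)
    show "AE y in lborel. norm (f y * ?n y - c * ?n y) \<le> norm (g y)"
      using le by (auto intro!: AE_I2 order_trans[OF le abs_ge_self])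
  qed (use g has_bochner_integral_iff in auto)
  have "integrable lborel (\<lambda>y. (f y * ?n y - c * ?n y) + c * ?n y)"
    using int \<tau> by (intro Bochner_Integration.integrable_add) auto
  then have intf: "integrable lborel (\<lambda>y. f y * ?n y)" by simp
  have "gaussian_smoothing \<tau> f x - c = (LBINT y. f y * ?n y - c * ?n y)"
    using intf \<tau> by (simp add: gaussian_smoothing_def normal_density_zero_diff)
  also have "\<bar>\<dots>\<bar> \<le> (LBINT y. \<bar>f y * ?n y - c * ?n y\<bar>)" by simp
  also have "\<dots> \<le> (LBINT y. g y)"
    using int g has_bochner_integral_iff by (intro integral_mono le) auto
  also have "\<dots> = a * 1 + B * (\<tau> * sqrt (2 / pi)) + D * (x\<^sup>2 + \<tau>\<^sup>2)"
    using g by (simp add: has_bochner_integral_iff)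
  also have "\<dots> \<le> a + B * \<tau> + D * (x\<^sup>2 + \<tau>\<^sup>2)"
  proof -
    have "sqrt (2 / pi) \<le> 1" using pi_ge_two by simp
    then have "B * (\<tau> * sqrt (2 / pi)) \<le> B * (\<tau> * 1)" using B \<tau> by (intro mult_left_mono) auto
    then show ?thesis by simp
  qed
  finally show ?thesis .
qed

section \<open>Fourier representation of smoothed functions\<close>

definition gaussian_weight :: "real \<Rightarrow> real \<Rightarrow> real" where
  "gaussian_weight \<tau> w = exp (- (\<tau> * w)\<^sup>2 / 2)"

lemma gaussian_weight_nonneg [simp]: "0 \<le> gaussian_weight \<tau> w"
  by (simp add: gaussian_weight_def)

lemma gaussian_weight_measurable [measurable]: "gaussian_weight \<tau> \<in> borel_measurable borel"
  unfolding gaussian_weight_def by measurable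

lemma cis_measurable [measurable]: "cis \<in> borel_measurable borel"
  by (intro borel_measurable_continuous_onI continuous_intros)

lemma char_eq_cis: "char \<mu> t = (CLINT x|\<mu>. cis (t * x))"
  by (simp add: char_def cis_conv_exp)

lemma gaussian_weight_integral:
  assumes "0 < \<tau>"
  shows "has_bochner_integral lborel (\<lambda>w. gaussian_weight \<tau> w) (sqrt (2 * pi) / \<tau>)"
proof -
  have "(\<lambda>w. gaussian_weight \<tau> w) = (\<lambda>w. sqrt (2 * pi) / \<tau> * normal_density 0 (1 / \<tau>) w)"
    using assms by (simp add: normal_density_zero_eq gaussian_weight_def mult.commute)
  moreover have "has_bochner_integral lborel (normal_density 0 (1 / \<tau>)) 1"
    using assms by (simp add: has_bochner_integral_iff)
  then have "has_bochner_integral lborel (\<lambda>w. sqrt (2 * pi) / \<tau> * normal_density 0 (1 / \<tau>) w) (sqrt (2 * pi) / \<tau> * 1)"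
    by (rule has_bochner_integral_mult_right)
  ultimately show ?thesis by simp
qed

text \<open>Inversion comes from the self-duality of the Gaussian: the characteristic function of
  the standard normal, evaluated at \<open>x / \<tau>\<close>, becomes an integral over frequencies
  after the substitution y = \<tau> w.\<close>

lemma normal_density_fourier:
  assumes \<tau>: "0 < \<tau>"
  shows "complex_of_real (normal_density 0 \<tau> x) =
    complex_of_real (1 / (2 * pi)) * (CLBINT w. gaussian_weight \<tau> w * cis (w * x))"
proof -
  let ?t = "x / \<tau>" and ?I = "CLBINT w. gaussian_weight \<tau> w * cis (w * x)"
  have "complex_of_real (exp (- ?t\<^sup>2 / 2)) = (CLINT y|std_normal_distribution. cis (?t * y))"
    using char_std_normal_distribution char_eq_cis by metis
  also have "\<dots> = (CLBINT y. std_normal_density y *\<^sub>R cis (?t * y))"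
    by (rule integral_density) auto
  also have "\<dots> = \<bar>\<tau>\<bar> *\<^sub>R (CLBINT w. std_normal_density (0 + \<tau> * w) *\<^sub>R cis (?t * (0 + \<tau> * w)))"
    using \<tau> by (intro lborel_integral_real_affine) simp
  also have "(\<lambda>w. std_normal_density (0 + \<tau> * w) *\<^sub>R cis (?t * (0 + \<tau> * w))) =
      (\<lambda>w. complex_of_real (1 / sqrt (2 * pi)) * (gaussian_weight \<tau> w * cis (w * x)))"
    using \<tau> by (simp add: fun_eq_iff std_normal_density_def gaussian_weight_def scaleR_conv_of_real mult_ac)
  finally have *: "complex_of_real (exp (- ?t\<^sup>2 / 2)) = complex_of_real (\<tau> / sqrt (2 * pi)) * ?I"
    using \<tau> by (simp add: scaleR_conv_of_real del: complex_scaleR)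
  have "complex_of_real (normal_density 0 \<tau> x) = complex_of_real (exp (- ?t\<^sup>2 / 2)) * complex_of_real (1 / (sqrt (2 * pi) * \<tau>))"
    using \<tau> by (simp add: normal_density_zero_eq)
  also have "\<dots> = complex_of_real (\<tau> / sqrt (2 * pi) * (1 / (sqrt (2 * pi) * \<tau>))) * ?I"
    by (simp only: * of_real_mult mult.commute mult.left_commute)
  also have "\<tau> / sqrt (2 * pi) * (1 / (sqrt (2 * pi) * \<tau>)) = 1 / (2 * pi)"
    using \<tau> by simp
  finally show ?thesis .
qed

lemma gaussian_smoothing_fourier:
  assumes \<tau>: "0 < \<tau>" and f: "integrable lborel f"
  shows "complex_of_real (gaussian_smoothing \<tau> f x) =
    (CLBINT w. gaussian_weight \<tau> w * (complex_of_real (1 / (2 * pi)) * (CLBINT y. f y * cis (- (w * y)))) * cis (w * x))"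
proof -
  have [measurable]: "f \<in> borel_measurable borel" using f by auto
  let ?h = "\<lambda>y w. complex_of_real (f y * gaussian_weight \<tau> w / (2 * pi)) * cis (w * (x - y))"
  have g: "integrable lborel (\<lambda>w. gaussian_weight \<tau> w)"
    using gaussian_weight_integral[OF \<tau>] by (simp add: has_bochner_integral_iff)
  have int: "integrable (lborel \<Otimes>\<^sub>M lborel) (\<lambda>(y, w). ?h y w)"
  proof (rule lborel_pair.Fubini_integrable)
    have "(\<lambda>y. LBINT w. norm (case (y, w) of (y, w) \<Rightarrow> ?h y w)) =
        (\<lambda>y. \<bar>f y\<bar> * (LBINT w. gaussian_weight \<tau> w / (2 * pi)))"
      by (simp add: norm_mult abs_mult norm_divide)
    then show "integrable lborel (\<lambda>y. LBINT w. norm (case (y, w) of (y, w) \<Rightarrow> ?h y w))"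
      using f by simp
    show "AE y in lborel. integrable lborel (\<lambda>w. case (y, w) of (y, w) \<Rightarrow> ?h y w)"
    proof (intro AE_I2)
      fix y
      have "integrable lborel (\<lambda>w. f y / (2 * pi) * gaussian_weight \<tau> w)" using g by simp
      then show "integrable lborel (\<lambda>w. case (y, w) of (y, w) \<Rightarrow> ?h y w)"
        by (rule Bochner_Integration.integrable_bound) (auto simp: norm_mult abs_mult norm_divide)
    qed
  qed measurable
  have "complex_of_real (gaussian_smoothing \<tau> f x) = (CLBINT y. complex_of_real (f y * normal_density 0 \<tau> (x - y)))"
    unfolding gaussian_smoothing_def integral_complex_of_real ..
  also have "\<dots> = (CLBINT y. CLBINT w. ?h y w)"
  proof (rule Bochner_Integration.integral_cong)
    fix y
    have "complex_of_real (f y * normal_density 0 \<tau> (x - y)) =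
      complex_of_real (f y / (2 * pi)) * (CLBINT w. gaussian_weight \<tau> w * cis (w * (x - y)))"
      using normal_density_fourier[OF \<tau>, of "x - y"] by simp
    also have "\<dots> = (CLBINT w. ?h y w)"
      by (subst integral_mult_right_zero[symmetric]) (simp add: mult_ac)
    finally show "complex_of_real (f y * normal_density 0 \<tau> (x - y)) = (CLBINT w. ?h y w)" .
  qed simp
  also have "\<dots> = (CLBINT w. CLBINT y. ?h y w)"
    using lborel_pair.Fubini_integral[OF int] by simp
  also have "\<dots> = (CLBINT w. gaussian_weight \<tau> w * (complex_of_real (1 / (2 * pi)) * (CLBINT y. f y * cis (- (w * y)))) * cis (w * x))"
  proof (rule Bochner_Integration.integral_cong)
    fix w
    have "?h y w = (complex_of_real (gaussian_weight \<tau> w * (1 / (2 * pi))) * cis (w * x)) * (f y * cis (- (w * y)))" for y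
      by (simp add: cis_mult algebra_simps)
    then have "(CLBINT y. ?h y w) = (complex_of_real (gaussian_weight \<tau> w * (1 / (2 * pi))) * cis (w * x)) * (CLBINT y. f y * cis (- (w * y)))"
      by (simp only: integral_mult_right_zero)
    then show "(CLBINT y. ?h y w) = gaussian_weight \<tau> w * (complex_of_real (1 / (2 * pi)) * (CLBINT y. f y * cis (- (w * y)))) * cis (w * x)"
      by (simp add: mult_ac)
  qed simp
  finally show ?thesis .
qed

context
  fixes \<tau> :: real and f :: "real \<Rightarrow> real"
  assumes \<tau>: "0 < \<tau>" and f: "integrable lborel f"
begin

private definition "F w = complex_of_real (1 / (2 * pi)) * (CLBINT y. f y * cis (- (w * y)))"

private lemma F_measurable [measurable]: "F \<in> borel_measurable borel"
proof -
  have [measurable]: "f \<in> borel_measurable borel" using f by auto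
  show ?thesis unfolding F_def by measurable
qed

private lemma F_bound: "cmod (F w) \<le> (LBINT y. \<bar>f y\<bar>) / (2 * pi)"
proof -
  have "cmod (CLBINT y. f y * cis (- (w * y))) \<le> (LBINT y. cmod (f y * cis (- (w * y))))"
    by (rule integral_norm_bound)
  also have "\<dots> = (LBINT y. \<bar>f y\<bar>)" by (simp add: norm_mult)
  finally show ?thesis by (simp add: F_def norm_mult norm_divide divide_right_mono)
qed

private lemma weight_F_integrable:
  assumes [measurable]: "c \<in> borel_measurable borel" and c: "\<And>w. cmod (c w) \<le> C"
  shows "integrable lborel (\<lambda>w. gaussian_weight \<tau> w * F w * c w)"
proof (rule Bochner_Integration.integrable_bound)
  show "integrable lborel (\<lambda>w. gaussian_weight \<tau> w * ((LBINT y. \<bar>f y\<bar>) / (2 * pi) * C))"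
    using gaussian_weight_integral[OF \<tau>] by (simp add: has_bochner_integral_iff)
  have "cmod (gaussian_weight \<tau> w * F w * c w) \<le> gaussian_weight \<tau> w * ((LBINT y. \<bar>f y\<bar>) / (2 * pi) * C)" for w
    using F_bound[of w] c[of w] unfolding norm_mult mult.assoc
    by (intro mult_mono) (auto intro!: mult_nonneg_nonneg integral_nonneg)
  then show "AE w in lborel. norm (gaussian_weight \<tau> w * F w * c w) \<le>
      norm (gaussian_weight \<tau> w * ((LBINT y. \<bar>f y\<bar>) / (2 * pi) * C))"
    by (intro AE_I2) (metis abs_ge_self order_trans real_norm_def)
qed measurable

lemma gaussian_smoothing_measurable [measurable]: "gaussian_smoothing \<tau> f \<in> borel_measurable borel"
proof -
  have [measurable]: "f \<in> borel_measurable borel" using f by auto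
  show ?thesis unfolding gaussian_smoothing_def by measurable
qed

private lemma expectation_fourier:
  assumes "real_distribution \<mu>"
  shows "complex_of_real (LINT x|\<mu>. gaussian_smoothing \<tau> f x) =
    (CLBINT w. gaussian_weight \<tau> w * F w * char \<mu> w)"
proof -
  interpret real_distribution \<mu> by fact
  interpret pair_sigma_finite \<mu> lborel by unfold_locales
  let ?h = "\<lambda>x w. gaussian_weight \<tau> w * F w * cis (w * x)"
  have int: "integrable (\<mu> \<Otimes>\<^sub>M lborel) (\<lambda>(x, w). ?h x w)"
  proof (rule Fubini_integrable)
    have "(\<lambda>x. LBINT w. norm (case (x, w) of (x, w) \<Rightarrow> ?h x w)) =
        (\<lambda>x. LBINT w. norm (gaussian_weight \<tau> w * F w))"
      by (simp add: norm_mult)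
    then show "integrable \<mu> (\<lambda>x. LBINT w. norm (case (x, w) of (x, w) \<Rightarrow> ?h x w))" by simp
    show "AE x in \<mu>. integrable lborel (\<lambda>w. case (x, w) of (x, w) \<Rightarrow> ?h x w)"
      by (auto intro!: AE_I2 weight_F_integrable[where C=1])
  qed measurable
  have "complex_of_real (LINT x|\<mu>. gaussian_smoothing \<tau> f x) = (CLINT x|\<mu>. (CLBINT w. ?h x w))"
    unfolding integral_complex_of_real[symmetric] gaussian_smoothing_fourier[OF \<tau> f] F_def ..
  also have "\<dots> = (CLBINT w. (CLINT x|\<mu>. ?h x w))"
    using Fubini_integral[OF int] by simp
  finally show ?thesis by (simp add: char_eq_cis)
qed

text \<open>The source of uniformity: after smoothing, \<open>f\<close> enters only through its L1
  norm, so one integral over frequencies serves all functions at once. The sum over \<open>I\<close>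
  stays inside the modulus, because for the data the bound relies on cancellation between
  coordinates; a singleton \<open>I\<close> serves the deconvolution.\<close>

lemma gaussian_smoothing_expectation_diff:
  assumes "finite I" and \<mu>: "\<And>i. i \<in> I \<Longrightarrow> real_distribution (\<mu> i)" and \<nu>: "\<And>i. i \<in> I \<Longrightarrow> real_distribution (\<nu> i)"
  shows "\<bar>\<Sum>i\<in>I. (LINT x|\<mu> i. gaussian_smoothing \<tau> f x) - (LINT x|\<nu> i. gaussian_smoothing \<tau> f x)\<bar> \<le>
    (LBINT y. \<bar>f y\<bar>) / (2 * pi) *
    (LBINT w. gaussian_weight \<tau> w * cmod (\<Sum>i\<in>I. char (\<mu> i) w - char (\<nu> i) w))"
proof -
  let ?D = "\<lambda>w. \<Sum>i\<in>I. char (\<mu> i) w - char (\<nu> i) w"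
  have char: "cmod (char \<rho> w) \<le> 1" "char \<rho> \<in> borel_measurable borel" if "real_distribution \<rho>" for \<rho> w
  proof -
    interpret real_distribution \<rho> by fact
    show "cmod (char \<rho> w) \<le> 1" "char \<rho> \<in> borel_measurable borel"
      by (auto simp: cmod_char_le_1)
  qed
  have D: "cmod (?D w) \<le> (\<Sum>i\<in>I. 2)" for w
  proof (rule sum_norm_le)
    fix i assume "i \<in> I"
    then have "cmod (char (\<mu> i) w) \<le> 1" "cmod (char (\<nu> i) w) \<le> 1"
      using char \<mu> \<nu> by auto
    then show "cmod (char (\<mu> i) w - char (\<nu> i) w) \<le> 2"
      using norm_triangle_ineq4[of "char (\<mu> i) w" "char (\<nu> i) w"] by linarith
  qed
  have [measurable]: "?D \<in> borel_measurable borel"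
    using char \<mu> \<nu> by (intro borel_measurable_sum borel_measurable_diff) auto
  have i: "integrable lborel (\<lambda>w. gaussian_weight \<tau> w * F w * c w)"
    if "real_distribution \<rho>" "c = char \<rho>" for \<rho> c
    using char that by (intro weight_F_integrable[where C=1]) auto
  have iD: "integrable lborel (\<lambda>w. gaussian_weight \<tau> w * F w * ?D w)"
    by (rule weight_F_integrable[OF _ D]) measurable
  have "complex_of_real (\<Sum>i\<in>I. (LINT x|\<mu> i. gaussian_smoothing \<tau> f x) - (LINT x|\<nu> i. gaussian_smoothing \<tau> f x))
    = (\<Sum>i\<in>I. (CLBINT w. gaussian_weight \<tau> w * F w * char (\<mu> i) w) -
        (CLBINT w. gaussian_weight \<tau> w * F w * char (\<nu> i) w))"
    using expectation_fourier \<mu> \<nu> by (simp del: integral_complex_of_real)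
  also have "\<dots> = (CLBINT w. (\<Sum>i\<in>I. gaussian_weight \<tau> w * F w * char (\<mu> i) w - gaussian_weight \<tau> w * F w * char (\<nu> i) w))"
    using i \<mu> \<nu> by (subst Bochner_Integration.integral_sum) auto
  also have "\<dots> = (CLBINT w. gaussian_weight \<tau> w * F w * ?D w)"
    by (simp add: right_diff_distrib sum_distrib_left)
  finally have "\<bar>\<Sum>i\<in>I. (LINT x|\<mu> i. gaussian_smoothing \<tau> f x) - (LINT x|\<nu> i. gaussian_smoothing \<tau> f x)\<bar>
      = cmod (CLBINT w. gaussian_weight \<tau> w * F w * ?D w)"
    by - (drule arg_cong[where f=cmod], simp only: norm_of_real)
  also have "\<dots> \<le> (LBINT w. cmod (gaussian_weight \<tau> w * F w * ?D w))"
    by (rule integral_norm_bound)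
  also have "\<dots> \<le> (LBINT w. (LBINT y. \<bar>f y\<bar>) / (2 * pi) * (gaussian_weight \<tau> w * cmod (?D w)))"
  proof (rule integral_mono)
    show "integrable lborel (\<lambda>w. cmod (gaussian_weight \<tau> w * F w * ?D w))" using iD by auto
    have "integrable lborel (\<lambda>w. gaussian_weight \<tau> w * cmod (?D w))"
    proof (rule Bochner_Integration.integrable_bound)
      show "integrable lborel (\<lambda>w. gaussian_weight \<tau> w * (\<Sum>i\<in>I. 2))"
        using gaussian_weight_integral[OF \<tau>] by (simp add: has_bochner_integral_iff)
      show "AE w in lborel. norm (gaussian_weight \<tau> w * cmod (?D w)) \<le> norm (gaussian_weight \<tau> w * (\<Sum>i\<in>I. 2))"
      proof (intro AE_I2)
        fix w
        have "gaussian_weight \<tau> w * cmod (?D w) \<le> gaussian_weight \<tau> w * (\<Sum>i\<in>I. 2)"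
          by (rule mult_left_mono[OF D]) simp
        then show "norm (gaussian_weight \<tau> w * cmod (?D w)) \<le> norm (gaussian_weight \<tau> w * (\<Sum>i\<in>I. 2))"
          by (simp add: abs_mult)
      qed
    qed measurable
    then show "integrable lborel (\<lambda>w. (LBINT y. \<bar>f y\<bar>) / (2 * pi) * (gaussian_weight \<tau> w * cmod (?D w)))"
      by (rule integrable_mult_right)
    fix w
    have "cmod (gaussian_weight \<tau> w * F w * ?D w) = cmod (F w) * (gaussian_weight \<tau> w * cmod (?D w))"
      by (simp add: norm_mult)
    also have "\<dots> \<le> (LBINT y. \<bar>f y\<bar>) / (2 * pi) * (gaussian_weight \<tau> w * cmod (?D w))"
      by (rule mult_right_mono[OF F_bound]) simp
    finally show "cmod (gaussian_weight \<tau> w * F w * ?D w) \<le> \<dots>" .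
  qed
  finally show ?thesis by simp
qed

end

lemma normal_density_zero_diff': "normal_density 0 s (x - u) = normal_density u s x"
  by (simp add: normal_density_def)

lemma normal_density_char:
  assumes s: "0 < s"
  shows "(CLBINT x. normal_density 0 s (x - u) * cis (w * x)) = gaussian_weight s w * cis (w * u)"
proof -
  have "(CLBINT x. normal_density 0 s (x - u) * cis (w * x)) =
      \<bar>s\<bar> *\<^sub>R (CLBINT y. normal_density 0 s (u + s * y - u) * cis (w * (u + s * y)))"
    using s by (intro lborel_integral_real_affine) simp
  also have "(\<lambda>y. normal_density 0 s (u + s * y - u) * cis (w * (u + s * y))) =
      (\<lambda>y. (complex_of_real (1 / s) * cis (w * u)) * (std_normal_density y *\<^sub>R cis ((w * s) * y)))"
    using s by (simp add: fun_eq_iff normal_density_zero_eq[of s] std_normal_density_def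
        scaleR_conv_of_real distrib_left cis_mult[symmetric] mult_ac)
  also have "(CLBINT y. (complex_of_real (1 / s) * cis (w * u)) * (std_normal_density y *\<^sub>R cis ((w * s) * y)))
      = (complex_of_real (1 / s) * cis (w * u)) * (CLBINT y. (std_normal_density y *\<^sub>R cis ((w * s) * y)))"
    by (rule integral_mult_right_zero)
  also have "(CLBINT y. (std_normal_density y *\<^sub>R cis ((w * s) * y))) = (CLINT y|std_normal_distribution. cis ((w * s) * y))"
    by (rule integral_density[symmetric]) auto
  also have "\<dots> = complex_of_real (exp (- (w * s)\<^sup>2 / 2))"
    using char_std_normal_distribution char_eq_cis by metis
  finally show ?thesis
    using s by (simp add: gaussian_weight_def scaleR_conv_of_real mult.commute del: complex_scaleR)
qed

section \<open>The law of a single observation\<close>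

definition mixture_law :: "real measure \<Rightarrow> real \<Rightarrow> real measure" where
  "mixture_law G s = density lborel (\<lambda>x. ennreal (mixture_density G s x))"

lemma sets_mixture_law [simp, measurable_cong]: "sets (mixture_law G s) = sets borel"
  by (simp add: mixture_law_def)

lemma space_mixture_law [simp]: "space (mixture_law G s) = UNIV"
  by (simp add: mixture_law_def)

context real_distribution
begin

lemma nn_integral_mixture_law:
  assumes s: "0 < s" and [measurable]: "f \<in> borel_measurable borel"
  shows "(\<integral>\<^sup>+x. f x \<partial>mixture_law M s) =
    (\<integral>\<^sup>+u. (\<integral>\<^sup>+x. ennreal (normal_density 0 s (x - u)) * f x \<partial>lborel) \<partial>M)"
  unfolding mixture_law_def by (subst nn_integral_density) (simp_all add: nn_integral_mixture[OF s])

lemma real_distribution_mixture_law: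
  assumes s: "0 < s" shows "real_distribution (mixture_law M s)"
proof -
  have "emeasure (mixture_law M s) (space (mixture_law M s)) = (\<integral>\<^sup>+x. ennreal (mixture_density M s x) \<partial>lborel)"
    unfolding mixture_law_def by (subst emeasure_density) auto
  also have "\<dots> = 1"
    using has_integral_mixture_density[OF s] mixture_density_pos[OF s]
    by (subst nn_integral_eq_integral) (auto simp: less_imp_le)
  finally show ?thesis by (intro real_distribution.intro prob_spaceI real_distribution_axioms.intro) auto
qed

lemma integral_mixture_law:
  fixes f :: "real \<Rightarrow> 'b::{banach, second_countable_topology}"
  assumes s: "0 < s" and "f \<in> borel_measurable borel"
  shows "(LINT x|mixture_law M s. f x) = (LBINT x. mixture_density M s x *\<^sub>R f x)"
  unfolding mixture_law_def using assms mixture_density_pos[OF s]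
  by (intro integral_density) (auto simp: less_imp_le)

lemma char_mixture_law:
  assumes s: "0 < s"
  shows "char (mixture_law M s) w = gaussian_weight s w * char M w"
proof -
  interpret pair_sigma_finite M lborel by unfold_locales
  let ?h = "\<lambda>u x. normal_density 0 s (x - u) * cis (w * x)"
  have int: "integrable (M \<Otimes>\<^sub>M lborel) (\<lambda>(u, x). ?h u x)"
  proof (rule Fubini_integrable)
    have nd: "has_bochner_integral lborel (\<lambda>x. normal_density 0 s (x - u)) 1" for u
      using s by (simp add: normal_density_zero_diff' has_bochner_integral_iff)
    show "integrable M (\<lambda>u. LBINT x. norm (case (u, x) of (u, x) \<Rightarrow> ?h u x))"
      using nd by (simp add: norm_mult has_bochner_integral_iff)
    show "AE u in M. integrable lborel (\<lambda>x. case (u, x) of (u, x) \<Rightarrow> ?h u x)"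
    proof (intro AE_I2)
      fix u
      have "integrable lborel (\<lambda>x. normal_density 0 s (x - u))" using nd by (simp add: has_bochner_integral_iff)
      then show "integrable lborel (\<lambda>x. case (u, x) of (u, x) \<Rightarrow> ?h u x)"
        by (rule Bochner_Integration.integrable_bound) (auto simp: norm_mult)
    qed
  qed measurable
  have "char (mixture_law M s) w = (CLBINT x. mixture_density M s x *\<^sub>R cis (w * x))"
    unfolding char_eq_cis by (rule integral_mixture_law[OF s]) measurable
  also have "\<dots> = (CLBINT x. (CLINT u|M. ?h u x))"
    unfolding mixture_density_def scaleR_conv_of_real integral_complex_of_real[symmetric] by simp
  also have "\<dots> = (CLINT u|M. (CLBINT x. ?h u x))"
    using Fubini_integral[OF int] by simp
  finally show ?thesis
    unfolding normal_density_char[OF s] by (simp add: char_eq_cis)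
qed

lemma mixture_law_second_moment:
  assumes s: "0 < s" and R: "AE u in M. \<bar>u\<bar> \<le> R"
  shows "integrable (mixture_law M s) (\<lambda>x. x\<^sup>2)" "(LINT x|mixture_law M s. x\<^sup>2) \<le> R\<^sup>2 + s\<^sup>2"
proof -
  have inner: "(\<integral>\<^sup>+x. ennreal (normal_density 0 s (x - u)) * ennreal (x\<^sup>2) \<partial>lborel) = ennreal (u\<^sup>2 + s\<^sup>2)" for u
  proof -
    have n0: "has_bochner_integral lborel (normal_density u s) 1"
      using s by (simp add: has_bochner_integral_iff)
    have "has_bochner_integral lborel (\<lambda>y. normal_density u s y * (y - u)\<^sup>2) (s\<^sup>2)"
      using normal_moment_even[OF s, of u 1] by (simp add: fact_numeral power2_eq_square)
    from has_bochner_integral_add[OF this has_bochner_integral_diff[OF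
        has_bochner_integral_mult_right[OF normal_moment_nz_1[OF s, of u], of "2 * u"]
        has_bochner_integral_mult_right[OF n0, of "u\<^sup>2"]]]
    have "has_bochner_integral lborel (\<lambda>y. normal_density u s y * y\<^sup>2) (u\<^sup>2 + s\<^sup>2)"
      by (simp add: power2_eq_square algebra_simps)
    then have "(\<integral>\<^sup>+x. ennreal (normal_density u s x * x\<^sup>2) \<partial>lborel) = ennreal (u\<^sup>2 + s\<^sup>2)"
      by (simp add: has_bochner_integral_iff nn_integral_eq_integral)
    then show ?thesis by (simp add: ennreal_mult normal_density_zero_diff')
  qed
  have "(\<integral>\<^sup>+x. ennreal (x\<^sup>2) \<partial>mixture_law M s) = (\<integral>\<^sup>+u. ennreal (u\<^sup>2 + s\<^sup>2) \<partial>M)"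
    by (subst nn_integral_mixture_law[OF s]) (simp_all add: inner)
  also have "\<dots> \<le> (\<integral>\<^sup>+u. ennreal (R\<^sup>2 + s\<^sup>2) \<partial>M)"
  proof (rule nn_integral_mono_AE)
    show "AE u in M. ennreal (u\<^sup>2 + s\<^sup>2) \<le> ennreal (R\<^sup>2 + s\<^sup>2)"
      using R by eventually_elim (auto intro!: ennreal_leI simp: abs_le_square_iff[symmetric])
  qed
  also have "\<dots> = ennreal (R\<^sup>2 + s\<^sup>2)" by (simp add: emeasure_space_1 del: space_eq_univ)
  finally have *: "(\<integral>\<^sup>+x. ennreal (x\<^sup>2) \<partial>mixture_law M s) \<le> ennreal (R\<^sup>2 + s\<^sup>2)" .
  show i: "integrable (mixture_law M s) (\<lambda>x. x\<^sup>2)"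
    using * by (intro integrableI_nonneg) (auto intro: le_less_trans)
  show "(LINT x|mixture_law M s. x\<^sup>2) \<le> R\<^sup>2 + s\<^sup>2"
    using * i by (subst (asm) nn_integral_eq_integral) (auto simp del: ennreal_plus)
qed

text \<open>Lipschitz constants of order 1 / p are unbounded. Under the law with density p itself,
  however, c / p integrates over [-K, K] to c times the length of the window, and outside the window
  the cap 2 is dominated by 2 x^2 / K^2, as in Chebyshev's inequality.\<close>

lemma mixture_law_reciprocal_bound:
  assumes s: "0 < s" and R: "AE u in M. \<bar>u\<bar> \<le> R" and c: "0 \<le> c" and K: "0 < K"
  shows "(LINT x|mixture_law M s. min 2 (c / mixture_density M s x)) \<le> 2 * c * K + 2 * (R\<^sup>2 + s\<^sup>2) / K\<^sup>2"
proof -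
  interpret L: real_distribution "mixture_law M s" by (rule real_distribution_mixture_law[OF s])
  let ?p = "mixture_density M s"
  have p: "0 < ?p x" for x using mixture_density_pos[OF s] .
  let ?q = "\<lambda>x. indicator {-K..K} x / ?p x"
  have "(\<integral>\<^sup>+x. ennreal (?q x) \<partial>mixture_law M s) = (\<integral>\<^sup>+x. indicator {-K..K} x \<partial>lborel)"
  proof -
    have "ennreal (?p x) * ennreal (?q x) = indicator {-K..K} x" for x
    proof -
      have "ennreal (?p x) * ennreal (?q x) = ennreal (?p x * ?q x)"
        using p[of x] by (intro ennreal_mult'[symmetric]) simp
      also have "?p x * ?q x = indicator {-K..K} x" using p[of x] by simp
      finally show ?thesis by (simp split: split_indicator)
    qed
    then show ?thesis unfolding mixture_law_def by (subst nn_integral_density) simp_all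
  qed
  also have "\<dots> = ennreal (2 * K)" using K by simp
  finally have q: "has_bochner_integral (mixture_law M s) ?q (2 * K)"
    using p K by (intro has_bochner_integral_nn_integral) (auto simp: less_imp_le)
  have g: "has_bochner_integral (mixture_law M s) (\<lambda>x. c * ?q x + 2 / K\<^sup>2 * x\<^sup>2)
      (c * (2 * K) + 2 / K\<^sup>2 * (LINT x|mixture_law M s. x\<^sup>2))"
    using mixture_law_second_moment(1)[OF s R]
    by (intro has_bochner_integral_add has_bochner_integral_mult_right q has_bochner_integral_integrable)
  have "(LINT x|mixture_law M s. min 2 (c / ?p x)) \<le> (LINT x|mixture_law M s. c * ?q x + 2 / K\<^sup>2 * x\<^sup>2)"
  proof (rule integral_mono)
    show "integrable (mixture_law M s) (\<lambda>x. min 2 (c / ?p x))"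
      using p c by (intro L.integrable_const_bound[where B=2]) (auto simp: less_imp_le)
    show "integrable (mixture_law M s) (\<lambda>x. c * ?q x + 2 / K\<^sup>2 * x\<^sup>2)"
      using g by (rule integrable.intros)
    fix x
    show "min 2 (c / ?p x) \<le> c * ?q x + 2 / K\<^sup>2 * x\<^sup>2"
    proof (cases "x \<in> {-K..K}")
      case True then show ?thesis by (simp add: min.coboundedI2)
    next
      case False
      then have "K\<^sup>2 \<le> x\<^sup>2" using K by (auto simp: abs_le_square_iff[symmetric])
      then have "2 \<le> 2 / K\<^sup>2 * x\<^sup>2" using K by (simp add: field_simps)
      then show ?thesis using False by (simp add: min.coboundedI1)
    qed
  qed
  also have "\<dots> = c * (2 * K) + 2 / K\<^sup>2 * (LINT x|mixture_law M s. x\<^sup>2)"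
    using g by (rule has_bochner_integral_integral_eq)
  also have "\<dots> \<le> c * (2 * K) + 2 / K\<^sup>2 * (R\<^sup>2 + s\<^sup>2)"
    using mixture_law_second_moment(2)[OF s R] by (intro add_left_mono mult_left_mono) auto
  finally show ?thesis by (simp add: mult_ac)
qed

end

section \<open>Uniform deviations of the harmonic ratio\<close>

text \<open>Bounds, uniformly in \<open>G\<close>, the error committed at \<open>x\<close> when \<open>harmonic_ratio G0 G s\<close> is truncated to
  \<open>[-K, K]\<close>, smoothed at scale \<open>\<tau>\<close>, and evaluated at a noise level within \<open>\<tau>\<close> of \<open>s\<close>.\<close>

definition smoothing_error :: "real measure \<Rightarrow> real \<Rightarrow> real \<Rightarrow> real \<Rightarrow> real \<Rightarrow> real \<Rightarrow> real" where
  "smoothing_error G0 m \<tau> K s x =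
     min 2 (8 * \<tau> / m\<^sup>2 / mixture_density G0 s x) + 2 / K\<^sup>2 * (x\<^sup>2 + \<tau>\<^sup>2)"

context two_distributions
begin

text \<open>\<open>gaussian_smoothing_close\<close> is used twice, with the range bound 2 and with
  the Lipschitz bound, which yields the minimum in \<open>smoothing_error\<close>. Of the factor 8
  there, half comes from the change of noise level and half from the smoothing.\<close>

lemma truncated_ratio_smoothing:
  assumes m: "0 < m" "m \<le> s" "m \<le> s'" and \<tau>: "0 < \<tau>" "\<bar>s - s'\<bar> \<le> \<tau>" and K: "0 < K"
  shows "\<bar>gaussian_smoothing \<tau> (\<lambda>y. harmonic_ratio G0 G s' y * indicator {-K..K} y) x - harmonic_ratio G0 G s x\<bar>
    \<le> smoothing_error G0 m \<tau> K s x"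
proof -
  let ?h = "harmonic_ratio G0 G" and ?p = "mixture_density G0 s x"
  have s: "0 < s" "0 < s'" using m by auto
  note b = harmonic_ratio_bounds[OF s(1)] harmonic_ratio_bounds[OF s(2)]
  have p: "0 < ?p" using G0.mixture_density_pos[OF s(1)] .
  \<comment> \<open>The cut-off costs at most 2, and only where 2 is at most 2 y^2 / K^2. A
    quadratic bound can be integrated against the smoothing kernel.\<close>
  have trunc: "\<bar>?h s' y * indicator {-K..K} y - ?h s x\<bar> \<le> \<bar>?h s x - ?h s' y\<bar> + 2 / K\<^sup>2 * y\<^sup>2" for y
  proof (cases "y \<in> {-K..K}")
    case True then show ?thesis by (simp add: abs_minus_commute)
  next
    case False
    then have "K\<^sup>2 \<le> y\<^sup>2" using K by (auto simp: abs_le_square_iff[symmetric])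
    then have "2 / K\<^sup>2 * K\<^sup>2 \<le> 2 / K\<^sup>2 * y\<^sup>2" by (rule mult_left_mono) simp
    then have "2 \<le> 2 / K\<^sup>2 * y\<^sup>2" using K by simp
    then show ?thesis using False b(1,2)[of x] by simp
  qed
  have meas: "(\<lambda>y. ?h s' y * indicator {-K..K} y) \<in> borel_measurable borel" by measurable
  let ?S = "gaussian_smoothing \<tau> (\<lambda>y. ?h s' y * indicator {-K..K} y) x"
  have "\<bar>?S - ?h s x\<bar> \<le> 2 + 0 * \<tau> + 2 / K\<^sup>2 * (x\<^sup>2 + \<tau>\<^sup>2)"
  proof (rule gaussian_smoothing_close[OF \<tau>(1) meas])
    fix y show "\<bar>?h s' y * indicator {-K..K} y - ?h s x\<bar> \<le> 2 + 0 * \<bar>x - y\<bar> + 2 / K\<^sup>2 * y\<^sup>2"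
      using trunc[of y] b(1,2)[of x] b(3,4)[of y] by linarith
  qed simp
  moreover have "\<bar>?S - ?h s x\<bar> \<le> 4 * \<tau> / m\<^sup>2 / ?p + 4 / m\<^sup>2 / ?p * \<tau> + 2 / K\<^sup>2 * (x\<^sup>2 + \<tau>\<^sup>2)"
  proof (rule gaussian_smoothing_close[OF \<tau>(1) meas])
    fix y
    have "\<bar>?h s x - ?h s' y\<bar> \<le> 4 * (\<bar>x - y\<bar> + \<bar>s - s'\<bar>) / m\<^sup>2 / ?p"
      by (rule harmonic_ratio_lipschitz[OF m])
    also have "\<dots> \<le> 4 * (\<bar>x - y\<bar> + \<tau>) / m\<^sup>2 / ?p"
      using p m \<tau> by (intro divide_right_mono mult_left_mono add_left_mono) auto
    also have "\<dots> = 4 * \<tau> / m\<^sup>2 / ?p + 4 / m\<^sup>2 / ?p * \<bar>x - y\<bar>"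
      by (simp add: add_divide_distrib distrib_left)
    finally show "\<bar>?h s' y * indicator {-K..K} y - ?h s x\<bar> \<le> 4 * \<tau> / m\<^sup>2 / ?p + 4 / m\<^sup>2 / ?p * \<bar>x - y\<bar> + 2 / K\<^sup>2 * y\<^sup>2"
      using trunc[of y] by linarith
  qed (use p m in auto)
  moreover have eq: "4 * \<tau> / m\<^sup>2 / ?p + 4 / m\<^sup>2 / ?p * \<tau> = 8 * \<tau> / m\<^sup>2 / ?p" by simp
  ultimately show ?thesis
    unfolding smoothing_error_def min_add_distrib_left eq by (intro min.boundedI) (simp_all only: mult_zero_left add_0_right)
qed

lemma truncated_ratio_integrable:
  assumes "0 < s" "0 < K"
  shows "integrable lborel (\<lambda>y. harmonic_ratio G0 G s y * indicator {-K..K} y)"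
    "(LBINT y. \<bar>harmonic_ratio G0 G s y * indicator {-K..K} y\<bar>) \<le> 4 * K"
proof -
  note b = harmonic_ratio_bounds[OF assms(1)]
  have i: "has_bochner_integral lborel (\<lambda>y. 2 * indicator {-K..K} y :: real) (2 * (2 * K))"
    using assms by (intro has_bochner_integral_mult_right) (simp add: has_bochner_integral_iff)
  have le: "\<bar>harmonic_ratio G0 G s y * indicator {-K..K} y\<bar> \<le> 2 * indicator {-K..K} y" for y
    using b[of y] by (simp split: split_indicator)
  show *: "integrable lborel (\<lambda>y. harmonic_ratio G0 G s y * indicator {-K..K} y)"
  proof (rule Bochner_Integration.integrable_bound)
    show "integrable lborel (\<lambda>y. 2 * indicator {-K..K} y :: real)" using i by (rule integrable.intros)
    show "AE y in lborel. norm (harmonic_ratio G0 G s y * indicator {-K..K} y) \<le> norm (2 * indicator {-K..K} y :: real)"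
      using le by (intro AE_I2) simp
  qed simp
  have "(LBINT y. \<bar>harmonic_ratio G0 G s y * indicator {-K..K} y\<bar>) \<le> (LBINT y. 2 * indicator {-K..K} y)"
    using * i by (intro integral_mono le) (auto simp: has_bochner_integral_iff)
  also have "\<dots> = 2 * (2 * K)" using i by (rule has_bochner_integral_integral_eq)
  finally show "(LBINT y. \<bar>harmonic_ratio G0 G s y * indicator {-K..K} y\<bar>) \<le> 4 * K" by simp
qed

end

section \<open>Deviations uniform in the estimated prior\<close>

definition char_deviation :: "real measure \<Rightarrow> (nat \<Rightarrow> real) \<Rightarrow> (nat \<Rightarrow> real) \<Rightarrow> nat set \<Rightarrow> real \<Rightarrow> complex" where
  "char_deviation G0 s u J w = (\<Sum>j\<in>J. cis (w * u j) - char (mixture_law G0 (s j)) w)"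

text \<open>The harmonic ratio depends on the coordinate through its noise level. Grouping the
  levels into intervals of width \<tau> lets one function represent each group, at a price already
  contained in \<open>smoothing_error\<close>, and with a number of groups of order 1 /
  \<tau>.\<close>

definition noise_bin :: "real \<Rightarrow> nat \<Rightarrow> (nat \<Rightarrow> real) \<Rightarrow> nat \<Rightarrow> nat set" where
  "noise_bin \<tau> n s b = {j \<in> {..<n}. nat \<lfloor>s j / \<tau>\<rfloor> = b}"

text \<open>The estimate does not occur here, so a single event on which this quantity is small also
  covers an estimate computed from the same data.\<close>

definition deviation_bound :: "real measure \<Rightarrow> real \<Rightarrow> real \<Rightarrow> real \<Rightarrow> nat \<Rightarrow> nat \<Rightarrow> (nat \<Rightarrow> real) \<Rightarrow> (nat \<Rightarrow> real) \<Rightarrow> real" where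
  "deviation_bound G0 m \<tau> K B n s u =
     (\<Sum>j<n. smoothing_error G0 m \<tau> K (s j) (u j)) +
     (\<Sum>j<n. LINT x|mixture_law G0 (s j). smoothing_error G0 m \<tau> K (s j) x) +
     4 * K / (2 * pi) * (\<Sum>b<B. LBINT w. gaussian_weight \<tau> w * cmod (char_deviation G0 s u (noise_bin \<tau> n s b) w))"

lemma real_distribution_return: "real_distribution (return borel (x::real))"
  by (intro real_distribution.intro prob_space_return real_distribution_axioms.intro) auto

lemma char_return: "char (return borel x) w = cis (w * x)"
  unfolding char_eq_cis by (subst integral_return) auto

lemma (in real_distribution) integrable_smoothing_error:
  assumes s: "0 < s" and R: "AE u in M. \<bar>u\<bar> \<le> R" and \<tau>: "0 < \<tau>"
  shows "integrable (mixture_law M s) (smoothing_error M m \<tau> K s)"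
proof -
  interpret L: real_distribution "mixture_law M s" by (rule real_distribution_mixture_law[OF s])
  have 1: "integrable (mixture_law M s) (\<lambda>x. min 2 (8 * \<tau> / m\<^sup>2 / mixture_density M s x))"
  proof (rule L.integrable_const_bound[where B=2])
    have "0 \<le> 8 * \<tau> / m\<^sup>2 / mixture_density M s x" for x
      using mixture_density_pos[OF s, of x] \<tau> by (intro divide_nonneg_nonneg) auto
    then have "norm (min 2 (8 * \<tau> / m\<^sup>2 / mixture_density M s x)) \<le> 2" for x
      by (simp add: abs_le_iff min.coboundedI1)
    then show "AE x in mixture_law M s. norm (min 2 (8 * \<tau> / m\<^sup>2 / mixture_density M s x)) \<le> 2" by simp
  qed measurable
  have 2: "integrable (mixture_law M s) (\<lambda>x. 2 / K\<^sup>2 * (x\<^sup>2 + \<tau>\<^sup>2))"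
    by (intro Bochner_Integration.integrable_add integrable_mult_right mixture_law_second_moment(1)[OF s R] L.integrable_const)
  show ?thesis
    unfolding smoothing_error_def[abs_def] using Bochner_Integration.integrable_add[OF 1 2] .
qed

context two_distributions
begin

lemma harmonic_ratio_deviation:
  assumes m: "0 < m" "\<And>j. j < n \<Longrightarrow> m \<le> s j" and \<tau>: "0 < \<tau>" and K: "0 < K"
    and B: "\<And>j. j < n \<Longrightarrow> s j / \<tau> < real B" and R: "AE u in G0. \<bar>u\<bar> \<le> R"
  shows "\<bar>\<Sum>j<n. harmonic_ratio G0 G (s j) (u j) -
      (LBINT x. harmonic_ratio G0 G (s j) x * mixture_density G0 (s j) x)\<bar> \<le> deviation_bound G0 m \<tau> K B n s u"
proof -
  define bin where "bin j = nat \<lfloor>s j / \<tau>\<rfloor>" for j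
  \<comment> \<open>The right end of the bin: it is positive even for bin 0 and not below any level
    in the bin, so the lower bound \<open>m\<close> is inherited.\<close>
  define c where "c b = \<tau> * (real b + 1)" for b
  define f where "f b y = harmonic_ratio G0 G (c b) y * indicator {-K..K} y" for b y
  define S where "S b = gaussian_smoothing \<tau> (f b)" for b
  define h where "h j = harmonic_ratio G0 G (s j)" for j
  define L where "L j = mixture_law G0 (s j)" for j
  define E where "E j = smoothing_error G0 m \<tau> K (s j)" for j
  have c0: "0 < c b" for b using \<tau> by (simp add: c_def)
  have f: "integrable lborel (f b)" "(LBINT y. \<bar>f b y\<bar>) \<le> 4 * K" for b
    using truncated_ratio_integrable[OF c0 K] unfolding f_def[abs_def] by auto
  have S_meas [measurable]: "S b \<in> borel_measurable borel" for b
    unfolding S_def using gaussian_smoothing_measurable[OF \<tau> f(1)] .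
  have h_meas [measurable]: "h j \<in> borel_measurable borel" for j
    unfolding h_def by measurable
  have [measurable]: "bin j < B" if "j < n" for j
  proof -
    have "0 \<le> s j / \<tau>" using m that \<tau> by (smt (verit) divide_nonneg_pos)
    then show ?thesis using B[OF that] by (simp add: bin_def floor_less_iff nat_less_iff)
  qed
  have close: "\<bar>S (bin j) x - h j x\<bar> \<le> E j x" if "j < n" for j x
    unfolding S_def f_def h_def E_def
  proof (rule truncated_ratio_smoothing[OF m(1) m(2)[OF that] _ \<tau> _ K])
    have s0: "0 \<le> s j / \<tau>" using m that \<tau> by (smt (verit) divide_nonneg_pos)
    then have fl: "real (bin j) = of_int \<lfloor>s j / \<tau>\<rfloor>" by (simp add: bin_def)
    have "real (bin j) \<le> s j / \<tau>" "s j / \<tau> \<le> real (bin j) + 1"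
      unfolding fl by linarith+
    then have le: "\<tau> * real (bin j) \<le> s j" "s j \<le> c (bin j)"
      using \<tau> by (auto simp: c_def field_simps)
    then show "m \<le> c (bin j)" using m(2)[OF that] by linarith
    show "\<bar>s j - c (bin j)\<bar> \<le> \<tau>" using le by (simp add: c_def algebra_simps)
  qed
  have sj: "0 < s j" if "j < n" for j using less_le_trans[OF m(1) m(2)[OF that]] .
  have hb: "\<bar>h j x\<bar> \<le> 2" if "j < n" for j x
    using harmonic_ratio_bounds[OF sj[OF that], of x] by (simp add: h_def)
  have ih: "integrable (L j) (h j)" "integrable (L j) (S (bin j))" "integrable (L j) (E j)" if "j < n" for j
  proof -
    interpret L: real_distribution "L j" unfolding L_def by (rule G0.real_distribution_mixture_law[OF sj[OF that]])
    show 1: "integrable (L j) (h j)" using hb[OF that] by (intro L.integrable_const_bound[where B=2]) auto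
    show 2: "integrable (L j) (E j)"
      unfolding E_def L_def by (rule G0.integrable_smoothing_error[OF sj[OF that] R \<tau>])
    have "integrable (L j) (\<lambda>x. S (bin j) x - h j x)"
    proof (rule Bochner_Integration.integrable_bound[OF 2])
      have "norm (S (bin j) x - h j x) \<le> norm (E j x)" for x
        using close[OF that, of x] by simp
      then show "AE x in L j. norm (S (bin j) x - h j x) \<le> norm (E j x)" by simp
    qed simp
    from Bochner_Integration.integrable_add[OF this 1] show "integrable (L j) (S (bin j))" by simp
  qed
  have term1: "\<bar>h j (u j) - (LINT x|L j. h j x) - (S (bin j) (u j) - (LINT x|L j. S (bin j) x))\<bar>
      \<le> E j (u j) + (LINT x|L j. E j x)" if "j < n" for j
  proof -
    have "\<bar>(LINT x|L j. S (bin j) x) - (LINT x|L j. h j x)\<bar> = \<bar>LINT x|L j. S (bin j) x - h j x\<bar>"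
      using ih[OF that] by simp
    also have "\<dots> \<le> (LINT x|L j. \<bar>S (bin j) x - h j x\<bar>)" by simp
    also have "\<dots> \<le> (LINT x|L j. E j x)"
      using ih[OF that] close[OF that] by (intro integral_mono) auto
    finally show ?thesis using close[OF that, of "u j"] by linarith
  qed
  let ?D = "\<lambda>j. S (bin j) (u j) - (LINT x|L j. S (bin j) x)"
  have "\<bar>\<Sum>j<n. ?D j\<bar> \<le> (\<Sum>b<B. 4 * K / (2 * pi) *
      (LBINT w. gaussian_weight \<tau> w * cmod (char_deviation G0 s u (noise_bin \<tau> n s b) w)))"
  proof -
    have "(\<Sum>j<n. ?D j) = (\<Sum>b<B. \<Sum>j\<in>noise_bin \<tau> n s b. ?D j)"
      unfolding noise_bin_def using \<open>\<And>j. j < n \<Longrightarrow> bin j < B\<close>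
      by (subst sum.group) (auto simp: bin_def)
    also have "\<bar>\<dots>\<bar> \<le> (\<Sum>b<B. \<bar>\<Sum>j\<in>noise_bin \<tau> n s b. ?D j\<bar>)" by (rule sum_abs)
    also have "\<dots> \<le> (\<Sum>b<B. 4 * K / (2 * pi) *
      (LBINT w. gaussian_weight \<tau> w * cmod (char_deviation G0 s u (noise_bin \<tau> n s b) w)))"
    proof (rule sum_mono)
      fix b
      let ?J = "noise_bin \<tau> n s b"
      have J: "j < n" "bin j = b" if "j \<in> ?J" for j using that by (auto simp: noise_bin_def bin_def)
      \<comment> \<open>Evaluation at a data point is written as expectation under a point mass, so
        that \<open>gaussian_smoothing_expectation_diff\<close> compares the empirical with the
        population part.\<close>
      have "(\<Sum>j\<in>?J. ?D j) = (\<Sum>j\<in>?J. (LINT x|return borel (u j). S b x) - (LINT x|L j. S b x))"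
        using J by (intro sum.cong) (auto simp: integral_return)
      also have "\<bar>\<dots>\<bar> \<le> (LBINT y. \<bar>f b y\<bar>) / (2 * pi) * (LBINT w. gaussian_weight \<tau> w *
          cmod (\<Sum>j\<in>?J. char (return borel (u j)) w - char (L j) w))"
        unfolding S_def L_def using J sj
        by (intro gaussian_smoothing_expectation_diff[OF \<tau> f(1)] real_distribution_return G0.real_distribution_mixture_law)
          (auto simp: noise_bin_def)
      also have "\<dots> \<le> 4 * K / (2 * pi) * (LBINT w. gaussian_weight \<tau> w *
          cmod (\<Sum>j\<in>?J. char (return borel (u j)) w - char (L j) w))"
        using f(2)[of b] by (intro mult_right_mono divide_right_mono) (auto intro!: integral_nonneg)
      finally show "\<bar>\<Sum>j\<in>?J. ?D j\<bar> \<le> 4 * K / (2 * pi) * (LBINT w. gaussian_weight \<tau> w * cmod (char_deviation G0 s u ?J w))"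
        by (simp add: char_return char_deviation_def L_def)
    qed
    finally show ?thesis .
  qed
  moreover have "\<bar>(\<Sum>j<n. h j (u j) - (LINT x|L j. h j x)) - (\<Sum>j<n. ?D j)\<bar> \<le> (\<Sum>j<n. E j (u j) + (LINT x|L j. E j x))"
    unfolding sum_subtractf[symmetric] by (rule order_trans[OF sum_abs sum_mono]) (use term1 in auto)
  ultimately have "\<bar>\<Sum>j<n. h j (u j) - (LINT x|L j. h j x)\<bar> \<le> deviation_bound G0 m \<tau> K B n s u"
    unfolding deviation_bound_def E_def[symmetric] L_def[symmetric] sum_distrib_left[symmetric] sum.distrib by linarith
  moreover have "(LINT x|L j. h j x) = (LBINT x. harmonic_ratio G0 G (s j) x * mixture_density G0 (s j) x)" if "j < n" for j
    unfolding L_def using G0.integral_mixture_law[OF sj[OF that] h_meas[of j]] by (simp add: h_def mult.commute)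
  ultimately show ?thesis by (simp add: h_def)
qed

text \<open>Both priors are convolved with the same noise, whose Gaussian factor can be pulled out;
  the rest is the bound of a Fourier transform by the L1 norm.\<close>

lemma char_diff_le:
  assumes s: "0 < s"
  shows "gaussian_weight s w * cmod (char G w - char G0 w) \<le> (LBINT x. \<bar>mixture_density G0 s x - mixture_density G s x\<bar>)"
proof -
  have law: "integrable lborel (\<lambda>x. mixture_density H s x *\<^sub>R cis (w * x))"
    "char (mixture_law H s) w = (CLBINT x. mixture_density H s x *\<^sub>R cis (w * x))" if "real_distribution H" for H
  proof -
    interpret real_distribution H by fact
    have [measurable]: "(\<lambda>x. cis (w * x)) \<in> borel_measurable borel" by measurable
    show "integrable lborel (\<lambda>x. mixture_density H s x *\<^sub>R cis (w * x))"
    proof (rule Bochner_Integration.integrable_bound[OF has_integral_mixture_density(1)[OF s]])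
      show "AE x in lborel. norm (mixture_density H s x *\<^sub>R cis (w * x)) \<le> norm (mixture_density H s x)"
        by (simp add: norm_mult)
    qed measurable
    show "char (mixture_law H s) w = (CLBINT x. mixture_density H s x *\<^sub>R cis (w * x))"
      unfolding char_eq_cis by (rule integral_mixture_law[OF s]) measurable
  qed
  have r: "real_distribution G0" "real_distribution G" by unfold_locales
  note laws = law[OF r(1)] law[OF r(2)]
  have "gaussian_weight s w * cmod (char G w - char G0 w) = cmod (gaussian_weight s w * char G0 w - gaussian_weight s w * char G w)"
    unfolding right_diff_distrib[symmetric] by (simp add: norm_mult norm_minus_commute)
  also have "\<dots> = cmod (char (mixture_law G0 s) w - char (mixture_law G s) w)"
    by (simp add: G0.char_mixture_law[OF s] G.char_mixture_law[OF s])
  also have "\<dots> = cmod (CLBINT x. (mixture_density G0 s x - mixture_density G s x) *\<^sub>R cis (w * x))"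
    unfolding laws scaleR_diff_left Bochner_Integration.integral_diff[OF laws(1) laws(3)] ..
  also have "\<dots> \<le> (LBINT x. cmod ((mixture_density G0 s x - mixture_density G s x) *\<^sub>R cis (w * x)))"
    by (rule integral_norm_bound)
  finally show ?thesis by simp
qed

end

text \<open>Only the average over \<open>j\<close> of the squared L1 distances is controlled, but
  the characteristic functions of \<open>G\<close> and \<open>G0\<close> do not depend on
  \<open>j\<close>. Every coordinate bounds the same difference at \<open>w\<close>, with a weight
  of at least exp (- A w^2 / 2), so the average controls it as well.\<close>

lemma mle_char_bound:
  assumes "real_distribution G0" and mle: "is_arg_max (composite_loglik n \<Sigma> u) (\<lambda>G. G \<in> prob_distributions) G"
    and n: "1 \<le> n" and m: "0 < m" "\<And>j. j < n \<Longrightarrow> m \<le> sd \<Sigma> j" and \<tau>: "0 < \<tau>" and K: "0 < K"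
    and B: "\<And>j. j < n \<Longrightarrow> sd \<Sigma> j / \<tau> < real B" and R: "AE u in G0. \<bar>u\<bar> \<le> R"
    and A: "\<And>j. j < n \<Longrightarrow> (sd \<Sigma> j)\<^sup>2 \<le> A"
    and D: "deviation_bound G0 m \<tau> K B n (sd \<Sigma>) u \<le> n * D\<^sup>2" "0 \<le> D"
  shows "cmod (char G w - char G0 w) \<le> 2 * D * exp (A * w\<^sup>2 / 2)"
proof -
  have "real_distribution G" using mle by (simp add: is_arg_max_def mem_prob_distributions_iff)
  with assms(1) interpret two_distributions G0 G by (rule two_distributions.intro)
  have sd: "0 < sd \<Sigma> j" if "j < n" for j using less_le_trans[OF m(1) m(2)[OF that]] .
  define L where "L j = (LBINT x. \<bar>mixture_density G0 (sd \<Sigma> j) x - mixture_density G (sd \<Sigma> j) x\<bar>)" for j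
  have "(\<Sum>j<n. 1 + (L j)\<^sup>2 / 4) \<le> (\<Sum>j<n. (LBINT x. harmonic_ratio G0 G (sd \<Sigma> j) x * mixture_density G0 (sd \<Sigma> j) x))"
    unfolding L_def using sd by (intro sum_mono harmonic_ratio_population) simp
  also have "\<dots> \<le> (\<Sum>j<n. harmonic_ratio G0 G (sd \<Sigma> j) (u j)) + n * D\<^sup>2"
    using harmonic_ratio_deviation[where s="sd \<Sigma>" and n=n and u=u, OF m \<tau> K B R] D(1) by (simp add: sum_subtractf)
  also have "\<dots> \<le> n + n * D\<^sup>2"
    using mle_harmonic_ratio_le[OF assms(1) mle n] sd by simp
  finally have L: "(\<Sum>j<n. (L j)\<^sup>2) \<le> n * (4 * D\<^sup>2)"
    by (simp add: sum.distrib sum_divide_distrib[symmetric])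
  let ?d = "cmod (char G w - char G0 w)"
  have "exp (- (A * w\<^sup>2)) * ?d\<^sup>2 \<le> (L j)\<^sup>2" if "j < n" for j
  proof -
    have "exp (- (A * w\<^sup>2 / 2)) * ?d \<le> gaussian_weight (sd \<Sigma> j) w * ?d"
    proof (rule mult_right_mono)
      show "exp (- (A * w\<^sup>2 / 2)) \<le> gaussian_weight (sd \<Sigma> j) w"
        using mult_right_mono[OF A[OF that], of "w\<^sup>2"] by (simp add: gaussian_weight_def power_mult_distrib)
    qed simp
    also have "\<dots> \<le> L j" unfolding L_def by (rule char_diff_le[OF sd[OF that]])
    finally have "(exp (- (A * w\<^sup>2 / 2)) * ?d)\<^sup>2 \<le> (L j)\<^sup>2" by (rule power_mono) simp
    moreover have "(exp (- (A * w\<^sup>2 / 2)))\<^sup>2 = exp (- (A * w\<^sup>2))"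
      unfolding exp_double[symmetric] by simp
    ultimately show ?thesis by (simp only: power_mult_distrib)
  qed
  then have "(\<Sum>j<n. exp (- (A * w\<^sup>2)) * ?d\<^sup>2) \<le> (\<Sum>j<n. (L j)\<^sup>2)" by (intro sum_mono) auto
  also note L
  finally have "real n * (exp (- (A * w\<^sup>2)) * ?d\<^sup>2) \<le> real n * (4 * D\<^sup>2)"
    by (simp only: sum_constant card_lessThan)
  then have "exp (- (A * w\<^sup>2)) * ?d\<^sup>2 \<le> 4 * D\<^sup>2"
    by (rule mult_left_le_imp_le) (use n in simp)
  then have "exp (A * w\<^sup>2) * (exp (- (A * w\<^sup>2)) * ?d\<^sup>2) \<le> exp (A * w\<^sup>2) * (4 * D\<^sup>2)"
    by (rule mult_left_mono) simp
  then have "?d\<^sup>2 \<le> 4 * D\<^sup>2 * exp (A * w\<^sup>2)"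
    unfolding mult.assoc[symmetric] mult_exp_exp by (simp add: mult_ac)
  also have "exp (A * w\<^sup>2) = (exp (A * w\<^sup>2 / 2))\<^sup>2"
    unfolding exp_double[symmetric] by simp
  also have "4 * D\<^sup>2 * (exp (A * w\<^sup>2 / 2))\<^sup>2 = (2 * D * exp (A * w\<^sup>2 / 2))\<^sup>2"
    by (simp add: power_mult_distrib)
  finally show ?thesis by (rule power2_le_imp_le) (use D(2) in simp)
qed

section \<open>Hadamard powers of the correlation matrix\<close>

locale covariance =
  fixes n :: nat and \<Sigma> S :: "real mat"
  assumes n_pos: "1 \<le> n"
    and psd: "psd_mat n \<Sigma>" and sqrt_S: "is_psd_sqrt n S \<Sigma>"
    and sd_pos: "\<And>j. j < n \<Longrightarrow> 0 < sd \<Sigma> j"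
begin

definition cor where "cor i j = \<Sigma> $$ (i, j) / (sd \<Sigma> i * sd \<Sigma> j)"
definition cor_norm where "cor_norm = op_norm (cor_mat \<Sigma>)"

lemma carrier: "\<Sigma> \<in> carrier_mat n n" "S \<in> carrier_mat n n"
  using psd sqrt_S by (auto simp: psd_mat_def is_psd_sqrt_def)

lemma S_sym: "i < n \<Longrightarrow> j < n \<Longrightarrow> S $$ (i, j) = S $$ (j, i)"
proof -
  assume ij: "i < n" "j < n"
  have "transpose_mat S = S" using sqrt_S by (simp add: is_psd_sqrt_def psd_mat_def)
  then have "transpose_mat S $$ (i, j) = S $$ (i, j)" by simp
  then show "S $$ (i, j) = S $$ (j, i)" using ij carrier(2) by simp
qed

lemma \<Sigma>_eq: "i < n \<Longrightarrow> j < n \<Longrightarrow> \<Sigma> $$ (i, j) = (\<Sum>k<n. S $$ (i, k) * S $$ (j, k))"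
proof -
  assume ij: "i < n" "j < n"
  have "\<Sigma> $$ (i, j) = (S * S) $$ (i, j)" using sqrt_S by (simp add: is_psd_sqrt_def)
  also have "\<dots> = (\<Sum>k<n. S $$ (i, k) * S $$ (k, j))"
    using ij carrier(2) by (simp add: scalar_prod_def lessThan_atLeast0)
  also have "\<dots> = (\<Sum>k<n. S $$ (i, k) * S $$ (j, k))"
    using ij S_sym by (intro sum.cong) auto
  finally show "\<Sigma> $$ (i, j) = (\<Sum>k<n. S $$ (i, k) * S $$ (j, k))" .
qed

lemma sd_square: "j < n \<Longrightarrow> (sd \<Sigma> j)\<^sup>2 = \<Sigma> $$ (j, j)"
  using sd_pos[of j] by (simp add: sd_def)

text \<open>The rows of \<open>S\<close> scaled to unit length; the correlation matrix is their Gram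
  matrix.\<close>

definition root_row where "root_row i k = S $$ (i, k) / sd \<Sigma> i"

lemma cor_eq: "i < n \<Longrightarrow> j < n \<Longrightarrow> cor i j = (\<Sum>k<n. root_row i k * root_row j k)"
  by (simp add: cor_def \<Sigma>_eq root_row_def sum_divide_distrib)

lemma cor_diag: "i < n \<Longrightarrow> cor i i = 1"
  using sd_square[of i, symmetric] sd_pos[of i] by (simp add: cor_def power2_eq_square)

lemma root_row_unit: "i < n \<Longrightarrow> (\<Sum>k<n. (root_row i k)\<^sup>2) = 1"
  using cor_eq[of i i] cor_diag[of i] by (simp add: power2_eq_square)

lemma \<Sigma>_cor: "i < n \<Longrightarrow> j < n \<Longrightarrow> \<Sigma> $$ (i, j) = sd \<Sigma> i * sd \<Sigma> j * cor i j"
  using sd_pos[of i] sd_pos[of j] by (simp add: cor_def)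

lemma abs_cor_le: "i < n \<Longrightarrow> j < n \<Longrightarrow> \<bar>cor i j\<bar> \<le> 1"
proof -
  assume ij: "i < n" "j < n"
  have "(cor i j)\<^sup>2 \<le> (\<Sum>k<n. (root_row i k)\<^sup>2) * (\<Sum>k<n. (root_row j k)\<^sup>2)"
    unfolding cor_eq[OF ij] by (rule Cauchy_Schwarz_ineq_sum)
  then show ?thesis using ij by (simp add: root_row_unit abs_square_le_1)
qed

lemma dim_cor_mat: "dim_row (cor_mat \<Sigma>) = n" "dim_col (cor_mat \<Sigma>) = n"
  using carrier by (auto simp: cor_mat_def Let_def mat_diag_def)

lemma cor_mat_index: "i < n \<Longrightarrow> j < n \<Longrightarrow> cor_mat \<Sigma> $$ (i, j) = cor i j"
proof -
  assume ij: "i < n" "j < n"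
  let ?f = "\<lambda>i. 1 / sqrt (\<Sigma> $$ (i, i))"
  have "cor_mat \<Sigma> = mat_diag n ?f * \<Sigma> * mat_diag n ?f"
    using carrier by (auto simp: cor_mat_def Let_def)
  also have "\<dots> = mat n n (\<lambda>(i, j). mat n n (\<lambda>(i, j). ?f i * \<Sigma> $$ (i, j)) $$ (i, j) * ?f j)"
    by (subst mat_diag_mult_left[OF carrier(1)], subst mat_diag_mult_right) auto
  finally show ?thesis using ij by (simp add: cor_def sd_def)
qed

definition cor_apply where "cor_apply c i = (\<Sum>j<n. cor i j * c j)"

lemma cor_mat_mult_vec:
  assumes "v \<in> carrier_vec n"
  shows "scalar_prod (cor_mat \<Sigma> *\<^sub>v v) (cor_mat \<Sigma> *\<^sub>v v) = (\<Sum>i<n. (cor_apply (\<lambda>j. v $ j) i)\<^sup>2)"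
proof -
  have "(cor_mat \<Sigma> *\<^sub>v v) $ i = cor_apply (\<lambda>j. v $ j) i" if "i < n" for i
    using assms that dim_cor_mat by (simp add: scalar_prod_def cor_apply_def cor_mat_index lessThan_atLeast0)
  then show ?thesis
    using dim_cor_mat by (simp add: scalar_prod_def lessThan_atLeast0 power2_eq_square)
qed

text \<open>A crude bound from entries of modulus at most 1. It makes the real supremum in
  \<open>op_norm\<close> meaningful and later gives \<open>cor_norm \<le> n\<close>, that is
  \<open>1 \<le> nstar\<close>.\<close>

lemma cor_apply_bound:
  assumes "(\<Sum>j<n. (c j)\<^sup>2) = 1" shows "sqrt (\<Sum>i<n. (cor_apply c i)\<^sup>2) \<le> n"
proof -
  have "(cor_apply c i)\<^sup>2 \<le> n" if "i < n" for i
  proof -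
    have "(cor_apply c i)\<^sup>2 \<le> (\<Sum>j<n. (cor i j)\<^sup>2) * (\<Sum>j<n. (c j)\<^sup>2)"
      unfolding cor_apply_def by (rule Cauchy_Schwarz_ineq_sum)
    also have "\<dots> \<le> (\<Sum>j<n. 1)"
      unfolding assms mult_1_right using abs_cor_le[OF that] by (intro sum_mono) (simp add: abs_square_le_1)
    finally show ?thesis by simp
  qed
  then have "(\<Sum>i<n. (cor_apply c i)\<^sup>2) \<le> (\<Sum>i<n. real n)" by (intro sum_mono) simp
  then have "sqrt (\<Sum>i<n. (cor_apply c i)\<^sup>2) \<le> sqrt ((real n)\<^sup>2)"
    by (intro real_sqrt_le_mono) (simp add: power2_eq_square)
  then show ?thesis by simp
qed

lemma cor_norm_eq: "cor_norm = (SUP v\<in>{v \<in> carrier_vec n. scalar_prod v v = 1}. sqrt (\<Sum>i<n. (cor_apply (\<lambda>j. v $ j) i)\<^sup>2))"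
  unfolding cor_norm_def op_norm_def dim_cor_mat by (rule SUP_cong) (simp_all add: cor_mat_mult_vec)

lemma unit_sum: "v \<in> carrier_vec n \<Longrightarrow> scalar_prod v v = 1 \<Longrightarrow> (\<Sum>j<n. (v $ j)\<^sup>2) = (1::real)"
  by (simp add: scalar_prod_def lessThan_atLeast0 power2_eq_square)

lemma cor_norm_upper:
  assumes "(\<Sum>j<n. (c j)\<^sup>2) = 1" shows "sqrt (\<Sum>i<n. (cor_apply c i)\<^sup>2) \<le> cor_norm"
proof -
  have "sqrt (\<Sum>i<n. (cor_apply (\<lambda>j. Matrix.vec n c $ j) i)\<^sup>2) \<le> cor_norm"
    unfolding cor_norm_eq
  proof (rule cSUP_upper)
    show "Matrix.vec n c \<in> {v \<in> carrier_vec n. scalar_prod v v = 1}"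
      using assms by (simp add: scalar_prod_def lessThan_atLeast0 power2_eq_square)
    show "bdd_above ((\<lambda>v. sqrt (\<Sum>i<n. (cor_apply (\<lambda>j. v $ j) i)\<^sup>2)) ` {v \<in> carrier_vec n. scalar_prod v v = 1})"
      by (rule bdd_aboveI[where M="real n"]) (use cor_apply_bound unit_sum in auto)
  qed
  then show ?thesis by (simp add: cor_apply_def)
qed

lemma unit_exists: "(\<Sum>j<n. ((if j = 0 then 1 else 0 :: real))\<^sup>2) = 1"
  using n_pos by (simp add: if_distrib[of "\<lambda>x. x\<^sup>2"] sum.delta cong: if_cong)

lemma cor_norm_ge_1: "1 \<le> cor_norm"
proof -
  let ?e = "\<lambda>j::nat. if j = 0 then 1 else 0 :: real"
  have "cor_apply ?e 0 = cor 0 0" using n_pos by (simp add: cor_apply_def if_distrib[of "\<lambda>x. _ * x"] sum.delta cong: if_cong)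
  then have "1 = (cor_apply ?e 0)\<^sup>2" using cor_diag[of 0] n_pos by simp
  also have "\<dots> \<le> (\<Sum>i<n. (cor_apply ?e i)\<^sup>2)"
    using n_pos by (intro member_le_sum[where f="\<lambda>i. (cor_apply ?e i)\<^sup>2"]) auto
  finally have "1 \<le> sqrt (\<Sum>i<n. (cor_apply ?e i)\<^sup>2)" by simp
  also have "\<dots> \<le> cor_norm" by (rule cor_norm_upper[OF unit_exists])
  finally show ?thesis .
qed

lemma cor_norm_le_n: "cor_norm \<le> n"
  unfolding cor_norm_eq
proof (rule cSUP_least)
  have "Matrix.vec n (\<lambda>j. if j = 0 then 1 else 0) \<in> {v \<in> carrier_vec n. scalar_prod v v = (1::real)}"
    using unit_exists by (simp add: scalar_prod_def lessThan_atLeast0 power2_eq_square)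
  then show "{v \<in> carrier_vec n. scalar_prod v v = (1::real)} \<noteq> {}" by blast
qed (use cor_apply_bound unit_sum in auto)

lemma cor_form_le: "(\<Sum>i<n. \<Sum>j<n. c i * c j * cor i j) \<le> cor_norm * (\<Sum>i<n. (c i)\<^sup>2)"
proof (cases "(\<Sum>i<n. (c i)\<^sup>2) = 0")
  case True
  then have "c i = 0" if "i < n" for i using that by (simp add: sum_nonneg_eq_0_iff)
  then have "(\<Sum>i<n. \<Sum>j<n. c i * c j * cor i j) = 0" by (intro sum.neutral ballI) simp
  then show ?thesis using True by simp
next
  case False
  define q where "q = (\<Sum>i<n. (c i)\<^sup>2)"
  have q: "0 < q" using False sum_nonneg[of "{..<n}" "\<lambda>i. (c i)\<^sup>2"] by (simp add: q_def)
  define d where "d i = c i / sqrt q" for i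
  have d1: "(\<Sum>i<n. (d i)\<^sup>2) = 1"
    using q by (simp add: d_def power_divide sum_divide_distrib[symmetric] flip: q_def)
  have "(\<Sum>i<n. d i * cor_apply d i)\<^sup>2 \<le> (\<Sum>i<n. (d i)\<^sup>2) * (\<Sum>i<n. (cor_apply d i)\<^sup>2)"
    by (rule Cauchy_Schwarz_ineq_sum)
  then have "(\<Sum>i<n. d i * cor_apply d i) \<le> sqrt (\<Sum>i<n. (cor_apply d i)\<^sup>2)"
    unfolding d1 by (intro real_le_rsqrt) simp
  also have "\<dots> \<le> cor_norm" by (rule cor_norm_upper[OF d1])
  finally have "q * (\<Sum>i<n. d i * cor_apply d i) \<le> q * cor_norm" using q by (intro mult_left_mono) auto
  moreover have "q * (\<Sum>i<n. d i * cor_apply d i) = (\<Sum>i<n. \<Sum>j<n. c i * c j * cor i j)"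
  proof -
    have "q * (d i * (cor i j * d j)) = c i * c j * cor i j" for i j
    proof -
      have "q * (d i * (cor i j * d j)) = q / (sqrt q * sqrt q) * (c i * c j * cor i j)"
        unfolding d_def by simp
      then show ?thesis using q by simp
    qed
    then show ?thesis unfolding cor_apply_def sum_distrib_left by (simp only:)
  qed
  ultimately show ?thesis by (simp add: q_def mult.commute)
qed

text \<open>The Hadamard powers of a correlation matrix inherit its operator norm bound: it is the Gram matrix
  of unit vectors, so the form of its power \<open>k + 1\<close> at \<open>c\<close> is the sum over \<open>l\<close> of the forms of its
  power \<open>k\<close> at \<open>c\<close> times the \<open>l\<close>-th coordinates of these vectors.\<close>

lemma cor_power_form_le:
  "(\<Sum>i<n. \<Sum>j<n. c i * c j * cor i j ^ Suc k) \<le> cor_norm * (\<Sum>i<n. (c i)\<^sup>2)"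
proof (induction k arbitrary: c)
  case 0 then show ?case using cor_form_le by simp
next
  case (Suc k)
  have "(\<Sum>i<n. \<Sum>j<n. c i * c j * cor i j ^ Suc (Suc k)) =
      (\<Sum>i<n. \<Sum>j<n. \<Sum>l<n. (c i * root_row i l) * (c j * root_row j l) * cor i j ^ Suc k)"
  proof (intro sum.cong refl)
    fix i j assume "i \<in> {..<n}" "j \<in> {..<n}"
    then have "cor i j ^ Suc (Suc k) = (\<Sum>l<n. root_row i l * root_row j l) * cor i j ^ Suc k" using cor_eq[of i j] by simp
    then show "c i * c j * cor i j ^ Suc (Suc k) = (\<Sum>l<n. (c i * root_row i l) * (c j * root_row j l) * cor i j ^ Suc k)"
      by (simp only: sum_distrib_left sum_distrib_right mult_ac)
  qed
  also have "\<dots> = (\<Sum>l<n. \<Sum>i<n. \<Sum>j<n. (c i * root_row i l) * (c j * root_row j l) * cor i j ^ Suc k)"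
    by (rule trans[OF sum.cong[OF refl sum.swap] sum.swap])
  also have "\<dots> \<le> (\<Sum>l<n. cor_norm * (\<Sum>i<n. (c i * root_row i l)\<^sup>2))"
    by (intro sum_mono Suc.IH)
  also have "\<dots> = cor_norm * (\<Sum>i<n. (c i)\<^sup>2 * (\<Sum>l<n. (root_row i l)\<^sup>2))"
    unfolding sum_distrib_left[symmetric] power_mult_distrib by (subst sum.swap) (simp add: sum_distrib_left)
  also have "\<dots> = cor_norm * (\<Sum>i<n. (c i)\<^sup>2)" by (simp add: root_row_unit)
  finally show ?case .
qed

text \<open>The exponential is expanded into its power series. The constant term contributes the
  plain double sum, which centring will remove. Each higher term is the form of a Hadamard power of
  the correlation matrix and is bounded with the same factor \<open>cor_norm\<close>, so the
  remaining diagonal series sums back to an exponential.\<close>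

lemma exp_form_le:
  fixes d :: "nat \<Rightarrow> real" and t :: real
  shows "(\<Sum>i<n. \<Sum>j<n. d i * d j * exp (t\<^sup>2 * \<Sigma> $$ (i, j))) \<le>
    (\<Sum>i<n. \<Sum>j<n. d i * d j) + cor_norm * (\<Sum>i<n. (d i)\<^sup>2 * exp (t\<^sup>2 * (sd \<Sigma> i)\<^sup>2))"
proof -
  let ?x = "\<lambda>i j. t\<^sup>2 * \<Sigma> $$ (i, j)"
  have L: "(\<lambda>k. \<Sum>i<n. \<Sum>j<n. d i * d j * (?x i j ^ k /\<^sub>R fact k)) sums (\<Sum>i<n. \<Sum>j<n. d i * d j * exp (?x i j))"
    by (intro sums_sum sums_mult exp_converges)
  let ?y = "\<lambda>i. t\<^sup>2 * (sd \<Sigma> i)\<^sup>2"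
  have "(\<lambda>k. if k = 0 then (\<Sum>i<n. \<Sum>j<n. d i * d j) else 0) sums (\<Sum>i<n. \<Sum>j<n. d i * d j)"
    using sums_single[of 0 "\<lambda>_. (\<Sum>i<n. \<Sum>j<n. d i * d j)"] by simp
  moreover have "(\<lambda>k. cor_norm * (\<Sum>i<n. (d i)\<^sup>2 * (?y i ^ k /\<^sub>R fact k))) sums (cor_norm * (\<Sum>i<n. (d i)\<^sup>2 * exp (?y i)))"
    by (intro sums_sum sums_mult exp_converges)
  ultimately have R: "(\<lambda>k. (if k = 0 then (\<Sum>i<n. \<Sum>j<n. d i * d j) else 0) + cor_norm * (\<Sum>i<n. (d i)\<^sup>2 * (?y i ^ k /\<^sub>R fact k)))
      sums ((\<Sum>i<n. \<Sum>j<n. d i * d j) + cor_norm * (\<Sum>i<n. (d i)\<^sup>2 * exp (?y i)))"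
    by (rule sums_add)
  show ?thesis
  proof (rule sums_le[OF _ L R])
    fix k
    show "(\<Sum>i<n. \<Sum>j<n. d i * d j * (?x i j ^ k /\<^sub>R fact k)) \<le>
       (if k = 0 then (\<Sum>i<n. \<Sum>j<n. d i * d j) else 0) + cor_norm * (\<Sum>i<n. (d i)\<^sup>2 * (?y i ^ k /\<^sub>R fact k))"
    proof (cases k)
      case 0
      then show ?thesis using cor_norm_ge_1 by (simp add: sum_nonneg)
    next
      case (Suc l)
      \<comment> \<open>Covariances become correlations once the standard deviations are moved into
        the coefficients.\<close>
      define c where "c i = d i * sd \<Sigma> i ^ k" for i
      have "(\<Sum>i<n. \<Sum>j<n. d i * d j * (?x i j ^ k /\<^sub>R fact k)) = (\<Sum>i<n. \<Sum>j<n. (t\<^sup>2 ^ k / fact k) * (c i * c j * cor i j ^ k))"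
      proof (intro sum.cong refl)
        fix i j assume "i \<in> {..<n}" "j \<in> {..<n}"
        then show "d i * d j * (?x i j ^ k /\<^sub>R fact k) = (t\<^sup>2 ^ k / fact k) * (c i * c j * cor i j ^ k)"
          by (simp add: \<Sigma>_cor c_def power_mult_distrib divide_inverse)
      qed
      also have "\<dots> = (t\<^sup>2 ^ k / fact k) * (\<Sum>i<n. \<Sum>j<n. c i * c j * cor i j ^ k)"
        by (simp only: sum_distrib_left)
      also have "\<dots> \<le> (t\<^sup>2 ^ k / fact k) * (cor_norm * (\<Sum>i<n. (c i)\<^sup>2))"
        unfolding Suc by (intro mult_left_mono cor_power_form_le) simp
      also have "\<dots> = cor_norm * (\<Sum>i<n. (d i)\<^sup>2 * (?y i ^ k /\<^sub>R fact k))"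
      proof -
        have "(t\<^sup>2 ^ k / fact k) * (c i)\<^sup>2 = (d i)\<^sup>2 * (?y i ^ k /\<^sub>R fact k)" for i
          by (simp add: c_def power_mult_distrib divide_inverse power_mult[symmetric] mult.commute[of k])
        then show ?thesis by (simp only: mult.left_commute[of _ cor_norm] sum_distrib_left)
      qed
      finally show ?thesis using Suc by simp
    qed
  qed
qed

end

section \<open>The law of the observations\<close>

lemma cis_sum: "finite I \<Longrightarrow> cis (\<Sum>i\<in>I. f i) = (\<Prod>i\<in>I. cis (f i))"
  by (induction I rule: finite_induct) (simp_all add: cis_mult[symmetric])

lemma char_linear_combination:
  fixes \<mu> :: "real measure" and a :: "nat \<Rightarrow> real"
  assumes "real_distribution \<mu>" "finite I"
  shows "(CLINT x|PiM I (\<lambda>_. \<mu>). cis (t * (\<Sum>k\<in>I. a k * x k))) = (\<Prod>k\<in>I. char \<mu> (t * a k))"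
proof -
  interpret real_distribution \<mu> by fact
  interpret P: product_prob_space "\<lambda>_. \<mu>" I by unfold_locales
  have "(CLINT x|PiM I (\<lambda>_. \<mu>). cis (t * (\<Sum>k\<in>I. a k * x k))) =
      (CLINT x|PiM I (\<lambda>_. \<mu>). (\<Prod>k\<in>I. cis ((t * a k) * x k)))"
    unfolding sum_distrib_left cis_sum[OF assms(2)] by (simp add: mult.assoc)
  also have "\<dots> = (\<Prod>k\<in>I. CLINT x|\<mu>. cis ((t * a k) * x))"
    by (rule P.product_integral_prod[OF assms(2)]) (auto intro!: integrable_const_bound[where B=1])
  finally show ?thesis by (simp only: char_eq_cis)
qed

lemma char_std_normal_combination:
  fixes a :: "nat \<Rightarrow> real"
  assumes "finite I"
  shows "(CLINT x|PiM I (\<lambda>_. std_normal_distribution). cis (t * (\<Sum>k\<in>I. a k * x k))) =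
    complex_of_real (exp (- (t\<^sup>2 * (\<Sum>k\<in>I. (a k)\<^sup>2)) / 2))"
proof -
  have "(\<Prod>k\<in>I. char std_normal_distribution (t * a k)) = complex_of_real (\<Prod>k\<in>I. exp (- (t * a k)\<^sup>2 / 2))"
    by (simp only: char_std_normal_distribution of_real_prod)
  also have "(\<Prod>k\<in>I. exp (- (t * a k)\<^sup>2 / 2)) = exp (\<Sum>k\<in>I. - (t * a k)\<^sup>2 / 2)"
    by (rule exp_sum[OF assms, symmetric])
  also have "(\<Sum>k\<in>I. - (t * a k)\<^sup>2 / 2) = - (t\<^sup>2 * (\<Sum>k\<in>I. (a k)\<^sup>2)) / 2"
    by (simp add: power_mult_distrib sum_distrib_left sum_negf sum_divide_distrib)
  finally show ?thesis by (simp only: char_linear_combination[OF real_dist_normal_dist assms])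
qed

lemma real_distribution_normal: "0 < s \<Longrightarrow> real_distribution (density lborel (\<lambda>x. ennreal (normal_density 0 s x)))"
  by (intro real_distribution.intro prob_space_normal_density real_distribution_axioms.intro) auto

text \<open>The law is identified by its characteristic function instead of by convolving densities,
  so that vanishing coefficients need no separate treatment.\<close>

lemma distr_std_normal_combination:
  fixes a :: "nat \<Rightarrow> real"
  assumes I: "finite I" and s: "0 < s" "(\<Sum>k\<in>I. (a k)\<^sup>2) = s\<^sup>2"
  shows "distr (PiM I (\<lambda>_. std_normal_distribution)) borel (\<lambda>x. \<Sum>k\<in>I. a k * x k) =
    density lborel (\<lambda>x. ennreal (normal_density 0 s x))"
proof (rule Levy_uniqueness)
  interpret N: real_distribution std_normal_distribution by (rule real_dist_normal_dist)
  interpret P: product_prob_space "\<lambda>_. std_normal_distribution" I by unfold_locales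
  have [measurable]: "(\<lambda>x. \<Sum>k\<in>I. a k * x k) \<in> borel_measurable (PiM I (\<lambda>_. std_normal_distribution))"
    by (intro borel_measurable_sum borel_measurable_times borel_measurable_const) measurable
  show "real_distribution (distr (PiM I (\<lambda>_. std_normal_distribution)) borel (\<lambda>x. \<Sum>k\<in>I. a k * x k))"
    by (intro real_distribution.intro P.prob_space_distr real_distribution_axioms.intro) simp_all
  show "real_distribution (density lborel (\<lambda>x. ennreal (normal_density 0 s x)))"
    by (rule real_distribution_normal[OF s(1)])
  show "char (distr (PiM I (\<lambda>_. std_normal_distribution)) borel (\<lambda>x. \<Sum>k\<in>I. a k * x k)) =
      char (density lborel (\<lambda>x. ennreal (normal_density 0 s x)))"
  proof
    fix t
    have "char (distr (PiM I (\<lambda>_. std_normal_distribution)) borel (\<lambda>x. \<Sum>k\<in>I. a k * x k)) t =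
        complex_of_real (exp (- (t\<^sup>2 * s\<^sup>2) / 2))"
      unfolding char_eq_cis by (subst integral_distr) (simp_all only: char_std_normal_combination[OF I] s(2), measurable)
    moreover have "char (density lborel (\<lambda>x. ennreal (normal_density 0 s x))) t = complex_of_real (exp (- (t\<^sup>2 * s\<^sup>2) / 2))"
    proof -
      have "char (density lborel (\<lambda>x. ennreal (normal_density 0 s x))) t = (CLBINT x. normal_density 0 s x *\<^sub>R cis (t * x))"
        unfolding char_eq_cis by (rule integral_density) auto
      also have "\<dots> = gaussian_weight s t"
        using normal_density_char[OF s(1), of 0 t] by (simp add: scaleR_conv_of_real del: complex_scaleR)
      finally show ?thesis by (simp add: gaussian_weight_def power_mult_distrib mult.commute)
    qed
    ultimately show "char (distr (PiM I (\<lambda>_. std_normal_distribution)) borel (\<lambda>x. \<Sum>k\<in>I. a k * x k)) t =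
      char (density lborel (\<lambda>x. ennreal (normal_density 0 s x))) t" by simp
  qed
qed

locale gaussian_model = covariance n \<Sigma> S + G0: real_distribution G0 for n \<Sigma> S G0
begin

abbreviation "PB \<equiv> PiM {..<n} (\<lambda>_. G0)"
abbreviation "PZ \<equiv> PiM {..<n} (\<lambda>_. std_normal_distribution)"
text \<open>The uniform index is left out; \<open>sequence_model_average\<close> restores it as an
  average over coordinates.\<close>

definition P where "P = PB \<Otimes>\<^sub>M PZ"

sublocale N: real_distribution std_normal_distribution by (rule real_dist_normal_dist)
sublocale PB: product_prob_space "\<lambda>_. G0" "{..<n}" by unfold_locales
sublocale PZ: product_prob_space "\<lambda>_. std_normal_distribution" "{..<n}" by unfold_locales
sublocale PP: pair_prob_space PB PZ by unfold_locales

lemma prob_space_P: "prob_space P" unfolding P_def by unfold_locales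
sublocale P: prob_space P by (rule prob_space_P)

lemma sets_P [measurable_cong]: "sets P = sets (Rn n \<Otimes>\<^sub>M Rn n)"
  unfolding P_def by (intro sets_pair_measure_cong sets_PiM_cong) auto

definition U where "U \<omega> = observation n S (fst \<omega>) (snd \<omega>)"

lemma U_eq: "j < n \<Longrightarrow> U \<omega> j = fst \<omega> j + (\<Sum>k<n. S $$ (j, k) * snd \<omega> k)"
  using carrier(2) by (simp add: U_def observation_def scalar_prod_def lessThan_atLeast0)

lemma component_measurable [measurable]:
  "j < n \<Longrightarrow> (\<lambda>\<omega>. fst \<omega> j) \<in> borel_measurable (Rn n \<Otimes>\<^sub>M Rn n)"
  "j < n \<Longrightarrow> (\<lambda>\<omega>. snd \<omega> j) \<in> borel_measurable (Rn n \<Otimes>\<^sub>M Rn n)"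
  by (rule measurable_compose[OF measurable_fst], rule measurable_component_singleton, simp)
    (rule measurable_compose[OF measurable_snd], rule measurable_component_singleton, simp)

lemma Uj_measurable [measurable]: "j < n \<Longrightarrow> (\<lambda>\<omega>. U \<omega> j) \<in> borel_measurable (Rn n \<Otimes>\<^sub>M Rn n)"
proof -
  assume j: "j < n"
  have "(\<lambda>\<omega>. fst \<omega> j + (\<Sum>k<n. S $$ (j, k) * snd \<omega> k)) \<in> borel_measurable (Rn n \<Otimes>\<^sub>M Rn n)"
    using j component_measurable by (intro borel_measurable_add borel_measurable_sum borel_measurable_times borel_measurable_const) auto
  then show ?thesis using j by (simp add: U_eq)
qed

lemma U_measurable [measurable]: "U \<in> Rn n \<Otimes>\<^sub>M Rn n \<rightarrow>\<^sub>M Rn n"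
proof -
  have "(\<lambda>\<omega>. \<lambda>j\<in>{..<n}. U \<omega> j) \<in> Rn n \<Otimes>\<^sub>M Rn n \<rightarrow>\<^sub>M Rn n"
    by (intro measurable_restrict Uj_measurable) simp
  moreover have "(\<lambda>j\<in>{..<n}. U \<omega> j) = U \<omega>" for \<omega>
    by (auto simp: U_def observation_def restrict_def fun_eq_iff)
  ultimately show ?thesis by simp
qed

lemma noise_variance: "j < n \<Longrightarrow> (\<Sum>k<n. (S $$ (j, k))\<^sup>2) = (sd \<Sigma> j)\<^sup>2"
  using sd_square[of j] \<Sigma>_eq[of j j] by (simp add: power2_eq_square)

text \<open>For a single coordinate the covariance matters only through its diagonal entry.
  Dependence between coordinates enters the argument solely through
  \<open>char_U_diff\<close>.\<close>

lemma joint_law: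
  assumes j: "j < n" and f [measurable]: "f \<in> borel_measurable (borel \<Otimes>\<^sub>M borel)"
  shows "(\<integral>\<^sup>+\<omega>. f (fst \<omega> j, U \<omega> j) \<partial>P) =
    (\<integral>\<^sup>+\<theta>. (\<integral>\<^sup>+x. ennreal (normal_density 0 (sd \<Sigma> j) (x - \<theta>)) * f (\<theta>, x) \<partial>lborel) \<partial>G0)"
proof -
  let ?N = "density lborel (\<lambda>x. ennreal (normal_density 0 (sd \<Sigma> j) x))"
  interpret Nj: real_distribution ?N by (rule real_distribution_normal[OF sd_pos[OF j]])
  have m1: "(\<lambda>\<beta>. \<beta> j) \<in> PB \<rightarrow>\<^sub>M G0" using j by simp
  have m2: "(\<lambda>z. \<Sum>k<n. S $$ (j, k) * z k) \<in> PZ \<rightarrow>\<^sub>M borel"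
    by (intro borel_measurable_sum borel_measurable_times borel_measurable_const) measurable
  have d1: "distr PB G0 (\<lambda>\<beta>. \<beta> j) = G0" using PB.PiM_component[of j] j by simp
  have d2: "distr PZ borel (\<lambda>z. \<Sum>k<n. S $$ (j, k) * z k) = ?N"
    by (rule distr_std_normal_combination) (use sd_pos j noise_variance in auto)
  have law: "G0 \<Otimes>\<^sub>M ?N = distr P (G0 \<Otimes>\<^sub>M borel) (\<lambda>(\<beta>, z). (\<beta> j, \<Sum>k<n. S $$ (j, k) * z k))"
    unfolding P_def using pair_measure_distr[OF m1 m2] unfolding d1 d2 using Nj.sigma_finite_measure_axioms by simp
  let ?g = "\<lambda>(\<theta>, v). f (\<theta>, \<theta> + v)"
  have [measurable]: "?g \<in> borel_measurable (G0 \<Otimes>\<^sub>M borel)" by measurable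
  have m: "(\<lambda>(\<beta>, z). (\<beta> j, \<Sum>k<n. S $$ (j, k) * z k)) \<in> P \<rightarrow>\<^sub>M G0 \<Otimes>\<^sub>M borel"
    unfolding P_def case_prod_beta'
    by (intro measurable_Pair measurable_compose[OF measurable_fst m1] measurable_compose[OF measurable_snd m2])
  have "(\<integral>\<^sup>+\<omega>. f (fst \<omega> j, U \<omega> j) \<partial>P) = (\<integral>\<^sup>+y. ?g y \<partial>distr P (G0 \<Otimes>\<^sub>M borel) (\<lambda>(\<beta>, z). (\<beta> j, \<Sum>k<n. S $$ (j, k) * z k)))"
    using j by (subst nn_integral_distr[OF m]) (auto simp: case_prod_beta' U_eq)
  also have "\<dots> = (\<integral>\<^sup>+\<theta>. (\<integral>\<^sup>+v. f (\<theta>, \<theta> + v) \<partial>?N) \<partial>G0)"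
    unfolding law[symmetric] by (subst Nj.nn_integral_fst[symmetric]) auto
  also have "\<dots> = (\<integral>\<^sup>+\<theta>. (\<integral>\<^sup>+x. ennreal (normal_density 0 (sd \<Sigma> j) (x - \<theta>)) * f (\<theta>, x) \<partial>lborel) \<partial>G0)"
  proof (rule nn_integral_cong)
    fix \<theta>
    have [measurable]: "(\<lambda>v. f (\<theta>, v)) \<in> borel_measurable borel" by measurable
    have "(\<integral>\<^sup>+v. f (\<theta>, \<theta> + v) \<partial>?N) = (\<integral>\<^sup>+v. ennreal (normal_density 0 (sd \<Sigma> j) v) * f (\<theta>, \<theta> + v) \<partial>lborel)"
      by (rule nn_integral_density) measurable
    also have "\<dots> = (\<integral>\<^sup>+x. ennreal (normal_density 0 (sd \<Sigma> j) (x - \<theta>)) * f (\<theta>, x) \<partial>lborel)"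
      by (subst nn_integral_real_affine[where c=1 and t=\<theta> and f="\<lambda>x. ennreal (normal_density 0 (sd \<Sigma> j) (x - \<theta>)) * f (\<theta>, x)"]) simp_all
    finally show "(\<integral>\<^sup>+v. f (\<theta>, \<theta> + v) \<partial>?N) = (\<integral>\<^sup>+x. ennreal (normal_density 0 (sd \<Sigma> j) (x - \<theta>)) * f (\<theta>, x) \<partial>lborel)" .
  qed
  finally show ?thesis .
qed

lemma distr_U:
  assumes j: "j < n" shows "distr P borel (\<lambda>\<omega>. U \<omega> j) = mixture_law G0 (sd \<Sigma> j)"
proof (rule measure_eqI)
  fix A assume "A \<in> sets (distr P borel (\<lambda>\<omega>. U \<omega> j))"
  then have [measurable]: "A \<in> sets borel" by simp
  have "emeasure (distr P borel (\<lambda>\<omega>. U \<omega> j)) A = (\<integral>\<^sup>+\<omega>. indicator A (U \<omega> j) \<partial>P)"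
    using j by (subst nn_integral_distr[symmetric, where f="indicator A" and M'=borel]) auto
  also have "\<dots> = (\<integral>\<^sup>+x. indicator A x \<partial>mixture_law G0 (sd \<Sigma> j))"
    using joint_law[OF j, of "\<lambda>(\<theta>, x). indicator A x"] G0.nn_integral_mixture_law[OF sd_pos[OF j], of "indicator A"] by simp
  finally show "emeasure (distr P borel (\<lambda>\<omega>. U \<omega> j)) A = emeasure (mixture_law G0 (sd \<Sigma> j)) A" by simp
qed simp

lemma
  fixes f :: "real \<Rightarrow> 'b::{banach, second_countable_topology}"
  assumes j: "j < n" and [measurable]: "f \<in> borel_measurable borel"
  shows integral_U: "(LINT \<omega>|P. f (U \<omega> j)) = (LINT x|mixture_law G0 (sd \<Sigma> j). f x)"
    and integrable_U: "integrable (mixture_law G0 (sd \<Sigma> j)) f \<Longrightarrow> integrable P (\<lambda>\<omega>. f (U \<omega> j))"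
proof -
  have [measurable]: "(\<lambda>\<omega>. U \<omega> j) \<in> P \<rightarrow>\<^sub>M borel" using j by measurable
  show "(LINT \<omega>|P. f (U \<omega> j)) = (LINT x|mixture_law G0 (sd \<Sigma> j). f x)"
    unfolding distr_U[OF j, symmetric] by (subst integral_distr) auto
  show "integrable (mixture_law G0 (sd \<Sigma> j)) f \<Longrightarrow> integrable P (\<lambda>\<omega>. f (U \<omega> j))"
    unfolding distr_U[OF j, symmetric] by (subst (asm) integrable_distr_eq) auto
qed

end

section \<open>Second moments of the empirical characteristic functions\<close>

lemma char_uminus: "char \<mu> (- t) = cnj (char \<mu> t)"
proof -
  have "(\<lambda>x. cis (- t * x)) = (\<lambda>x. cnj (cis (t * x)))" by (simp add: cis_cnj)
  then show ?thesis by (simp only: char_eq_cis Bochner_Integration.integral_cnj)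
qed

lemma (in prob_space) expectation_le_sqrt:
  fixes f :: "'a \<Rightarrow> real"
  assumes i: "integrable M f" "integrable M (\<lambda>x. (f x)\<^sup>2)" and le: "(LINT x|M. (f x)\<^sup>2) \<le> c\<^sup>2" and c: "0 < c"
  shows "(LINT x|M. f x) \<le> c"
proof -
  \<comment> \<open>Jensen's inequality in elementary form: f \<le> f^2 / (2 c) + c / 2 is
    integrated.\<close>
  have "(LINT x|M. f x) \<le> (LINT x|M. (f x)\<^sup>2 / (2 * c) + c / 2)"
  proof (rule integral_mono[OF i(1)])
    show "integrable M (\<lambda>x. (f x)\<^sup>2 / (2 * c) + c / 2)" using i(2) by simp
    fix x
    have "0 \<le> (f x - c)\<^sup>2 / (2 * c)" using c by (intro divide_nonneg_pos) auto
    also have "(f x - c)\<^sup>2 / (2 * c) = (f x)\<^sup>2 / (2 * c) + c / 2 - f x"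
      using c by (simp add: power2_diff add_divide_distrib diff_divide_distrib) (simp add: power2_eq_square)
    finally show "f x \<le> (f x)\<^sup>2 / (2 * c) + c / 2" by simp
  qed
  also have "\<dots> = (LINT x|M. (f x)\<^sup>2) / (2 * c) + c / 2" using i(2) by (simp add: prob_space)
  also have "\<dots> \<le> c\<^sup>2 / (2 * c) + c / 2" using le c by (intro add_right_mono divide_right_mono) auto
  also have "\<dots> = c" using c by (simp add: power2_eq_square)
  finally show ?thesis .
qed

context gaussian_model
begin

lemma integrable_cis_P: "f \<in> borel_measurable P \<Longrightarrow> integrable P (\<lambda>\<omega>. cis (f \<omega>))"
  by (rule P.integrable_const_bound[where B=1]) auto

lemma char_U: "j < n \<Longrightarrow> (CLINT \<omega>|P. cis (t * U \<omega> j)) = gaussian_weight (sd \<Sigma> j) t * char G0 t"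
  by (subst integral_U) (simp_all add: char_eq_cis[symmetric] G0.char_mixture_law sd_pos)

text \<open>The two effects are independent, hence the squared modulus. The noise difference is
  Gaussian, and splitting its variance leaves \<open>exp (t\<^sup>2 * \<Sigma> $$ (i, j))\<close> as
  the only trace of dependence.\<close>

lemma char_U_diff:
  assumes ij: "i < n" "j < n" "i \<noteq> j"
  shows "(CLINT \<omega>|P. cis (t * (U \<omega> i - U \<omega> j))) =
    complex_of_real ((cmod (char G0 t))\<^sup>2 * (gaussian_weight (sd \<Sigma> i) t * gaussian_weight (sd \<Sigma> j) t * exp (t\<^sup>2 * \<Sigma> $$ (i, j))))"
proof -
  \<comment> \<open>The difference of two effects as a combination of all of them; coordinates with
    coefficient 0 contribute the factor \<open>char G0 0\<close>, which is 1.\<close>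
  define a where "a k = (if k = i then 1 else if k = j then -1 else 0 :: real)" for k
  define b where "b k = S $$ (i, k) - S $$ (j, k)" for k
  have sum_a: "(\<Sum>k<n. a k * \<beta> k) = \<beta> i - \<beta> j" for \<beta> :: "nat \<Rightarrow> real"
  proof -
    have "(\<Sum>k<n. a k * \<beta> k) = (\<Sum>k<n. (if k = i then \<beta> k else 0) - (if k = j then \<beta> k else 0))"
      using ij(3) by (intro sum.cong) (auto simp: a_def)
    then show ?thesis using ij by (simp add: sum_subtractf)
  qed
  have U: "U (\<beta>, z) i - U (\<beta>, z) j = (\<Sum>k<n. a k * \<beta> k) + (\<Sum>k<n. b k * z k)" for \<beta> z
    unfolding sum_a using ij by (simp add: U_eq b_def left_diff_distrib sum_subtractf)
  have [measurable]: "(\<lambda>\<beta>. \<Sum>k<n. a k * \<beta> k) \<in> borel_measurable PB" "(\<lambda>z. \<Sum>k<n. b k * z k) \<in> borel_measurable PZ"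
    by (intro borel_measurable_sum borel_measurable_times borel_measurable_const; measurable)+
  have int: "integrable (PB \<Otimes>\<^sub>M PZ) (\<lambda>(\<beta>, z). cis (t * (\<Sum>k<n. a k * \<beta> k)) * cis (t * (\<Sum>k<n. b k * z k)))"
    by (rule PP.P.integrable_const_bound[where B=1]) (auto simp: norm_mult)
  have "(CLINT \<omega>|P. cis (t * (U \<omega> i - U \<omega> j))) =
      (CLINT \<omega>|PB \<Otimes>\<^sub>M PZ. (case \<omega> of (\<beta>, z) \<Rightarrow> cis (t * (\<Sum>k<n. a k * \<beta> k)) * cis (t * (\<Sum>k<n. b k * z k))))"
    unfolding P_def by (intro Bochner_Integration.integral_cong) (auto simp: U cis_mult distrib_left)
  also have "\<dots> = (CLINT \<beta>|PB. (CLINT z|PZ. cis (t * (\<Sum>k<n. a k * \<beta> k)) * cis (t * (\<Sum>k<n. b k * z k))))"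
    using PP.integral_fst[OF int] by simp
  also have "\<dots> = (CLINT \<beta>|PB. cis (t * (\<Sum>k<n. a k * \<beta> k))) * (CLINT z|PZ. cis (t * (\<Sum>k<n. b k * z k)))"
    by simp
  also have "(CLINT z|PZ. cis (t * (\<Sum>k<n. b k * z k))) = complex_of_real (exp (- (t\<^sup>2 * (\<Sum>k<n. (b k)\<^sup>2)) / 2))"
    by (rule char_std_normal_combination) simp
  also have "(CLINT \<beta>|PB. cis (t * (\<Sum>k<n. a k * \<beta> k))) = (\<Prod>k<n. char G0 (t * a k))"
    by (rule char_linear_combination) (simp_all add: G0.real_distribution_axioms)
  also have "(\<Prod>k<n. char G0 (t * a k)) = char G0 t * cnj (char G0 t)"
  proof -
    have "(\<Prod>k<n. char G0 (t * a k)) = (\<Prod>k<n. (if k = i then char G0 t else 1) * (if k = j then cnj (char G0 t) else 1))"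
      using ij(3) by (intro prod.cong) (auto simp: a_def G0.char_zero char_uminus)
    then show ?thesis using ij by (simp add: prod.distrib)
  qed
  also have "char G0 t * cnj (char G0 t) = complex_of_real ((cmod (char G0 t))\<^sup>2)"
    by (rule complex_norm_square[symmetric])
  also have "(\<Sum>k<n. (b k)\<^sup>2) = (sd \<Sigma> i)\<^sup>2 + (sd \<Sigma> j)\<^sup>2 - 2 * \<Sigma> $$ (i, j)"
    unfolding noise_variance[OF ij(1), symmetric] noise_variance[OF ij(2), symmetric] \<Sigma>_eq[OF ij(1,2)] b_def
    by (simp add: power2_diff sum.distrib sum_subtractf sum_distrib_left mult.assoc)
  also have "exp (- (t\<^sup>2 * ((sd \<Sigma> i)\<^sup>2 + (sd \<Sigma> j)\<^sup>2 - 2 * \<Sigma> $$ (i, j))) / 2) =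
      gaussian_weight (sd \<Sigma> i) t * gaussian_weight (sd \<Sigma> j) t * exp (t\<^sup>2 * \<Sigma> $$ (i, j))"
    unfolding gaussian_weight_def mult_exp_exp by (rule arg_cong[where f=exp]) (simp add: field_simps power_mult_distrib)
  finally show ?thesis by (simp only: of_real_mult)
qed

definition centred where "centred t \<omega> j = cis (t * U \<omega> j) - char (mixture_law G0 (sd \<Sigma> j)) t"

lemma mean_char: "j < n \<Longrightarrow> char (mixture_law G0 (sd \<Sigma> j)) t = gaussian_weight (sd \<Sigma> j) t * char G0 t"
  by (simp add: G0.char_mixture_law sd_pos)

text \<open>The expression for the off-diagonal covariances is extended to the diagonal: there the
  additional 1 pays for the variance and the exponential term is a nonnegative surplus. Summation
  over all pairs then gives a full quadratic form, as \<open>exp_form_le\<close> requires.\<close>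

lemma centred_covariance:
  assumes ij: "i < n" "j < n"
  shows "integrable P (\<lambda>\<omega>. centred t \<omega> i * cnj (centred t \<omega> j))"
    "Re (CLINT \<omega>|P. centred t \<omega> i * cnj (centred t \<omega> j)) \<le> (if i = j then 1 else 0) +
      (cmod (char G0 t))\<^sup>2 * (gaussian_weight (sd \<Sigma> i) t * gaussian_weight (sd \<Sigma> j) t * exp (t\<^sup>2 * \<Sigma> $$ (i, j)) -
         gaussian_weight (sd \<Sigma> i) t * gaussian_weight (sd \<Sigma> j) t)"
proof -
  define mi mj where "mi = char (mixture_law G0 (sd \<Sigma> i)) t" "mj = char (mixture_law G0 (sd \<Sigma> j)) t"
  let ?A = "(cmod (char G0 t))\<^sup>2" and ?g = "\<lambda>i. gaussian_weight (sd \<Sigma> i) t"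
  have [measurable]: "(\<lambda>\<omega>. U \<omega> i) \<in> borel_measurable P" "(\<lambda>\<omega>. U \<omega> j) \<in> borel_measurable P"
    using ij by measurable
  have expand: "centred t \<omega> i * cnj (centred t \<omega> j) =
      cis (t * (U \<omega> i - U \<omega> j)) - mi * cnj (cis (t * U \<omega> j)) - cis (t * U \<omega> i) * cnj mj + mi * cnj mj" for \<omega>
    by (simp add: centred_def mi_mj_def algebra_simps cis_cnj cis_mult)
  have i1: "integrable P (\<lambda>\<omega>. cis (t * (U \<omega> i - U \<omega> j)))"
    "integrable P (\<lambda>\<omega>. cis (t * U \<omega> j))" "integrable P (\<lambda>\<omega>. cis (t * U \<omega> i))"
    by (rule integrable_cis_P, measurable)+
  have i2: "integrable P (\<lambda>\<omega>. mi * cnj (cis (t * U \<omega> j)))" "integrable P (\<lambda>\<omega>. cis (t * U \<omega> i) * cnj mj)"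
    by (rule integrable_mult_right[OF integrable_cnj[OF i1(2)]], rule integrable_mult_left[OF i1(3)])
  show "integrable P (\<lambda>\<omega>. centred t \<omega> i * cnj (centred t \<omega> j))"
    unfolding expand using i1(1) i2 by (intro Bochner_Integration.integrable_add Bochner_Integration.integrable_diff P.integrable_const)
  have mm: "mi * cnj mj = complex_of_real (?A * (?g i * ?g j))"
    unfolding mi_mj_def mean_char[OF ij(1)] mean_char[OF ij(2)]
    by (simp only: of_real_mult complex_norm_square complex_cnj_mult complex_cnj_complex_of_real mult_ac)
  have "(CLINT \<omega>|P. centred t \<omega> i * cnj (centred t \<omega> j)) = (CLINT \<omega>|P. cis (t * (U \<omega> i - U \<omega> j))) -
      mi * cnj (CLINT \<omega>|P. cis (t * U \<omega> j)) - (CLINT \<omega>|P. cis (t * U \<omega> i)) * cnj mj + mi * cnj mj"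
    unfolding expand using i1 i2 by (simp add: P.prob_space)
  also have "\<dots> = (CLINT \<omega>|P. cis (t * (U \<omega> i - U \<omega> j))) - mi * cnj mj"
    unfolding char_U[OF ij(1)] char_U[OF ij(2)] mean_char[OF ij(1), symmetric] mean_char[OF ij(2), symmetric] mi_mj_def[symmetric] by simp
  finally have *: "Re (CLINT \<omega>|P. centred t \<omega> i * cnj (centred t \<omega> j)) =
      Re (CLINT \<omega>|P. cis (t * (U \<omega> i - U \<omega> j))) - ?A * (?g i * ?g j)"
    unfolding mm by simp
  show "Re (CLINT \<omega>|P. centred t \<omega> i * cnj (centred t \<omega> j)) \<le> (if i = j then 1 else 0) +
      ?A * (?g i * ?g j * exp (t\<^sup>2 * \<Sigma> $$ (i, j)) - ?g i * ?g j)"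
  proof (cases "i = j")
    case True
    have "0 \<le> ?A * (?g i * ?g j * exp (t\<^sup>2 * \<Sigma> $$ (i, j)))" by simp
    then show ?thesis unfolding * using True by (simp add: P.prob_space right_diff_distrib)
  next
    case False
    show ?thesis unfolding * char_U_diff[OF ij False] using False by (simp add: right_diff_distrib)
  qed
qed

text \<open>Subtracting the product of the means cancels the constant term of the power series, and
  the squared Gaussian weight cancels the diagonal exponential of \<open>exp_form_le\<close>
  exactly. Hence the bound is uniform in the frequency \<open>t\<close>. Subsets \<open>J\<close>
  are needed for the bins and cost nothing, since the coefficients outside \<open>J\<close> are set
  to 0.\<close>

lemma char_deviation_second_moment:
  assumes J: "J \<subseteq> {..<n}"
  shows "integrable P (\<lambda>\<omega>. (cmod (char_deviation G0 (sd \<Sigma>) (U \<omega>) J t))\<^sup>2)"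
    "(LINT \<omega>|P. (cmod (char_deviation G0 (sd \<Sigma>) (U \<omega>) J t))\<^sup>2) \<le> 2 * n * cor_norm"
proof -
  have fin: "finite J" using J finite_subset by blast
  define d where "d i = (if i \<in> J then gaussian_weight (sd \<Sigma> i) t else 0)" for i
  let ?A = "(cmod (char G0 t))\<^sup>2" and ?g = "\<lambda>i. gaussian_weight (sd \<Sigma> i) t"
  have eq: "(cmod (char_deviation G0 (sd \<Sigma>) (U \<omega>) J t))\<^sup>2 = (\<Sum>i\<in>J. \<Sum>j\<in>J. Re (centred t \<omega> i * cnj (centred t \<omega> j)))" for \<omega>
  proof -
    have "complex_of_real ((cmod (char_deviation G0 (sd \<Sigma>) (U \<omega>) J t))\<^sup>2) = (\<Sum>i\<in>J. centred t \<omega> i) * cnj (\<Sum>j\<in>J. centred t \<omega> j)"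
      unfolding complex_norm_square char_deviation_def centred_def ..
    also have "\<dots> = (\<Sum>i\<in>J. \<Sum>j\<in>J. centred t \<omega> i * cnj (centred t \<omega> j))"
      by (simp only: cnj_sum sum_product)
    finally show ?thesis by - (drule arg_cong[where f=Re], simp only: Re_complex_of_real Re_sum)
  qed
  have int: "integrable P (\<lambda>\<omega>. Re (centred t \<omega> i * cnj (centred t \<omega> j)))" if "i \<in> J" "j \<in> J" for i j
    using centred_covariance(1) that J by (intro integrable_Re) auto
  show "integrable P (\<lambda>\<omega>. (cmod (char_deviation G0 (sd \<Sigma>) (U \<omega>) J t))\<^sup>2)"
    unfolding eq using int by (intro Bochner_Integration.integrable_sum)
  have "(LINT \<omega>|P. (cmod (char_deviation G0 (sd \<Sigma>) (U \<omega>) J t))\<^sup>2) =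
      (\<Sum>i\<in>J. \<Sum>j\<in>J. LINT \<omega>|P. Re (centred t \<omega> i * cnj (centred t \<omega> j)))"
    unfolding eq using int by (simp add: Bochner_Integration.integral_sum Bochner_Integration.integrable_sum del: times_complex.simps)
  also have "\<dots> \<le> (\<Sum>i\<in>J. \<Sum>j\<in>J. (if i = j then 1 else 0) + ?A * (?g i * ?g j * exp (t\<^sup>2 * \<Sigma> $$ (i, j)) - ?g i * ?g j))"
  proof (intro sum_mono)
    fix i j assume "i \<in> J" "j \<in> J"
    then have ij: "i < n" "j < n" using J by auto
    have "(LINT \<omega>|P. Re (centred t \<omega> i * cnj (centred t \<omega> j))) = Re (CLINT \<omega>|P. centred t \<omega> i * cnj (centred t \<omega> j))"
      by (rule integral_Re[OF centred_covariance(1)[OF ij]])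
    then show "(LINT \<omega>|P. Re (centred t \<omega> i * cnj (centred t \<omega> j))) \<le>
       (if i = j then 1 else 0) + ?A * (?g i * ?g j * exp (t\<^sup>2 * \<Sigma> $$ (i, j)) - ?g i * ?g j)"
      using centred_covariance(2)[OF ij] by simp
  qed
  also have "\<dots> = card J + ?A * (\<Sum>i\<in>J. \<Sum>j\<in>J. ?g i * ?g j * exp (t\<^sup>2 * \<Sigma> $$ (i, j)) - ?g i * ?g j)"
    unfolding sum.distrib sum_distrib_left[symmetric] using fin by simp
  also have "\<dots> \<le> n + 1 * (cor_norm * n)"
  proof (rule add_mono)
    show "real (card J) \<le> n" using card_mono[OF _ J] by simp
    have restrict: "(\<Sum>i\<in>J. \<Sum>j\<in>J. ?g i * ?g j * c i j) = (\<Sum>i<n. \<Sum>j<n. d i * d j * c i j)" for c :: "nat \<Rightarrow> nat \<Rightarrow> real"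
    proof -
      have "(\<Sum>i\<in>J. \<Sum>j\<in>J. ?g i * ?g j * c i j) = (\<Sum>i\<in>J. \<Sum>j<n. d i * d j * c i j)"
        using J by (intro sum.cong refl sum.mono_neutral_cong_left) (auto simp: d_def)
      also have "\<dots> = (\<Sum>i<n. \<Sum>j<n. d i * d j * c i j)"
        using J by (intro sum.mono_neutral_left) (auto simp: d_def)
      finally show ?thesis .
    qed
    have "(\<Sum>i\<in>J. \<Sum>j\<in>J. ?g i * ?g j * exp (t\<^sup>2 * \<Sigma> $$ (i, j)) - ?g i * ?g j) =
      (\<Sum>i<n. \<Sum>j<n. d i * d j * exp (t\<^sup>2 * \<Sigma> $$ (i, j))) - (\<Sum>i<n. \<Sum>j<n. d i * d j)"
      using restrict[of "\<lambda>i j. exp (t\<^sup>2 * \<Sigma> $$ (i, j))"] restrict[of "\<lambda>i j. 1"] by (simp add: sum_subtractf)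
    also have "\<dots> \<le> cor_norm * (\<Sum>i<n. (d i)\<^sup>2 * exp (t\<^sup>2 * (sd \<Sigma> i)\<^sup>2))"
      using exp_form_le[of d t] by simp
    also have "\<dots> \<le> cor_norm * (\<Sum>i<n. 1)"
    proof (intro mult_left_mono sum_mono)
      fix i
      have "(?g i)\<^sup>2 * exp (t\<^sup>2 * (sd \<Sigma> i)\<^sup>2) = 1"
        by (simp add: gaussian_weight_def power2_eq_square mult_exp_exp algebra_simps)
      then show "(d i)\<^sup>2 * exp (t\<^sup>2 * (sd \<Sigma> i)\<^sup>2) \<le> 1" by (simp add: d_def)
    qed (use cor_norm_ge_1 in simp)
    finally have B: "(\<Sum>i\<in>J. \<Sum>j\<in>J. ?g i * ?g j * exp (t\<^sup>2 * \<Sigma> $$ (i, j)) - ?g i * ?g j) \<le> cor_norm * n" by simp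
    have A: "?A \<le> 1" using G0.cmod_char_le_1[of t] by (simp add: power_le_one)
    have "?A * (\<Sum>i\<in>J. \<Sum>j\<in>J. ?g i * ?g j * exp (t\<^sup>2 * \<Sigma> $$ (i, j)) - ?g i * ?g j) \<le> ?A * (cor_norm * n)"
      by (rule mult_left_mono[OF B]) simp
    also have "\<dots> \<le> 1 * (cor_norm * n)" using A cor_norm_ge_1 by (intro mult_right_mono) auto
    finally show "?A * (\<Sum>i\<in>J. \<Sum>j\<in>J. ?g i * ?g j * exp (t\<^sup>2 * \<Sigma> $$ (i, j)) - ?g i * ?g j) \<le> 1 * (cor_norm * n)" .
  qed
  also have "\<dots> \<le> 2 * n * cor_norm"
    using mult_left_mono[OF cor_norm_ge_1, of "real n"] by (simp add: mult.commute)
  finally show "(LINT \<omega>|P. (cmod (char_deviation G0 (sd \<Sigma>) (U \<omega>) J t))\<^sup>2) \<le> 2 * n * cor_norm" .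
qed

definition bin_deviation where
  "bin_deviation \<tau> J \<omega> = (LBINT w. gaussian_weight \<tau> w * cmod (char_deviation G0 (sd \<Sigma>) (U \<omega>) J w))"

text \<open>By Fubini the second moment may be taken frequency by frequency; as its bound does not
  depend on the frequency, only the total mass of the Gaussian weight appears.\<close>

lemma bin_deviation_expectation:
  assumes J: "J \<subseteq> {..<n}" and \<tau>: "0 < \<tau>"
  shows "integrable P (bin_deviation \<tau> J)" "(LINT \<omega>|P. bin_deviation \<tau> J \<omega>) \<le> sqrt (2 * pi) / \<tau> * sqrt (2 * n * cor_norm)"
proof -
  let ?D = "\<lambda>\<omega> w. cmod (char_deviation G0 (sd \<Sigma>) (U \<omega>) J w)"
  have fin: "finite J" using J finite_subset by blast
  interpret PL: pair_sigma_finite P lborel by unfold_locales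
  have mD [measurable]: "(\<lambda>(\<omega>, w). ?D \<omega> w) \<in> borel_measurable (P \<Otimes>\<^sub>M lborel)"
  proof -
    have "(\<lambda>(\<omega>, w). char_deviation G0 (sd \<Sigma>) (U \<omega>) J w) \<in> borel_measurable (P \<Otimes>\<^sub>M lborel)"
      unfolding char_deviation_def case_prod_beta'
    proof (intro borel_measurable_sum borel_measurable_diff)
      fix j assume "j \<in> J"
      then have j: "j < n" using J by auto
      interpret L: real_distribution "mixture_law G0 (sd \<Sigma> j)" by (rule G0.real_distribution_mixture_law[OF sd_pos[OF j]])
      have [measurable]: "(\<lambda>\<omega>. U \<omega> j) \<in> borel_measurable P" using j by measurable
      show "(\<lambda>x. cis (snd x * U (fst x) j)) \<in> borel_measurable (P \<Otimes>\<^sub>M lborel)" by measurable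
      show "(\<lambda>x. char (mixture_law G0 (sd \<Sigma> j)) (snd x)) \<in> borel_measurable (P \<Otimes>\<^sub>M lborel)" by measurable
    qed
    then show ?thesis by (simp add: case_prod_beta')
  qed
  have bound: "?D \<omega> w \<le> 2 * card J" for \<omega> w
  proof -
    have "?D \<omega> w \<le> (\<Sum>j\<in>J. 2)"
      unfolding char_deviation_def
    proof (rule sum_norm_le)
      fix j assume "j \<in> J"
      then have j: "j < n" using J by auto
      interpret L: real_distribution "mixture_law G0 (sd \<Sigma> j)" by (rule G0.real_distribution_mixture_law[OF sd_pos[OF j]])
      show "cmod (cis (w * U \<omega> j) - char (mixture_law G0 (sd \<Sigma> j)) w) \<le> 2"
        using norm_triangle_ineq4[of "cis (w * U \<omega> j)" "char (mixture_law G0 (sd \<Sigma> j)) w"] L.cmod_char_le_1[of w] by simp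
    qed
    then show ?thesis by simp
  qed
  have gw: "integrable lborel (\<lambda>w. gaussian_weight \<tau> w * c)" for c
    using gaussian_weight_integral[OF \<tau>] by (simp add: has_bochner_integral_iff)
  have iw: "integrable lborel (\<lambda>w. gaussian_weight \<tau> w * ?D \<omega> w)" if "\<omega> \<in> space P" for \<omega>
  proof (rule Bochner_Integration.integrable_bound[OF gw[of "2 * card J"]])
    show "(\<lambda>w. gaussian_weight \<tau> w * ?D \<omega> w) \<in> borel_measurable lborel"
      using measurable_compose[OF measurable_Pair1'[OF that] mD] by simp
    show "AE w in lborel. norm (gaussian_weight \<tau> w * ?D \<omega> w) \<le> norm (gaussian_weight \<tau> w * (2 * card J))"
      using bound by (intro AE_I2) (simp add: abs_mult mult_left_mono)
  qed
  have int: "integrable (P \<Otimes>\<^sub>M lborel) (\<lambda>(\<omega>, w). gaussian_weight \<tau> w * ?D \<omega> w)"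
  proof (rule PL.Fubini_integrable)
    show "AE \<omega> in P. integrable lborel (\<lambda>w. case (\<omega>, w) of (\<omega>, w) \<Rightarrow> gaussian_weight \<tau> w * ?D \<omega> w)"
      using iw by (intro AE_I2) simp
    show "integrable P (\<lambda>\<omega>. LBINT w. norm (case (\<omega>, w) of (\<omega>, w) \<Rightarrow> gaussian_weight \<tau> w * ?D \<omega> w))"
    proof (rule P.integrable_const_bound[where B="LBINT w. gaussian_weight \<tau> w * (2 * card J)"])
      show "AE \<omega> in P. norm (LBINT w. norm (case (\<omega>, w) of (\<omega>, w) \<Rightarrow> gaussian_weight \<tau> w * ?D \<omega> w)) \<le> (LBINT w. gaussian_weight \<tau> w * (2 * card J))"
      proof (rule AE_I2)
        fix \<omega> assume \<omega>: "\<omega> \<in> space P"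
        have "norm (LBINT w. norm (case (\<omega>, w) of (\<omega>, w) \<Rightarrow> gaussian_weight \<tau> w * ?D \<omega> w)) = (LBINT w. gaussian_weight \<tau> w * ?D \<omega> w)"
          by (simp add: abs_mult integral_nonneg)
        also have "\<dots> \<le> (LBINT w. gaussian_weight \<tau> w * (2 * card J))"
          by (rule integral_mono[OF iw[OF \<omega>] gw]) (intro mult_left_mono bound gaussian_weight_nonneg)
        finally show "norm (LBINT w. norm (case (\<omega>, w) of (\<omega>, w) \<Rightarrow> gaussian_weight \<tau> w * ?D \<omega> w)) \<le> (LBINT w. gaussian_weight \<tau> w * (2 * card J))" .
      qed
    qed measurable
  qed measurable
  show "integrable P (bin_deviation \<tau> J)"
    unfolding bin_deviation_def[abs_def] using PL.integrable_fst[OF int] by simp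
  have "(LINT \<omega>|P. bin_deviation \<tau> J \<omega>) = (LBINT w. (LINT \<omega>|P. gaussian_weight \<tau> w * ?D \<omega> w))"
    unfolding bin_deviation_def using PL.Fubini_integral[OF int] by simp
  also have "\<dots> \<le> (LBINT w. gaussian_weight \<tau> w * sqrt (2 * n * cor_norm))"
  proof (rule integral_mono[OF _ gw])
    show "integrable lborel (\<lambda>w. LINT \<omega>|P. gaussian_weight \<tau> w * ?D \<omega> w)"
      using PL.integrable_snd[OF int] by simp
    fix w
    have "(LINT \<omega>|P. ?D \<omega> w) \<le> sqrt (2 * n * cor_norm)"
    proof (rule P.expectation_le_sqrt)
      show "integrable P (\<lambda>\<omega>. ?D \<omega> w)"
      proof (rule P.integrable_const_bound[where B="2 * card J"])
        show "(\<lambda>\<omega>. ?D \<omega> w) \<in> borel_measurable P" by measurable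
      qed (use bound in auto)
      show "integrable P (\<lambda>\<omega>. (?D \<omega> w)\<^sup>2)" by (rule char_deviation_second_moment(1)[OF J])
      show "(LINT \<omega>|P. (?D \<omega> w)\<^sup>2) \<le> (sqrt (2 * n * cor_norm))\<^sup>2"
        using char_deviation_second_moment(2)[OF J, of w] cor_norm_ge_1 by simp
      show "0 < sqrt (2 * n * cor_norm)" using n_pos cor_norm_ge_1 by simp
    qed
    then show "(LINT \<omega>|P. gaussian_weight \<tau> w * ?D \<omega> w) \<le> gaussian_weight \<tau> w * sqrt (2 * n * cor_norm)"
      by (simp add: mult_left_mono)
  qed
  also have "\<dots> = sqrt (2 * pi) / \<tau> * sqrt (2 * n * cor_norm)"
    using gaussian_weight_integral[OF \<tau>] by (simp add: has_bochner_integral_iff)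
  finally show "(LINT \<omega>|P. bin_deviation \<tau> J \<omega>) \<le> sqrt (2 * pi) / \<tau> * sqrt (2 * n * cor_norm)" .
qed

end

section \<open>Deconvolution\<close>

text \<open>A Lipschitz stand-in for the indicator of \<open>{..a}\<close>: it is 1 up to
  \<open>a\<close> and falls linearly to 0 at \<open>a + d\<close>.\<close>

definition ramp :: "real \<Rightarrow> real \<Rightarrow> real \<Rightarrow> real" where
  "ramp a d y = max 0 (min 1 ((a + d - y) / d))"

lemma ramp_bounds: "0 \<le> ramp a d y" "ramp a d y \<le> 1" "0 < d \<Longrightarrow> y \<le> a \<Longrightarrow> ramp a d y = 1" "0 < d \<Longrightarrow> a + d < y \<Longrightarrow> ramp a d y = 0"
  by (auto simp: ramp_def divide_nonpos_pos)

lemma ramp_lipschitz: assumes "0 < d" shows "\<bar>ramp a d y - ramp a d z\<bar> \<le> \<bar>y - z\<bar> / d"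
proof -
  have "\<bar>ramp a d y - ramp a d z\<bar> \<le> \<bar>(a + d - y) / d - (a + d - z) / d\<bar>"
    unfolding ramp_def by linarith
  also have "(a + d - y) / d - (a + d - z) / d = (z - y) / d" by (simp add: diff_divide_distrib[symmetric])
  finally show ?thesis using assms by (simp add: abs_minus_commute)
qed

lemma ramp_measurable [measurable]: "ramp a d \<in> borel_measurable borel"
  unfolding ramp_def by measurable

text \<open>Interpolates between a trivial bound and one that grows with the frequency; a small
  exponent tames the growth.\<close>

lemma min_le_powr:
  fixes y \<alpha> :: real
  assumes "0 \<le> y" "0 < \<alpha>" "\<alpha> \<le> 1" shows "min 1 y \<le> y powr \<alpha>"
proof (cases "y \<le> 1")
  case True
  then have "y powr 1 \<le> y powr \<alpha>" using assms by (intro powr_mono') auto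
  then show ?thesis using assms by simp
next
  case False
  then show ?thesis using assms by (simp add: ge_one_powr_ge_zero)
qed

definition deconvolution_error :: "real \<Rightarrow> real \<Rightarrow> real \<Rightarrow> real" where
  "deconvolution_error D A \<tau> = 2 * D powr (\<tau>\<^sup>2 / (2 * A)) / \<tau>"

context two_distributions
begin

text \<open>The bound on the difference grows like exp (A w^2 / 2), faster than the weight decays
  when \<tau> is small. Since the difference never exceeds 2, it can be interpolated with exponent
  \<alpha> = \<tau>^2 / (2 A): the growth becomes exp ((\<tau> w)^2 / 4), which uses up half of the
  decay of the weight. The price is \<open>D powr \<alpha>\<close> in place of \<open>D\<close>, and
  this turns a polynomial rate into a logarithmic one.\<close>

lemma char_close_integral:
  assumes \<tau>: "0 < \<tau>" and A: "0 < A" "\<tau>\<^sup>2 \<le> 2 * A" and D: "0 < D"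
    and close: "\<And>w. cmod (char G w - char G0 w) \<le> 2 * D * exp (A * w\<^sup>2 / 2)"
  shows "(LBINT w. gaussian_weight \<tau> w * cmod (char G w - char G0 w)) \<le> 2 * pi * deconvolution_error D A \<tau>"
proof -
  define \<alpha> where "\<alpha> = \<tau>\<^sup>2 / (2 * A)"
  have \<alpha>: "0 < \<alpha>" "\<alpha> \<le> 1" using \<tau> A by (auto simp: \<alpha>_def)
  have le: "cmod (char G w - char G0 w) \<le> 2 * (D powr \<alpha> * exp ((\<tau> * w)\<^sup>2 / 4))" for w
  proof -
    let ?y = "D * exp (A * w\<^sup>2 / 2)"
    have "cmod (char G w - char G0 w) \<le> 2"
      using norm_triangle_ineq4[of "char G w" "char G0 w"] G.cmod_char_le_1[of w] G0.cmod_char_le_1[of w] by linarith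
    then have "cmod (char G w - char G0 w) \<le> 2 * min 1 ?y" using close[of w] by (auto simp: min_def)
    also have "\<dots> \<le> 2 * ?y powr \<alpha>" using D \<alpha> by (intro mult_left_mono min_le_powr) auto
    also have "?y powr \<alpha> = D powr \<alpha> * exp (A * w\<^sup>2 / 2) powr \<alpha>" using D by (simp add: powr_mult)
    also have "exp (A * w\<^sup>2 / 2) powr \<alpha> = exp ((\<tau> * w)\<^sup>2 / 4)"
      using A by (simp add: powr_def \<alpha>_def power_mult_distrib)
    finally show ?thesis .
  qed
  have gw: "gaussian_weight \<tau> w * (2 * (D powr \<alpha> * exp ((\<tau> * w)\<^sup>2 / 4))) = 2 * D powr \<alpha> * gaussian_weight (\<tau> / sqrt 2) w" for w
  proof -
    have "gaussian_weight \<tau> w * exp ((\<tau> * w)\<^sup>2 / 4) = gaussian_weight (\<tau> / sqrt 2) w"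
      unfolding gaussian_weight_def mult_exp_exp by (rule arg_cong[where f=exp]) (simp add: power_mult_distrib power_divide)
    then show ?thesis by (simp add: mult.left_commute)
  qed
  have i: "has_bochner_integral lborel (\<lambda>w. 2 * D powr \<alpha> * gaussian_weight (\<tau> / sqrt 2) w) (2 * D powr \<alpha> * (sqrt (2 * pi) / (\<tau> / sqrt 2)))"
    using \<tau> by (intro has_bochner_integral_mult_right gaussian_weight_integral) simp
  have le': "gaussian_weight \<tau> w * cmod (char G w - char G0 w) \<le> 2 * D powr \<alpha> * gaussian_weight (\<tau> / sqrt 2) w" for w
    using mult_left_mono[OF le[of w] gaussian_weight_nonneg[of \<tau> w]] unfolding gw .
  have int: "integrable lborel (\<lambda>w. gaussian_weight \<tau> w * cmod (char G w - char G0 w))"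
  proof (rule Bochner_Integration.integrable_bound)
    show "integrable lborel (\<lambda>w. 2 * D powr \<alpha> * gaussian_weight (\<tau> / sqrt 2) w)" using i by (rule integrable.intros)
    show "AE w in lborel. norm (gaussian_weight \<tau> w * cmod (char G w - char G0 w)) \<le> norm (2 * D powr \<alpha> * gaussian_weight (\<tau> / sqrt 2) w)"
      using le' by (intro AE_I2) (simp add: abs_mult)
  qed measurable
  have "(LBINT w. gaussian_weight \<tau> w * cmod (char G w - char G0 w)) \<le> (LBINT w. 2 * D powr \<alpha> * gaussian_weight (\<tau> / sqrt 2) w)"
    by (rule integral_mono[OF int _ le']) (rule integrable.intros[OF i])
  also have "\<dots> = 2 * D powr \<alpha> * (sqrt (2 * pi) / (\<tau> / sqrt 2))" using i by (rule has_bochner_integral_integral_eq)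
  also have "\<dots> = 2 * (2 * sqrt pi) * D powr \<alpha> / \<tau>" by (simp add: real_sqrt_mult)
  also have "\<dots> \<le> 2 * (2 * pi) * D powr \<alpha> / \<tau>"
  proof -
    have "sqrt pi \<le> pi"
      using pi_ge_two real_le_lsqrt[of pi pi] mult_left_mono[of 1 pi pi] by (simp add: power2_eq_square)
    then show ?thesis using \<tau> by (intro divide_right_mono mult_right_mono) auto
  qed
  finally show ?thesis by (simp add: deconvolution_error_def \<alpha>_def)
qed

text \<open>Smoothing moves each of the two expectations by at most \<open>L * \<tau>\<close>. For
  the smoothed function the Fourier bound applies, and domination by a normal density makes the L1
  norm at most 1.\<close>

lemma kernel_expectation_diff:
  assumes \<tau>: "0 < \<tau>" and A: "0 < A" "\<tau>\<^sup>2 \<le> 2 * A" and D: "0 < D"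
    and close: "\<And>w. cmod (char G w - char G0 w) \<le> 2 * D * exp (A * w\<^sup>2 / 2)"
    and s: "0 < s" and [measurable]: "f \<in> borel_measurable borel"
    and f: "\<And>y. 0 \<le> f y" "\<And>y. f y \<le> normal_density 0 s (u - y)"
    and L: "\<And>y z. \<bar>f y - f z\<bar> \<le> L * \<bar>y - z\<bar>" "0 \<le> L"
  shows "\<bar>(LINT y|G. f y) - (LINT y|G0. f y)\<bar> \<le> 2 * L * \<tau> + deconvolution_error D A \<tau>"
proof -
  let ?S = "gaussian_smoothing \<tau> f"
  have nd: "has_bochner_integral lborel (\<lambda>y. normal_density 0 s (u - y)) 1"
    unfolding normal_density_zero_diff using s by (simp add: has_bochner_integral_iff)
  have fi: "integrable lborel f"
  proof (rule Bochner_Integration.integrable_bound)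
    show "integrable lborel (\<lambda>y. normal_density 0 s (u - y))" using nd by (rule integrable.intros)
    show "AE y in lborel. norm (f y) \<le> norm (normal_density 0 s (u - y))" using f by (intro AE_I2) simp
  qed simp
  have f1: "(LBINT y. \<bar>f y\<bar>) \<le> 1"
  proof -
    have "(LBINT y. \<bar>f y\<bar>) \<le> (LBINT y. normal_density 0 s (u - y))"
      using fi nd f by (intro integral_mono) (auto simp: has_bochner_integral_iff)
    then show ?thesis using nd by (simp add: has_bochner_integral_iff)
  qed
  have close_S: "\<bar>?S x - f x\<bar> \<le> L * \<tau>" for x
    using gaussian_smoothing_close[OF \<tau>, of f L "f x" 0 x 0] L by (simp add: abs_minus_commute)
  have fb: "\<bar>f x\<bar> \<le> 1 / (2 * s)" for x using f[of x] normal_density_zero_le[OF s, of "u - x"] by simp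
  have [measurable]: "?S \<in> borel_measurable borel" by (rule gaussian_smoothing_measurable[OF \<tau> fi])
  have diff: "\<bar>(LINT y|H. ?S y) - (LINT y|H. f y)\<bar> \<le> L * \<tau>" if "real_distribution H" for H
  proof -
    interpret H: real_distribution H by fact
    have i1: "integrable H f" using fb by (intro H.integrable_const_bound[where B="1 / (2 * s)"]) auto
    have i2: "integrable H (\<lambda>x. ?S x - f x)" using close_S by (intro H.integrable_const_bound[where B="L * \<tau>"]) auto
    have i3: "integrable H ?S" using Bochner_Integration.integrable_add[OF i2 i1] by simp
    have "(LINT y|H. ?S y) - (LINT y|H. f y) = (LINT y|H. ?S y - f y)" using i1 i3 by simp
    also have "\<bar>\<dots>\<bar> \<le> (LINT y|H. \<bar>?S y - f y\<bar>)" by simp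
    also have "\<dots> \<le> (LINT y|H. L * \<tau>)"
      using close_S i2 by (intro integral_mono) auto
    finally show ?thesis using H.prob_space by simp
  qed
  have "\<bar>(LINT y|G. ?S y) - (LINT y|G0. ?S y)\<bar> \<le>
     (LBINT y. \<bar>f y\<bar>) / (2 * pi) * (LBINT w. gaussian_weight \<tau> w * cmod (char G w - char G0 w))"
    using gaussian_smoothing_expectation_diff[OF \<tau> fi, of "{()}" "\<lambda>_. G" "\<lambda>_. G0"] G.real_distribution_axioms G0.real_distribution_axioms
    by simp
  also have "\<dots> \<le> 1 / (2 * pi) * (2 * pi * deconvolution_error D A \<tau>)"
    using f1 char_close_integral[OF \<tau> A D close] \<tau> by (intro mult_mono divide_right_mono integral_nonneg) auto
  also have "\<dots> = deconvolution_error D A \<tau>" by simp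
  finally show ?thesis
    using diff[OF G.real_distribution_axioms] diff[OF G0.real_distribution_axioms] by linarith
qed

text \<open>The indicator in the posterior is not Lipschitz and the estimate may have atoms, so the
  indicator is enclosed between two ramps of width \<open>d\<close>. The gap of this enclosure is
  measured under \<open>G0\<close> alone, where \<open>dens\<close> applies.\<close>

lemma posterior_cdf_close:
  assumes \<tau>: "0 < \<tau>" and A: "0 < A" "\<tau>\<^sup>2 \<le> 2 * A" and D: "0 < D"
    and close: "\<And>w. cmod (char G w - char G0 w) \<le> 2 * D * exp (A * w\<^sup>2 / 2)"
    and m: "0 < m" "m \<le> s" and d: "0 < d"
    and dens: "\<And>a b. a \<le> b \<Longrightarrow> measure G0 {a<..b} \<le> g * (b - a)"
  shows "\<bar>posterior_cdf G s u t - posterior_cdf G0 s u t\<bar> \<le>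
    2 * (2 * (1 / m\<^sup>2 + 1 / (2 * m) / d) * \<tau> + deconvolution_error D A \<tau> + g * d / (2 * m)) / mixture_density G0 s u"
proof -
  have s: "0 < s" using m by simp
  let ?k = "\<lambda>y. normal_density 0 s (u - y)"
  define e where "e = 2 * (1 / m\<^sup>2 + 1 / (2 * m) / d) * \<tau> + deconvolution_error D A \<tau> + g * d / (2 * m)"
  define f where "f a y = ?k y * ramp a d y" for a y
  define cum where "cum H t = (LINT y:{..t}|H. ?k y)" for H t
  have kb: "0 \<le> ?k y" "?k y \<le> 1 / (2 * m)" for y
  proof -
    have "1 / (2 * s) \<le> 1 / (2 * m)" using m by (intro divide_left_mono) auto
    then show "?k y \<le> 1 / (2 * m)" using normal_density_zero_le[OF s, of "u - y"] by linarith
  qed simp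
  have klip: "\<bar>?k y - ?k z\<bar> \<le> 1 / m\<^sup>2 * \<bar>y - z\<bar>" for y z
    using normal_density_lipschitz[OF m m(2), of "u - y" "u - z"] by (simp add: abs_minus_commute)
  have flip: "\<bar>f a y - f a z\<bar> \<le> (1 / m\<^sup>2 + 1 / (2 * m) / d) * \<bar>y - z\<bar>" for a y z
  proof -
    have "f a y - f a z = (?k y - ?k z) * ramp a d y + ?k z * (ramp a d y - ramp a d z)"
      by (simp add: f_def algebra_simps)
    also have "\<bar>\<dots>\<bar> \<le> \<bar>?k y - ?k z\<bar> * ramp a d y + ?k z * \<bar>ramp a d y - ramp a d z\<bar>"
      using kb(1) ramp_bounds(1) by (intro order_trans[OF abs_triangle_ineq]) (simp add: abs_mult)
    also have "\<dots> \<le> (1 / m\<^sup>2 * \<bar>y - z\<bar>) * 1 + 1 / (2 * m) * (\<bar>y - z\<bar> / d)"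
      using klip kb ramp_bounds(1,2) ramp_lipschitz[OF d] m by (intro add_mono mult_mono) auto
    finally show ?thesis by (simp add: distrib_right)
  qed
  have cumint: "integrable H (\<lambda>y. indicator B y * ?k y)" "integrable H (f a)" if "real_distribution H" "B \<in> sets borel" for H B a
  proof -
    interpret H: real_distribution H by fact
    have [measurable]: "B \<in> sets H" using that by simp
    show "integrable H (\<lambda>y. indicator B y * ?k y)"
      using kb m by (intro H.integrable_const_bound[where B="1 / (2 * m)"]) (auto split: split_indicator)
    have fb: "\<bar>f a y\<bar> \<le> 1 / (2 * m)" for y
      using mult_mono[OF kb(2) ramp_bounds(2) _ ramp_bounds(1), of y a d y] kb(1)[of y] ramp_bounds(1)[of a d y] m by (simp add: f_def)
    then show "integrable H (f a)"
      unfolding f_def by (intro H.integrable_const_bound[where B="1 / (2 * m)"]) (auto simp: f_def)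
  qed
  have cum_le_f: "cum H t \<le> (LINT y|H. f t y)" "(LINT y|H. f (t - d) y) \<le> cum H t" if H: "real_distribution H" for H t
  proof -
    have "indicator {..t} y * ?k y \<le> f t y" for y
      using kb(1)[of y] ramp_bounds(1)[of t d y] ramp_bounds(3)[OF d, of y t] by (cases "y \<le> t") (simp_all add: f_def)
    then show "cum H t \<le> (LINT y|H. f t y)"
      unfolding cum_def set_lebesgue_integral_def real_scaleR_def by (intro integral_mono cumint[OF H, of "{..t}"]) simp_all
    have "f (t - d) y \<le> indicator {..t} y * ?k y" for y
      using mult_left_mono[OF ramp_bounds(2)[of "t - d" d y] kb(1)[of y]] ramp_bounds(4)[OF d, of "t - d" y]
      by (cases "y \<le> t") (simp_all add: f_def)
    then show "(LINT y|H. f (t - d) y) \<le> cum H t"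
      unfolding cum_def set_lebesgue_integral_def real_scaleR_def by (intro integral_mono cumint[OF H, of "{..t}"]) simp_all
  qed
  have incr: "cum G0 (t + d) \<le> cum G0 t + g * d / (2 * m)" for t
  proof -
    have "cum G0 (t + d) = (LINT y|G0. indicator {..t} y * ?k y + indicator {t<..t + d} y * ?k y)"
      unfolding cum_def set_lebesgue_integral_def using d by (intro Bochner_Integration.integral_cong) (auto split: split_indicator)
    also have "\<dots> = cum G0 t + (LINT y|G0. indicator {t<..t + d} y * ?k y)"
      unfolding cum_def set_lebesgue_integral_def using cumint(1)[OF G0.real_distribution_axioms] by (subst Bochner_Integration.integral_add) auto
    also have "(LINT y|G0. indicator {t<..t + d} y * ?k y) \<le> (LINT y|G0. indicator {t<..t + d} y * (1 / (2 * m)))"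
    proof (rule integral_mono)
      show "integrable G0 (\<lambda>y. indicator {t<..t + d} y * ?k y)" by (rule cumint(1)[OF G0.real_distribution_axioms]) simp
      show "integrable G0 (\<lambda>y. indicator {t<..t + d} y * (1 / (2 * m)))"
        by (rule G0.integrable_const_bound[where B="1 / (2 * m)"]) (use m in \<open>auto split: split_indicator\<close>)
      show "indicator {t<..t + d} y * ?k y \<le> indicator {t<..t + d} y * (1 / (2 * m))" for y
        by (rule mult_left_mono[OF kb(2)]) simp
    qed
    also have "\<dots> = measure G0 {t<..t + d} * (1 / (2 * m))" by simp
    also have "\<dots> \<le> g * d * (1 / (2 * m))" using dens[of t "t + d"] d m by (intro mult_right_mono) auto
    finally show ?thesis by simp
  qed
  have ker: "\<bar>(LINT y|G. f a y) - (LINT y|G0. f a y)\<bar> \<le> 2 * (1 / m\<^sup>2 + 1 / (2 * m) / d) * \<tau> + deconvolution_error D A \<tau>" for a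
  proof (rule kernel_expectation_diff[OF \<tau> A D close s])
    show "f a \<in> borel_measurable borel" unfolding f_def by measurable
    show "0 \<le> f a y" "f a y \<le> ?k y" for y
      using kb(1)[of y] ramp_bounds(1,2)[of a d y] by (auto simp: f_def mult_left_le)
    show "\<bar>f a y - f a z\<bar> \<le> (1 / m\<^sup>2 + 1 / (2 * m) / d) * \<bar>y - z\<bar>" for y z by (rule flip)
  qed (use m d in auto)
  note G = G.real_distribution_axioms and G0 = G0.real_distribution_axioms
  \<comment> \<open>From above, the ramp at \<open>t\<close> is transferred from \<open>G\<close> to
    \<open>G0\<close>, where it is at most the value at \<open>t + d\<close>; from below, the ramp
    at \<open>t - d\<close> is transferred in the same way.\<close>
  have cumd: "\<bar>cum G t - cum G0 t\<bar> \<le> e" for t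
    using cum_le_f[OF G, of t] cum_le_f[OF G0, of "t + d"] cum_le_f(2)[OF G, of t] cum_le_f(1)[OF G0, of "t - d"]
      ker[of t] ker[of "t - d"] incr[of t] incr[of "t - d"] unfolding e_def by simp
  have g0: "0 \<le> g * d / (2 * m)"
    using order_trans[OF measure_nonneg dens[of 0 d]] d m by (intro divide_nonneg_nonneg) auto
  have mix: "\<bar>mixture_density G s u - mixture_density G0 s u\<bar> \<le> e"
  proof -
    have "\<bar>(LINT y|G. ?k y) - (LINT y|G0. ?k y)\<bar> \<le> 2 * (1 / m\<^sup>2) * \<tau> + deconvolution_error D A \<tau>"
      by (rule kernel_expectation_diff[OF \<tau> A D close s _ kb(1) order_refl klip]) auto
    also have "2 * (1 / m\<^sup>2) * \<tau> \<le> 2 * (1 / m\<^sup>2 + 1 / (2 * m) / d) * \<tau>"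
      using m d \<tau> by (intro mult_right_mono) auto
    finally show ?thesis using g0 unfolding e_def mixture_density_def by linarith
  qed
  let ?p = "mixture_density G0 s u" and ?q = "mixture_density G s u"
  have p: "0 < ?p" "0 < ?q" using G0.mixture_density_pos[OF s] G.mixture_density_pos[OF s] by auto
  have cq: "0 \<le> cum G t" "cum G t \<le> ?q"
    unfolding cum_def set_lebesgue_integral_def mixture_density_def
    using kb(1) cumint(1)[OF G, of "{..t}"] G.integrable_normal_kernel[OF s]
    by (auto intro!: integral_nonneg integral_mono split: split_indicator)
  \<comment> \<open>This expansion keeps \<open>?q\<close> only in \<open>cum G t / ?q\<close>,
    which is at most 1, so the final bound divides by the true marginal density alone.\<close>
  have "cum G t / ?q - cum G0 t / ?p = (cum G t - cum G0 t) / ?p + cum G t / ?q * ((?p - ?q) / ?p)"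
    using p by (simp add: diff_divide_distrib right_diff_distrib)
  also have "\<bar>\<dots>\<bar> \<le> \<bar>cum G t - cum G0 t\<bar> / ?p + cum G t / ?q * (\<bar>?p - ?q\<bar> / ?p)"
    using p cq by (intro order_trans[OF abs_triangle_ineq]) (simp add: abs_mult)
  also have "\<dots> \<le> e / ?p + 1 * (e / ?p)"
    using p cq cumd[of t] mix by (intro add_mono mult_mono divide_right_mono) (auto simp: abs_minus_commute)
  also have "\<dots> = 2 * e / ?p" by simp
  finally show ?thesis by (simp add: posterior_cdf_def cum_def e_def)
qed

end

section \<open>Posterior quantiles and the probability integral transform\<close>

definition posterior :: "real measure \<Rightarrow> real \<Rightarrow> real \<Rightarrow> real measure" where
  "posterior G s u = density G (\<lambda>\<theta>. ennreal (normal_density 0 s (u - \<theta>) / mixture_density G s u))"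

context real_distribution
begin

lemma real_distribution_posterior:
  assumes s: "0 < s" shows "real_distribution (posterior M s u)"
proof -
  have p: "0 < mixture_density M s u" using mixture_density_pos[OF s] .
  have "emeasure (posterior M s u) (space (posterior M s u)) =
      (\<integral>\<^sup>+\<theta>. ennreal (normal_density 0 s (u - \<theta>) / mixture_density M s u) \<partial>M)"
    unfolding posterior_def by (subst emeasure_density) (auto intro!: nn_integral_cong)
  also have "\<dots> = ennreal (LINT \<theta>|M. normal_density 0 s (u - \<theta>) / mixture_density M s u)"
    using integrable_normal_kernel[OF s] p by (intro nn_integral_eq_integral) (auto intro!: divide_nonneg_pos)
  also have "\<dots> = 1" using p by (simp add: mixture_density_def[symmetric])
  finally show ?thesis
    by (intro real_distribution.intro prob_spaceI real_distribution_axioms.intro) (auto simp: posterior_def)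
qed

lemma posterior_cdf_eq_cdf:
  assumes s: "0 < s" shows "posterior_cdf M s u t = cdf (posterior M s u) t"
proof -
  have p: "0 < mixture_density M s u" using mixture_density_pos[OF s] .
  interpret Q: real_distribution "posterior M s u" by (rule real_distribution_posterior[OF s])
  have "cdf (posterior M s u) t = (LINT \<theta>|posterior M s u. indicator {..t} \<theta>)"
    by (simp add: cdf_def)
  also have "\<dots> = (LINT \<theta>|M. (normal_density 0 s (u - \<theta>) / mixture_density M s u) *\<^sub>R indicator {..t} \<theta>)"
    unfolding posterior_def using p by (intro integral_density) (auto intro!: divide_nonneg_pos)
  also have "\<dots> = (LINT \<theta>|M. 1 / mixture_density M s u * (indicator {..t} \<theta> *\<^sub>R normal_density 0 s (u - \<theta>)))"
    by (intro Bochner_Integration.integral_cong) auto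
  finally show ?thesis by (simp add: posterior_cdf_def set_lebesgue_integral_def)
qed

lemma cdf_level_exists:
  assumes a: "0 < a" "a < 1"
  shows "\<exists>t. cdf M t < a" "\<exists>t. a < cdf M t"
proof -
  have "eventually (\<lambda>t. cdf M t < a) at_bot"
    using order_tendstoD(2)[OF cdf_lim_at_bot a(1)] .
  then show "\<exists>t. cdf M t < a" by (auto simp: eventually_at_bot_linorder)
  have "eventually (\<lambda>t. a < cdf M t) at_top"
    using order_tendstoD(1)[OF cdf_lim_at_top_prob a(2)] .
  then show "\<exists>t. a < cdf M t" by (auto simp: eventually_at_top_linorder)
qed

lemma quantile_set:
  assumes a: "0 < a" "a < 1"
  shows "{t. a \<le> cdf M t} \<noteq> {}" "bdd_below {t. a \<le> cdf M t}"
proof -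
  show "{t. a \<le> cdf M t} \<noteq> {}" using cdf_level_exists(2)[OF a] less_imp_le by blast
  obtain t0 where t0: "cdf M t0 < a" using cdf_level_exists(1)[OF a] by blast
  have "t0 \<le> t" if "a \<le> cdf M t" for t
    using cdf_nondecreasing[of t t0] that t0 by (cases "t0 \<le> t") auto
  then show "bdd_below {t. a \<le> cdf M t}" by (intro bdd_belowI) auto
qed

text \<open>A countable description of the event, for the measurability of random quantiles.\<close>

lemma quantile_less_iff:
  assumes a: "0 < a" "a < 1"
  shows "Inf {t. a \<le> cdf M t} < x \<longleftrightarrow> (\<exists>q::rat. of_rat q < x \<and> a \<le> cdf M (of_rat q))"
proof -
  have "Inf {t. a \<le> cdf M t} < x \<longleftrightarrow> (\<exists>t. a \<le> cdf M t \<and> t < x)"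
    using cInf_less_iff[OF quantile_set[OF a], of x] by auto
  also have "\<dots> \<longleftrightarrow> (\<exists>q::rat. of_rat q < x \<and> a \<le> cdf M (of_rat q))"
  proof
    assume "\<exists>t. a \<le> cdf M t \<and> t < x"
    then obtain t where t: "a \<le> cdf M t" "t < x" by blast
    obtain q :: rat where "t < of_rat q" "of_rat q < x" using of_rat_dense[OF t(2)] by blast
    then show "\<exists>q::rat. of_rat q < x \<and> a \<le> cdf M (of_rat q)"
      using t cdf_nondecreasing[of t "of_rat q"] by (intro exI[of _ q]) auto
  qed auto
  finally show ?thesis .
qed

text \<open>The passage from the quantile to the distribution function is stated only at points
  strictly beyond \<open>x\<close>, because the estimated posterior may have atoms; the converse
  passage works at \<open>x\<close> itself.\<close>

lemma quantile_le_iff: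
  assumes a: "0 < a" "a < 1"
  shows "Inf {t. a \<le> cdf M t} \<le> x \<Longrightarrow> x < t \<Longrightarrow> a \<le> cdf M t"
    "a \<le> cdf M x \<Longrightarrow> Inf {t. a \<le> cdf M t} \<le> x"
    "x \<le> Inf {t. a \<le> cdf M t} \<Longrightarrow> t < x \<Longrightarrow> cdf M t < a"
    "cdf M x < a \<Longrightarrow> x \<le> Inf {t. a \<le> cdf M t}"
proof -
  assume "Inf {t. a \<le> cdf M t} \<le> x" "x < t"
  then obtain t' where "a \<le> cdf M t'" "t' < t"
    using cInf_less_iff[OF quantile_set[OF a], of t] by auto
  then show "a \<le> cdf M t" using cdf_nondecreasing[of t' t] by simp
next
  assume "a \<le> cdf M x"
  then show "Inf {t. a \<le> cdf M t} \<le> x" by (intro cInf_lower quantile_set(2)[OF a]) simp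
next
  assume *: "x \<le> Inf {t. a \<le> cdf M t}" "t < x"
  show "cdf M t < a"
  proof (rule ccontr)
    assume "\<not> cdf M t < a"
    then have "Inf {t. a \<le> cdf M t} \<le> t" by (intro cInf_lower quantile_set(2)[OF a]) simp
    then show False using * by simp
  qed
next
  assume *: "cdf M x < a"
  show "x \<le> Inf {t. a \<le> cdf M t}"
  proof (rule cInf_greatest[OF quantile_set(1)[OF a]])
    fix t assume "t \<in> {t. a \<le> cdf M t}"
    then show "x \<le> t" using * cdf_nondecreasing[of t x] by (cases "x \<le> t") auto
  qed
qed

text \<open>Two one-sided inequalities are all that is used later. For a level inside (0, 1),
  continuity provides a point \<open>y\<close> at exactly that level, and monotonicity compares the
  event with \<open>{..y}\<close>.\<close>

lemma probability_integral_transform: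
  assumes cont: "\<And>x. isCont (cdf M) x"
  shows "0 \<le> a \<Longrightarrow> measure M {x. cdf M x < a} \<le> a" "a \<le> 1 \<Longrightarrow> a \<le> measure M {x. cdf M x \<le> a}"
proof -
  have level: "\<exists>y. cdf M y = a" if a: "0 < a" "a < 1"
  proof -
    obtain l u where l: "cdf M l < a" and u: "a < cdf M u" using cdf_level_exists[OF a] by blast
    then have "l \<le> u" using cdf_nondecreasing[of u l] by (cases "l \<le> u") auto
    then show ?thesis using IVT[of "cdf M" l a u] l u cont by auto
  qed
  have [measurable]: "cdf M \<in> borel_measurable borel"
    using cont by (intro borel_measurable_continuous_onI) (simp add: continuous_on_eq_continuous_at)
  have sets: "{x. cdf M x < a} \<in> sets M" "{x. cdf M x \<le> a} \<in> sets M" by simp_all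
  show "measure M {x. cdf M x < a} \<le> a" if a0: "0 \<le> a"
  proof (cases "0 < a \<and> a < 1")
    case True
    then obtain y where y: "cdf M y = a" using level by blast
    have "{x. cdf M x < a} \<subseteq> {..y}"
    proof
      fix x assume "x \<in> {x. cdf M x < a}"
      then show "x \<in> {..y}" using y cdf_nondecreasing[of y x] by (cases "x \<le> y") auto
    qed
    then have "measure M {x. cdf M x < a} \<le> measure M {..y}" by (intro finite_measure_mono) auto
    then show ?thesis using y by (simp add: cdf_def)
  next
    case False
    then consider "a = 0" | "1 \<le> a" using a0 by force
    then show ?thesis
    proof cases
      case 1
      then have "{x. cdf M x < a} = {}" using cdf_nonneg by (auto simp: not_less)
      then show ?thesis using 1 by simp
    next
      case 2 then show ?thesis using prob_le_1[of "{x. cdf M x < a}"] by linarith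
    qed
  qed
  show "a \<le> measure M {x. cdf M x \<le> a}" if a1: "a \<le> 1"
  proof (cases "0 < a \<and> a < 1")
    case True
    then obtain y where y: "cdf M y = a" using level by blast
    have "{..y} \<subseteq> {x. cdf M x \<le> a}" using y cdf_nondecreasing by auto
    then have "measure M {..y} \<le> measure M {x. cdf M x \<le> a}" using sets by (intro finite_measure_mono) auto
    then show ?thesis using y by (simp add: cdf_def)
  next
    case False
    then consider "a \<le> 0" | "a = 1" using a1 by force
    then show ?thesis
    proof cases
      case 1 then show ?thesis using measure_nonneg[of M "{x. cdf M x \<le> a}"] by linarith
    next
      case 2
      then have "{x. cdf M x \<le> a} = UNIV" using cdf_bounded_prob by auto
      then show ?thesis using 2 prob_space by simp
    qed
  qed
qed

lemma isCont_posterior_cdf: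
  assumes s: "0 < s" and atomless: "\<And>x. emeasure M {x} = 0"
  shows "isCont (cdf (posterior M s u)) x"
proof -
  interpret Q: real_distribution "posterior M s u" by (rule real_distribution_posterior[OF s])
  have "{x} \<in> null_sets M" using atomless by (auto simp: null_sets_def)
  then have "emeasure (posterior M s u) {x} = 0"
    unfolding posterior_def by (subst emeasure_density) (auto intro: nn_integral_null_set)
  then show ?thesis by (simp add: Q.isCont_cdf measure_def)
qed

lemma measurable_posterior_cdf:
  "(\<lambda>(\<theta>, x). posterior_cdf M s x \<theta>) \<in> borel_measurable (borel \<Otimes>\<^sub>M borel)"
proof -
  have "(\<lambda>(p, y). indicator {..fst p} y * normal_density 0 s (snd p - y)) =
      (\<lambda>(p, y). if y \<le> fst p then normal_density 0 s (snd p - y) else 0 :: real)"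
    by (auto simp: fun_eq_iff)
  moreover have "(\<lambda>(p, y). if y \<le> fst p then normal_density 0 s (snd p - y) else 0 :: real) \<in> borel_measurable ((borel \<Otimes>\<^sub>M borel) \<Otimes>\<^sub>M M)"
    by measurable
  ultimately have "(\<lambda>(p, y). indicator {..fst p} y * normal_density 0 s (snd p - y) :: real) \<in> borel_measurable ((borel \<Otimes>\<^sub>M borel) \<Otimes>\<^sub>M M)"
    by (simp only:)
  then have [measurable]: "(\<lambda>p. LINT y|M. indicator {..fst p} y * normal_density 0 s (snd p - y)) \<in> borel_measurable (borel \<Otimes>\<^sub>M borel)"
    by (rule borel_measurable_lebesgue_integral)
  show ?thesis
    unfolding posterior_cdf_def set_lebesgue_integral_def case_prod_beta' real_scaleR_def by measurable
qed

end

section \<open>Oracle coverage and measurability\<close>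

context gaussian_model
begin

text \<open>Bayes' rule: after the order of integration in \<open>joint_law\<close> is exchanged,
  the kernel factors into marginal density times posterior density. This replaces conditional
  expectations given the observation.\<close>

lemma joint_posterior:
  assumes j: "j < n" and E [measurable]: "Measurable.pred (borel \<Otimes>\<^sub>M borel) (\<lambda>(\<theta>, x). E \<theta> x)"
  shows "emeasure P {\<omega> \<in> space P. E (fst \<omega> j) (U \<omega> j)} =
    (\<integral>\<^sup>+x. emeasure (posterior G0 (sd \<Sigma> j) x) {\<theta>. E \<theta> x} \<partial>mixture_law G0 (sd \<Sigma> j))"
proof -
  let ?s = "sd \<Sigma> j" and ?p = "mixture_density G0 (sd \<Sigma> j)"
  have s: "0 < ?s" by (rule sd_pos[OF j])
  have p: "0 < ?p x" for x using G0.mixture_density_pos[OF s] .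
  interpret PL: pair_sigma_finite G0 lborel by unfold_locales
  let ?f = "indicator {p. case p of (\<theta>, x) \<Rightarrow> E \<theta> x} :: real \<times> real \<Rightarrow> ennreal"
  have ES: "{p. case p of (\<theta>, x) \<Rightarrow> E \<theta> x} \<in> sets (borel \<Otimes>\<^sub>M borel)"
    using E by (simp add: pred_def space_pair_measure)
  have [measurable]: "?f \<in> borel_measurable (borel \<Otimes>\<^sub>M borel)"
    using ES by (rule borel_measurable_indicator)
  have [measurable]: "(\<lambda>\<omega>. (fst \<omega> j, U \<omega> j)) \<in> P \<rightarrow>\<^sub>M borel \<Otimes>\<^sub>M borel" using j by measurable
  have "emeasure P {\<omega> \<in> space P. E (fst \<omega> j) (U \<omega> j)} = (\<integral>\<^sup>+\<omega>. ?f (fst \<omega> j, U \<omega> j) \<partial>P)"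
  proof -
    have S: "{\<omega> \<in> space P. E (fst \<omega> j) (U \<omega> j)} \<in> sets P"
      using measurable_sets[OF \<open>(\<lambda>\<omega>. (fst \<omega> j, U \<omega> j)) \<in> P \<rightarrow>\<^sub>M borel \<Otimes>\<^sub>M borel\<close> ES] by (simp add: vimage_def Int_def conj_commute)
    show ?thesis
      unfolding nn_integral_indicator[OF S, symmetric] by (intro nn_integral_cong) (simp add: indicator_def)
  qed
  also have "\<dots> = (\<integral>\<^sup>+\<theta>. (\<integral>\<^sup>+x. ennreal (normal_density 0 ?s (x - \<theta>)) * ?f (\<theta>, x) \<partial>lborel) \<partial>G0)"
    by (rule joint_law[OF j]) measurable
  also have "\<dots> = (\<integral>\<^sup>+x. (\<integral>\<^sup>+\<theta>. ennreal (normal_density 0 ?s (x - \<theta>)) * ?f (\<theta>, x) \<partial>G0) \<partial>lborel)"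
    by (rule PL.Fubini'[symmetric]) measurable
  also have "\<dots> = (\<integral>\<^sup>+x. ennreal (?p x) * emeasure (posterior G0 ?s x) {\<theta>. E \<theta> x} \<partial>lborel)"
  proof (rule nn_integral_cong)
    fix x
    have Ex: "{\<theta>. E \<theta> x} \<in> sets borel" using sets_Pair2[OF ES, of x] by (simp add: vimage_def)
    have "(\<integral>\<^sup>+\<theta>. ennreal (normal_density 0 ?s (x - \<theta>)) * ?f (\<theta>, x) \<partial>G0) =
        (\<integral>\<^sup>+\<theta>. ennreal (?p x) * (ennreal (normal_density 0 ?s (x - \<theta>) / ?p x) * indicator {\<theta>. E \<theta> x} \<theta>) \<partial>G0)"
    proof (rule nn_integral_cong)
      fix \<theta>
      have "ennreal (normal_density 0 ?s (x - \<theta>)) = ennreal (?p x) * ennreal (normal_density 0 ?s (x - \<theta>) / ?p x)"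
        using p[of x] by (subst ennreal_mult'[symmetric]) auto
      then show "ennreal (normal_density 0 ?s (x - \<theta>)) * ?f (\<theta>, x) =
        ennreal (?p x) * (ennreal (normal_density 0 ?s (x - \<theta>) / ?p x) * indicator {\<theta>. E \<theta> x} \<theta>)"
        by (auto simp: indicator_def)
    qed
    also have "\<dots> = ennreal (?p x) * (\<integral>\<^sup>+\<theta>. ennreal (normal_density 0 ?s (x - \<theta>) / ?p x) * indicator {\<theta>. E \<theta> x} \<theta> \<partial>G0)"
      using Ex by (intro nn_integral_cmult) measurable
    also have "(\<integral>\<^sup>+\<theta>. ennreal (normal_density 0 ?s (x - \<theta>) / ?p x) * indicator {\<theta>. E \<theta> x} \<theta> \<partial>G0) = emeasure (posterior G0 ?s x) {\<theta>. E \<theta> x}"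
      unfolding posterior_def using Ex by (intro emeasure_density[symmetric]) auto
    finally show "(\<integral>\<^sup>+\<theta>. ennreal (normal_density 0 ?s (x - \<theta>)) * ?f (\<theta>, x) \<partial>G0) =
       ennreal (?p x) * emeasure (posterior G0 ?s x) {\<theta>. E \<theta> x}" .
  qed
  also have "\<dots> = (\<integral>\<^sup>+x. emeasure (posterior G0 ?s x) {\<theta>. E \<theta> x} \<partial>mixture_law G0 ?s)"
  proof -
    have "(\<lambda>x. emeasure (posterior G0 ?s x) {\<theta>. E \<theta> x}) \<in> borel_measurable lborel"
    proof -
      have "(\<lambda>x. \<integral>\<^sup>+\<theta>. ennreal (normal_density 0 ?s (x - \<theta>) / ?p x) * ?f (\<theta>, x) \<partial>G0) \<in> borel_measurable lborel"
        by measurable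
      moreover have "(\<integral>\<^sup>+\<theta>. ennreal (normal_density 0 ?s (x - \<theta>) / ?p x) * ?f (\<theta>, x) \<partial>G0) = emeasure (posterior G0 ?s x) {\<theta>. E \<theta> x}" for x
      proof -
        have Ex: "{\<theta>. E \<theta> x} \<in> sets borel" using sets_Pair2[OF ES, of x] by (simp add: vimage_def)
        then show ?thesis
          unfolding posterior_def by (subst emeasure_density) (auto intro!: nn_integral_cong simp: indicator_def)
      qed
      ultimately show ?thesis by simp
    qed
    then show ?thesis unfolding mixture_law_def by (subst nn_integral_density) simp_all
  qed
  finally show ?thesis .
qed

text \<open>Given the observation, the probability integral transform applies to the posterior; its
  bounds do not depend on the observation and therefore survive integration.\<close>

lemma oracle_uniform:
  assumes j: "j < n" and atomless: "\<And>x. emeasure G0 {x} = 0"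
  defines "F \<equiv> \<lambda>\<omega>. posterior_cdf G0 (sd \<Sigma> j) (U \<omega> j) (fst \<omega> j)"
  shows "F \<in> borel_measurable P"
    "0 \<le> a \<Longrightarrow> P.prob {\<omega> \<in> space P. F \<omega> < a} \<le> a"
    "a \<le> 1 \<Longrightarrow> a \<le> P.prob {\<omega> \<in> space P. F \<omega> \<le> a}"
proof -
  let ?s = "sd \<Sigma> j" and ?L = "mixture_law G0 (sd \<Sigma> j)"
  have s: "0 < ?s" by (rule sd_pos[OF j])
  interpret L: real_distribution ?L by (rule G0.real_distribution_mixture_law[OF s])
  note m = G0.measurable_posterior_cdf[of ?s]
  have m2: "(\<lambda>\<omega>. (fst \<omega> j, U \<omega> j)) \<in> P \<rightarrow>\<^sub>M borel \<Otimes>\<^sub>M borel" using j by measurable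
  show "F \<in> borel_measurable P"
    unfolding F_def using measurable_compose[OF m2 m] by simp
  have lt: "Measurable.pred (borel \<Otimes>\<^sub>M borel) (\<lambda>(\<theta>, x). posterior_cdf G0 ?s x \<theta> < a)"
    using borel_measurable_less[OF m borel_measurable_const[of a]] by (simp add: pred_def case_prod_beta')
  have le: "Measurable.pred (borel \<Otimes>\<^sub>M borel) (\<lambda>(\<theta>, x). posterior_cdf G0 ?s x \<theta> \<le> a)"
    using borel_measurable_le[OF m borel_measurable_const[of a]] by (simp add: pred_def case_prod_beta')
  have pit: "0 \<le> a \<Longrightarrow> measure (posterior G0 ?s x) {\<theta>. posterior_cdf G0 ?s x \<theta> < a} \<le> a"
    "a \<le> 1 \<Longrightarrow> a \<le> measure (posterior G0 ?s x) {\<theta>. posterior_cdf G0 ?s x \<theta> \<le> a}"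
    "emeasure (posterior G0 ?s x) B = ennreal (measure (posterior G0 ?s x) B)" for x B
  proof -
    interpret Q: real_distribution "posterior G0 ?s x" by (rule G0.real_distribution_posterior[OF s])
    show "emeasure (posterior G0 ?s x) B = ennreal (measure (posterior G0 ?s x) B)"
      by (rule Q.emeasure_eq_measure)
    show "0 \<le> a \<Longrightarrow> measure (posterior G0 ?s x) {\<theta>. posterior_cdf G0 ?s x \<theta> < a} \<le> a"
      "a \<le> 1 \<Longrightarrow> a \<le> measure (posterior G0 ?s x) {\<theta>. posterior_cdf G0 ?s x \<theta> \<le> a}"
      unfolding G0.posterior_cdf_eq_cdf[OF s]
      using Q.probability_integral_transform[OF G0.isCont_posterior_cdf[OF s atomless]] by blast+
  qed
  show "P.prob {\<omega> \<in> space P. F \<omega> < a} \<le> a" if a: "0 \<le> a"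
  proof -
    have "emeasure P {\<omega> \<in> space P. F \<omega> < a} \<le> (\<integral>\<^sup>+x. ennreal a \<partial>?L)"
      unfolding F_def joint_posterior[OF j lt] pit(3) using pit(1) a by (intro nn_integral_mono ennreal_leI) simp
    also have "\<dots> = ennreal a" by (simp add: L.emeasure_space_1[unfolded space_mixture_law])
    finally show ?thesis using a by (simp add: P.emeasure_eq_measure)
  qed
  show "a \<le> P.prob {\<omega> \<in> space P. F \<omega> \<le> a}" if a: "a \<le> 1"
  proof -
    have "ennreal a = (\<integral>\<^sup>+x. ennreal a \<partial>?L)" by (simp add: L.emeasure_space_1[unfolded space_mixture_law])
    also have "\<dots> \<le> emeasure P {\<omega> \<in> space P. F \<omega> \<le> a}"
      unfolding F_def joint_posterior[OF j le] pit(3) using pit(2) a by (intro nn_integral_mono ennreal_leI) simp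
    finally show ?thesis by (simp add: P.emeasure_eq_measure)
  qed
qed

text \<open>The integrating measure is itself random. Nonnegative integrals against a measurable
  kernel are measurable, hence the detour through \<open>enn2real\<close>; the quantile events are
  then countable unions over the rationals.\<close>

lemma measurable_posterior_quantile:
  assumes j: "j < n" and Gh: "Ghat \<in> Rn n \<rightarrow>\<^sub>M prob_algebra borel" and a: "0 < a" "a < 1"
  shows "(\<lambda>\<omega>. posterior_quantile (Ghat (U \<omega>)) (sd \<Sigma> j) (U \<omega> j) a) \<in> borel_measurable P"
proof -
  let ?s = "sd \<Sigma> j"
  have s: "0 < ?s" by (rule sd_pos[OF j])
  have U: "U \<in> P \<rightarrow>\<^sub>M Rn n" "(\<lambda>\<omega>. U \<omega> j) \<in> borel_measurable P" using j by measurable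
  note [measurable] = U
  have G: "(\<lambda>\<omega>. Ghat (U \<omega>)) \<in> P \<rightarrow>\<^sub>M prob_algebra borel"
    using measurable_compose[OF U(1) Gh] .
  have [measurable]: "(\<lambda>\<omega>. Ghat (U \<omega>)) \<in> P \<rightarrow>\<^sub>M subprob_algebra borel"
    by (rule measurable_prob_algebraD[OF G])
  have rd: "real_distribution (Ghat (U \<omega>))" if "\<omega> \<in> space P" for \<omega>
    using measurable_space[OF G that] by (simp add: mem_prob_distributions_iff)
  have int_meas: "(\<lambda>\<omega>. LINT \<theta>|Ghat (U \<omega>). f \<theta> * normal_density 0 ?s (U \<omega> j - \<theta>)) \<in> borel_measurable P"
    if [measurable]: "f \<in> borel_measurable borel" and f: "\<And>\<theta>. 0 \<le> f \<theta>" for f :: "real \<Rightarrow> real"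
  proof -
    have "(\<lambda>\<omega>. \<integral>\<^sup>+\<theta>. ennreal (f \<theta> * normal_density 0 ?s (U \<omega> j - \<theta>)) \<partial>Ghat (U \<omega>)) \<in> borel_measurable P"
      by (rule nn_integral_measurable_subprob_algebra2[where N=borel]) measurable
    then have "(\<lambda>\<omega>. enn2real (\<integral>\<^sup>+\<theta>. ennreal (f \<theta> * normal_density 0 ?s (U \<omega> j - \<theta>)) \<partial>Ghat (U \<omega>))) \<in> borel_measurable P"
      by measurable
    moreover have "(LINT \<theta>|Ghat (U \<omega>). f \<theta> * normal_density 0 ?s (U \<omega> j - \<theta>)) =
        enn2real (\<integral>\<^sup>+\<theta>. ennreal (f \<theta> * normal_density 0 ?s (U \<omega> j - \<theta>)) \<partial>Ghat (U \<omega>))" if "\<omega> \<in> space P" for \<omega>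
    proof -
      interpret H: real_distribution "Ghat (U \<omega>)" by (rule rd[OF that])
      show ?thesis using f by (intro integral_eq_nn_integral) auto
    qed
    ultimately show ?thesis by (simp cong: measurable_cong)
  qed
  have cdf_meas: "(\<lambda>\<omega>. posterior_cdf (Ghat (U \<omega>)) ?s (U \<omega> j) t) \<in> borel_measurable P" for t
    unfolding posterior_cdf_def mixture_density_def set_lebesgue_integral_def real_scaleR_def
    using int_meas[of "\<lambda>_. 1"] int_meas[of "indicator {..t}"] by simp
  show ?thesis
    unfolding borel_measurable_iff_less
  proof
    fix x
    have "{\<omega> \<in> space P. posterior_quantile (Ghat (U \<omega>)) ?s (U \<omega> j) a < x} =
        (\<Union>q::rat. {\<omega> \<in> space P. of_rat q < x \<and> a \<le> posterior_cdf (Ghat (U \<omega>)) ?s (U \<omega> j) (of_rat q)})"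
    proof -
      have "posterior_quantile (Ghat (U \<omega>)) ?s (U \<omega> j) a < x \<longleftrightarrow>
          (\<exists>q::rat. of_rat q < x \<and> a \<le> posterior_cdf (Ghat (U \<omega>)) ?s (U \<omega> j) (of_rat q))" if "\<omega> \<in> space P" for \<omega>
      proof -
        interpret H: real_distribution "Ghat (U \<omega>)" by (rule rd[OF that])
        interpret Q: real_distribution "posterior (Ghat (U \<omega>)) ?s (U \<omega> j)" by (rule H.real_distribution_posterior[OF s])
        show ?thesis
          unfolding posterior_quantile_def H.posterior_cdf_eq_cdf[OF s] by (rule Q.quantile_less_iff[OF a])
      qed
      then show ?thesis by auto
    qed
    also have "\<dots> \<in> sets P"
    proof (rule sets.countable_UN'')
      show "{\<omega> \<in> space P. of_rat q < x \<and> a \<le> posterior_cdf (Ghat (U \<omega>)) ?s (U \<omega> j) (of_rat q)} \<in> sets P" for q :: rat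
        using borel_measurable_le[OF borel_measurable_const[of a] cdf_meas[of "of_rat q"]] by (cases "of_rat q < x") simp_all
    qed simp
    finally show "{\<omega> \<in> space P. posterior_quantile (Ghat (U \<omega>)) ?s (U \<omega> j) a < x} \<in> sets P" .
  qed
qed

section \<open>Coverage of the estimated intervals\<close>

definition covered where
  "covered Ghat \<gamma> j = {\<omega> \<in> space P. fst \<omega> j \<in> credible_interval \<Sigma> Ghat \<gamma> (U \<omega>) j}"

lemma covered_measurable:
  assumes j: "j < n" and Gh: "Ghat \<in> Rn n \<rightarrow>\<^sub>M prob_algebra borel" and \<gamma>: "0 < \<gamma>" "\<gamma> < 1"
  shows "covered Ghat \<gamma> j \<in> sets P"
proof -
  have [measurable]: "(\<lambda>\<omega>. fst \<omega> j) \<in> borel_measurable P" using j by measurable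
  have [measurable]: "(\<lambda>\<omega>. posterior_quantile (Ghat (U \<omega>)) (sd \<Sigma> j) (U \<omega> j) (\<gamma> / 2)) \<in> borel_measurable P"
    "(\<lambda>\<omega>. posterior_quantile (Ghat (U \<omega>)) (sd \<Sigma> j) (U \<omega> j) (1 - \<gamma> / 2)) \<in> borel_measurable P"
    using \<gamma> by (auto intro!: measurable_posterior_quantile[OF j Gh])
  have "covered Ghat \<gamma> j = {\<omega> \<in> space P. posterior_quantile (Ghat (U \<omega>)) (sd \<Sigma> j) (U \<omega> j) (\<gamma> / 2) \<le> fst \<omega> j \<and>
      fst \<omega> j \<le> posterior_quantile (Ghat (U \<omega>)) (sd \<Sigma> j) (U \<omega> j) (1 - \<gamma> / 2)}"
    by (auto simp: covered_def credible_interval_def)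
  also have "\<dots> \<in> sets P" by measurable
  finally show ?thesis .
qed

text \<open>Estimated and true quantiles are never compared, which would require a modulus of
  continuity of the quantile function. Instead coverage is enclosed between events about the oracle
  variable \<open>F\<close>, whose law is known, at levels shifted by \<eta>.\<close>

lemma coverage_stability:
  assumes j: "j < n" and Gh: "Ghat \<in> Rn n \<rightarrow>\<^sub>M prob_algebra borel" and \<gamma>: "0 < \<gamma>" "\<gamma> < 1"
    and atomless: "\<And>x. emeasure G0 {x} = 0" and \<eta>: "0 < \<eta>" and B [measurable]: "B \<in> sets P"
    and close: "\<And>\<omega> t. \<omega> \<in> space P \<Longrightarrow> \<omega> \<notin> B \<Longrightarrow>
      \<bar>posterior_cdf (Ghat (U \<omega>)) (sd \<Sigma> j) (U \<omega> j) t - posterior_cdf G0 (sd \<Sigma> j) (U \<omega> j) t\<bar> \<le> \<eta>"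
  shows "\<bar>P.prob (covered Ghat \<gamma> j) - (1 - \<gamma>)\<bar> \<le> 4 * \<eta> + P.prob B"
proof -
  let ?s = "sd \<Sigma> j" and ?C = "covered Ghat \<gamma> j"
  have s: "0 < ?s" by (rule sd_pos[OF j])
  define F where "F \<omega> = posterior_cdf G0 ?s (U \<omega> j) (fst \<omega> j)" for \<omega>
  note unif = oracle_uniform[OF j atomless, folded F_def]
  have [measurable]: "F \<in> borel_measurable P" by (rule unif(1))
  have C [measurable]: "?C \<in> sets P" by (rule covered_measurable[OF j Gh \<gamma>])
  have g: "0 < \<gamma> / 2" "\<gamma> / 2 < 1" "0 < 1 - \<gamma> / 2" "1 - \<gamma> / 2 < 1" using \<gamma> by auto
  have rd: "real_distribution (Ghat (U \<omega>))" if "\<omega> \<in> space P" for \<omega>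
  proof -
    have "U \<in> P \<rightarrow>\<^sub>M Rn n" by measurable
    from measurable_space[OF Gh measurable_space[OF this that]] show ?thesis by (simp add: mem_prob_distributions_iff)
  qed
  have upper: "\<gamma> / 2 - \<eta> \<le> F \<omega>" "F \<omega> \<le> 1 - \<gamma> / 2 + \<eta>" if \<omega>: "\<omega> \<in> ?C" "\<omega> \<notin> B" for \<omega>
  proof -
    have sp: "\<omega> \<in> space P" using \<omega>(1) by (simp add: covered_def)
    interpret H: real_distribution "Ghat (U \<omega>)" by (rule rd[OF sp])
    interpret Q: real_distribution "posterior (Ghat (U \<omega>)) ?s (U \<omega> j)" by (rule H.real_distribution_posterior[OF s])
    have q: "Inf {t. \<gamma> / 2 \<le> cdf (posterior (Ghat (U \<omega>)) ?s (U \<omega> j)) t} \<le> fst \<omega> j"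
      "fst \<omega> j \<le> Inf {t. 1 - \<gamma> / 2 \<le> cdf (posterior (Ghat (U \<omega>)) ?s (U \<omega> j)) t}"
      using \<omega>(1) by (auto simp: covered_def credible_interval_def posterior_quantile_def H.posterior_cdf_eq_cdf[OF s])
    let ?F0 = "cdf (posterior G0 ?s (U \<omega> j))"
    have cont: "isCont ?F0 x" for x by (rule G0.isCont_posterior_cdf[OF s atomless])
    have F: "F \<omega> = ?F0 (fst \<omega> j)" by (simp add: F_def G0.posterior_cdf_eq_cdf[OF s])
    note cl = close[OF sp \<omega>(2), unfolded H.posterior_cdf_eq_cdf[OF s] G0.posterior_cdf_eq_cdf[OF s]]
    \<comment> \<open>The quantiles constrain the estimated distribution function strictly to the
      right, and in \<open>l\<close> strictly to the left, of the effect. Continuity of the true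
      posterior carries both bounds to the effect itself.\<close>
    have r: "\<gamma> / 2 - \<eta> \<le> ?F0 t" if "fst \<omega> j < t" for t
      using Q.quantile_le_iff(1)[OF g(1,2) q(1) that] cl[of t] by linarith
    have l: "?F0 t \<le> 1 - \<gamma> / 2 + \<eta>" if "t < fst \<omega> j" for t
      using Q.quantile_le_iff(3)[OF g(3,4) q(2) that] cl[of t] by linarith
    have "(?F0 \<longlongrightarrow> ?F0 (fst \<omega> j)) (at_right (fst \<omega> j))" "(?F0 \<longlongrightarrow> ?F0 (fst \<omega> j)) (at_left (fst \<omega> j))"
      using cont[of "fst \<omega> j"] unfolding isCont_def by (auto intro: filterlim_mono at_le)
    from this(1) show "\<gamma> / 2 - \<eta> \<le> F \<omega>"
      unfolding F by (rule tendsto_lowerbound) (use r in \<open>auto simp: eventually_at_filter\<close>)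
    from \<open>(?F0 \<longlongrightarrow> ?F0 (fst \<omega> j)) (at_left (fst \<omega> j))\<close> show "F \<omega> \<le> 1 - \<gamma> / 2 + \<eta>"
      unfolding F by (rule tendsto_upperbound) (use l in \<open>auto simp: eventually_at_filter\<close>)
  qed
  have lower: "\<omega> \<in> ?C" if \<omega>: "\<omega> \<in> space P" "\<omega> \<notin> B" "\<gamma> / 2 + \<eta> \<le> F \<omega>" "F \<omega> < 1 - \<gamma> / 2 - \<eta>" for \<omega>
  proof -
    interpret H: real_distribution "Ghat (U \<omega>)" by (rule rd[OF \<omega>(1)])
    interpret Q: real_distribution "posterior (Ghat (U \<omega>)) ?s (U \<omega> j)" by (rule H.real_distribution_posterior[OF s])
    have "\<gamma> / 2 \<le> cdf (posterior (Ghat (U \<omega>)) ?s (U \<omega> j)) (fst \<omega> j)"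
      "cdf (posterior (Ghat (U \<omega>)) ?s (U \<omega> j)) (fst \<omega> j) < 1 - \<gamma> / 2"
      using close[OF \<omega>(1,2), of "fst \<omega> j"] \<omega>(3,4) unfolding F_def H.posterior_cdf_eq_cdf[OF s] by linarith+
    from Q.quantile_le_iff(2)[OF g(1,2) this(1)] Q.quantile_le_iff(4)[OF g(3,4) this(2)]
    show ?thesis using \<omega>(1)
      by (simp add: covered_def credible_interval_def posterior_quantile_def H.posterior_cdf_eq_cdf[OF s])
  qed
  have le: "P.prob ?C \<le> 1 - \<gamma> + 4 * \<eta> + P.prob B"
  proof -
    have "P.prob ?C \<le> P.prob ({\<omega> \<in> space P. F \<omega> \<le> 1 - \<gamma> / 2 + \<eta>} - {\<omega> \<in> space P. F \<omega> < \<gamma> / 2 - \<eta>} \<union> B)"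
      using upper by (intro P.finite_measure_mono) (force simp: covered_def not_less)+
    also have "\<dots> \<le> P.prob ({\<omega> \<in> space P. F \<omega> \<le> 1 - \<gamma> / 2 + \<eta>} - {\<omega> \<in> space P. F \<omega> < \<gamma> / 2 - \<eta>}) + P.prob B"
      by (rule measure_Un_le) measurable
    also have "P.prob ({\<omega> \<in> space P. F \<omega> \<le> 1 - \<gamma> / 2 + \<eta>} - {\<omega> \<in> space P. F \<omega> < \<gamma> / 2 - \<eta>}) =
        P.prob {\<omega> \<in> space P. F \<omega> \<le> 1 - \<gamma> / 2 + \<eta>} - P.prob {\<omega> \<in> space P. F \<omega> < \<gamma> / 2 - \<eta>}"
      using \<gamma> \<eta> by (intro P.finite_measure_Diff) auto
    \<comment> \<open>A second \<eta> is spent on passing from \<le> to <, because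
      \<open>unif\<close> bounds each kind of event from one side only. Both ends together give
      \<open>4 * \<eta>\<close>.\<close>
    also have "P.prob {\<omega> \<in> space P. F \<omega> \<le> 1 - \<gamma> / 2 + \<eta>} \<le> P.prob {\<omega> \<in> space P. F \<omega> < 1 - \<gamma> / 2 + 2 * \<eta>}"
      using \<eta> by (intro P.finite_measure_mono) auto
    also have "\<dots> \<le> 1 - \<gamma> / 2 + 2 * \<eta>" using \<gamma> \<eta> by (intro unif(2)) auto
    finally have 1: "P.prob ?C \<le> 1 - \<gamma> / 2 + 2 * \<eta> - P.prob {\<omega> \<in> space P. F \<omega> < \<gamma> / 2 - \<eta>} + P.prob B" by simp
    have "\<gamma> / 2 - 2 * \<eta> \<le> P.prob {\<omega> \<in> space P. F \<omega> \<le> \<gamma> / 2 - 2 * \<eta>}" using \<gamma> \<eta> by (intro unif(3)) auto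
    also have "\<dots> \<le> P.prob {\<omega> \<in> space P. F \<omega> < \<gamma> / 2 - \<eta>}" using \<eta> by (intro P.finite_measure_mono) auto
    finally show ?thesis using 1 by linarith
  qed
  have ge: "1 - \<gamma> - 4 * \<eta> - P.prob B \<le> P.prob ?C"
  proof -
    have "1 - \<gamma> / 2 - 2 * \<eta> \<le> P.prob {\<omega> \<in> space P. F \<omega> \<le> 1 - \<gamma> / 2 - 2 * \<eta>}" using \<gamma> \<eta> by (intro unif(3)) auto
    also have "\<dots> \<le> P.prob ({\<omega> \<in> space P. F \<omega> < \<gamma> / 2 + \<eta>} \<union> (?C \<union> B))"
      using lower \<eta> by (intro P.finite_measure_mono) (force simp: not_less)+
    also have "\<dots> \<le> P.prob {\<omega> \<in> space P. F \<omega> < \<gamma> / 2 + \<eta>} + P.prob (?C \<union> B)"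
      by (rule measure_Un_le) measurable
    also have "\<dots> \<le> (\<gamma> / 2 + \<eta>) + (P.prob ?C + P.prob B)"
      using \<gamma> \<eta> by (intro add_mono unif(2) measure_Un_le) auto
    finally show ?thesis using \<eta> by linarith
  qed
  show ?thesis using le ge by linarith
qed

lemma sequence_model_average:
  assumes A: "A \<in> sets (sequence_model n G0)"
  shows "measure (sequence_model n G0) A = (\<Sum>j<n. P.prob {\<omega> \<in> space P. (fst \<omega>, snd \<omega>, j) \<in> A}) / n"
proof -
  let ?U = "uniform_count_measure {..<n}"
  interpret UC: prob_space ?U using n_pos by (intro prob_space_uniform_count_measure) (auto simp: lessThan_empty_iff)
  interpret ZU: pair_prob_space PZ ?U by unfold_locales
  interpret BZU: pair_prob_space PB "PZ \<Otimes>\<^sub>M ?U" by unfold_locales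
  have M: "sequence_model n G0 = PB \<Otimes>\<^sub>M (PZ \<Otimes>\<^sub>M ?U)" by (simp add: sequence_model_def)
  note A' = A[unfolded M]
  let ?I = "indicator A :: _ \<Rightarrow> real"
  have A_j: "{\<omega> \<in> space P. (fst \<omega>, snd \<omega>, j) \<in> A} \<in> sets P" if "j < n" for j
  proof -
    have "(\<lambda>\<omega>. (fst \<omega>, snd \<omega>, j)) \<in> PB \<Otimes>\<^sub>M PZ \<rightarrow>\<^sub>M PB \<Otimes>\<^sub>M (PZ \<Otimes>\<^sub>M ?U)"
      using that by (intro measurable_Pair measurable_fst measurable_snd measurable_const) (simp add: space_uniform_count_measure)
    from measurable_sets[OF this A'] show ?thesis
      unfolding P_def by (simp add: vimage_def Int_def conj_commute)
  qed
  have int1: "integrable (PB \<Otimes>\<^sub>M (PZ \<Otimes>\<^sub>M ?U)) ?I"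
    using A' by (intro BZU.P.integrable_const_bound[where B=1]) auto
  have "measure (sequence_model n G0) A = integral\<^sup>L (PB \<Otimes>\<^sub>M (PZ \<Otimes>\<^sub>M ?U)) ?I"
    using sets.sets_into_space[OF A'] unfolding M by (simp add: Int_absorb2)
  also have "\<dots> = (LINT \<beta>|PB. (LINT y|(PZ \<Otimes>\<^sub>M ?U). ?I (\<beta>, y)))"
    by (rule BZU.integral_fst'[OF int1, symmetric])
  also have "\<dots> = (LINT \<beta>|PB. (LINT z|PZ. (\<Sum>j<n. ?I (\<beta>, z, j)) / n))"
  proof (rule Bochner_Integration.integral_cong[OF refl])
    fix \<beta> assume b: "\<beta> \<in> space PB"
    have "(\<lambda>y. ?I (\<beta>, y)) \<in> borel_measurable (PZ \<Otimes>\<^sub>M ?U)"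
      using measurable_compose[OF measurable_Pair1'[OF b] borel_measurable_indicator[OF A']] .
    then have "integrable (PZ \<Otimes>\<^sub>M ?U) (\<lambda>y. ?I (\<beta>, y))"
      by (intro ZU.P.integrable_const_bound[where B=1]) auto
    then have "(LINT y|(PZ \<Otimes>\<^sub>M ?U). ?I (\<beta>, y)) = (LINT z|PZ. (LINT j|?U. ?I (\<beta>, z, j)))"
      by (rule ZU.integral_fst'[symmetric])
    then show "(LINT y|(PZ \<Otimes>\<^sub>M ?U). ?I (\<beta>, y)) = (LINT z|PZ. (\<Sum>j<n. ?I (\<beta>, z, j)) / n)"
      by (simp add: integral_uniform_count_measure)
  qed
  also have "\<dots> = (LINT \<omega>|P. (\<Sum>j<n. indicator {\<omega> \<in> space P. (fst \<omega>, snd \<omega>, j) \<in> A} \<omega>) / n)"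
  proof -
    have "integrable P (\<lambda>\<omega>. (\<Sum>j<n. indicator {\<omega> \<in> space P. (fst \<omega>, snd \<omega>, j) \<in> A} \<omega>) / n :: real)"
      using A_j by (intro integrable_divide Bochner_Integration.integrable_sum P.integrable_const_bound[where B=1]) auto
    from PP.integral_fst'[OF this[unfolded P_def]] show ?thesis
      unfolding P_def by (simp add: space_pair_measure indicator_def cong: Bochner_Integration.integral_cong)
  qed
  also have "\<dots> = (\<Sum>j<n. P.prob {\<omega> \<in> space P. (fst \<omega>, snd \<omega>, j) \<in> A}) / n"
  proof -
    have "(LINT \<omega>|P. (\<Sum>j<n. indicator {\<omega> \<in> space P. (fst \<omega>, snd \<omega>, j) \<in> A} \<omega> :: real)) =
        (\<Sum>j<n. (LINT \<omega>|P. indicat_real {\<omega> \<in> space P. (fst \<omega>, snd \<omega>, j) \<in> A} \<omega>))"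
      using A_j by (intro Bochner_Integration.integral_sum P.integrable_const_bound[where B=1]) auto
    also have "\<dots> = (\<Sum>j<n. P.prob {\<omega> \<in> space P. (fst \<omega>, snd \<omega>, j) \<in> A})"
      using A_j sets.sets_into_space by (intro sum.cong refl) (simp add: Int_absorb2)
    finally show ?thesis by simp
  qed
  finally show ?thesis .
qed

lemma coverage_average:
  assumes Gh: "Ghat \<in> Rn n \<rightarrow>\<^sub>M prob_algebra borel" and \<gamma>: "0 < \<gamma>" "\<gamma> < 1"
  shows "coverage n G0 \<Sigma> S Ghat \<gamma> = (\<Sum>j<n. P.prob (covered Ghat \<gamma> j)) / n"
proof -
  let ?U = "uniform_count_measure {..<n}"
  define A where "A = {(\<beta>, z, j) \<in> space (sequence_model n G0). \<beta> j \<in> credible_interval \<Sigma> Ghat \<gamma> (observation n S \<beta> z) j}"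
  have M: "sequence_model n G0 = PB \<Otimes>\<^sub>M (PZ \<Otimes>\<^sub>M ?U)" by (simp add: sequence_model_def)
  have sp: "(\<beta>, z, j) \<in> space (sequence_model n G0) \<longleftrightarrow> (\<beta>, z) \<in> space P \<and> j < n" for \<beta> z j
    unfolding M P_def by (auto simp: space_pair_measure space_uniform_count_measure)
  have cov: "{\<omega> \<in> space P. (fst \<omega>, snd \<omega>, j) \<in> A} = covered Ghat \<gamma> j" if "j < n" for j
    using that by (auto simp: A_def sp covered_def U_def)
  \<comment> \<open>The interval depends on the index, so for measurability the event is cut into
    finitely many slices with fixed index.\<close>
  have "A = (\<Union>j<n. (\<lambda>(\<beta>, z, i). (\<beta>, z)) -` covered Ghat \<gamma> j \<inter> space (sequence_model n G0) \<inter>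
      ((\<lambda>(\<beta>, z, i). i) -` {j} \<inter> space (sequence_model n G0)))"
    by (auto simp: A_def sp covered_def U_def)
  also have "\<dots> \<in> sets (sequence_model n G0)"
  proof (rule sets.finite_UN)
    fix j assume "j \<in> {..<n}"
    then have j: "j < n" by simp
    have m1: "(\<lambda>(\<beta>, z, i). (\<beta>, z)) \<in> sequence_model n G0 \<rightarrow>\<^sub>M P" unfolding M P_def case_prod_beta' by measurable
    have m2: "(\<lambda>(\<beta>, z, i). i) \<in> sequence_model n G0 \<rightarrow>\<^sub>M ?U" unfolding M case_prod_beta' by measurable
    show "(\<lambda>(\<beta>, z, i). (\<beta>, z)) -` covered Ghat \<gamma> j \<inter> space (sequence_model n G0) \<inter>
      ((\<lambda>(\<beta>, z, i). i) -` {j} \<inter> space (sequence_model n G0)) \<in> sets (sequence_model n G0)"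
      by (rule sets.Int[OF measurable_sets[OF m1 covered_measurable[OF j Gh \<gamma>]] measurable_sets[OF m2]])
        (use j in \<open>simp add: sets_uniform_count_measure\<close>)
  qed simp
  finally have "A \<in> sets (sequence_model n G0)" .
  from sequence_model_average[OF this] show ?thesis
    unfolding coverage_def A_def[symmetric] using cov by simp
qed

end

section \<open>Rates\<close>

lemma sqrt_le_self: "1 \<le> x \<Longrightarrow> sqrt x \<le> (x::real)"
  using real_sqrt_le_mono[of x "x\<^sup>2"] mult_left_mono[of 1 x x] by (simp add: power2_eq_square)

lemma (in real_distribution) smoothing_error_expectation:
  assumes s: "0 < s" and R: "AE u in M. \<bar>u\<bar> \<le> R" and \<tau>: "0 < \<tau>" and K: "0 < K" and A: "s\<^sup>2 \<le> A"
  shows "(LINT x|mixture_law M s. smoothing_error M m \<tau> K s x) \<le>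
    16 * \<tau> / m\<^sup>2 * K + 2 * (R\<^sup>2 + A) / K\<^sup>2 + 2 * (R\<^sup>2 + A + \<tau>\<^sup>2) / K\<^sup>2"
proof -
  interpret L: real_distribution "mixture_law M s" by (rule real_distribution_mixture_law[OF s])
  have "0 \<le> 8 * \<tau> / m\<^sup>2 / mixture_density M s x" for x
    using mixture_density_pos[OF s, of x] \<tau> by (intro divide_nonneg_nonneg) auto
  then have "norm (min 2 (8 * \<tau> / m\<^sup>2 / mixture_density M s x)) \<le> 2" for x
    by (simp add: abs_le_iff min.coboundedI1)
  then have 1: "integrable (mixture_law M s) (\<lambda>x. min 2 (8 * \<tau> / m\<^sup>2 / mixture_density M s x))"
    by (intro L.integrable_const_bound[where B=2]) auto
  have 2: "integrable (mixture_law M s) (\<lambda>x. 2 / K\<^sup>2 * (x\<^sup>2 + \<tau>\<^sup>2))"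
    by (intro Bochner_Integration.integrable_add integrable_mult_right mixture_law_second_moment(1)[OF s R] L.integrable_const)
  have "(LINT x|mixture_law M s. 2 / K\<^sup>2 * (x\<^sup>2 + \<tau>\<^sup>2)) = 2 / K\<^sup>2 * ((LINT x|mixture_law M s. x\<^sup>2) + \<tau>\<^sup>2)"
    using mixture_law_second_moment(1)[OF s R] L.prob_space by simp
  also have "\<dots> \<le> 2 / K\<^sup>2 * ((R\<^sup>2 + A) + \<tau>\<^sup>2)"
    using mixture_law_second_moment(2)[OF s R] A by (intro mult_left_mono add_right_mono) auto
  finally have B: "(LINT x|mixture_law M s. 2 / K\<^sup>2 * (x\<^sup>2 + \<tau>\<^sup>2)) \<le> 2 / K\<^sup>2 * ((R\<^sup>2 + A) + \<tau>\<^sup>2)" .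
  have "(LINT x|mixture_law M s. min 2 (8 * \<tau> / m\<^sup>2 / mixture_density M s x)) \<le> 2 * (8 * \<tau> / m\<^sup>2) * K + 2 * (R\<^sup>2 + s\<^sup>2) / K\<^sup>2"
    using \<tau> by (intro mixture_law_reciprocal_bound[OF s R _ K]) auto
  also have "\<dots> \<le> 2 * (8 * \<tau> / m\<^sup>2) * K + 2 * (R\<^sup>2 + A) / K\<^sup>2"
    using A by (intro add_left_mono divide_right_mono mult_left_mono) auto
  finally show ?thesis
    unfolding smoothing_error_def Bochner_Integration.integral_add[OF 1 2] using B by simp
qed

context gaussian_model
begin

text \<open>The smoothing errors at the data and their means have the same expectation, hence the
  factor 2. Nonnegativity is recorded for Markov's inequality.\<close>

lemma deviation_bound_expectation:
  assumes m: "0 < m" and \<tau>: "0 < \<tau>" and K: "0 < K" and R: "AE u in G0. \<bar>u\<bar> \<le> R"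
    and A: "\<And>j. j < n \<Longrightarrow> (sd \<Sigma> j)\<^sup>2 \<le> A"
  shows "integrable P (\<lambda>\<omega>. deviation_bound G0 m \<tau> K B n (sd \<Sigma>) (U \<omega>))"
    "(LINT \<omega>|P. deviation_bound G0 m \<tau> K B n (sd \<Sigma>) (U \<omega>)) \<le>
      2 * n * (16 * \<tau> / m\<^sup>2 * K + 2 * (R\<^sup>2 + A) / K\<^sup>2 + 2 * (R\<^sup>2 + A + \<tau>\<^sup>2) / K\<^sup>2) +
      4 * K / (2 * pi) * (B * (sqrt (2 * pi) / \<tau> * sqrt (2 * n * cor_norm)))"
    "0 \<le> deviation_bound G0 m \<tau> K B n (sd \<Sigma>) u"
proof -
  let ?E = "\<lambda>j. smoothing_error G0 m \<tau> K (sd \<Sigma> j)" and ?L = "\<lambda>j. mixture_law G0 (sd \<Sigma> j)"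
  let ?e = "16 * \<tau> / m\<^sup>2 * K + 2 * (R\<^sup>2 + A) / K\<^sup>2 + 2 * (R\<^sup>2 + A + \<tau>\<^sup>2) / K\<^sup>2"
  let ?J = "noise_bin \<tau> n (sd \<Sigma>)"
  have E_meas: "?E j \<in> borel_measurable borel" for j unfolding smoothing_error_def by measurable
  have E_nonneg: "0 \<le> ?E j x" if "j < n" for j x
    using G0.mixture_density_pos[OF sd_pos[OF that], of x] \<tau> unfolding smoothing_error_def
    by (intro add_nonneg_nonneg min.boundedI divide_nonneg_nonneg mult_nonneg_nonneg) auto
  have J: "?J b \<subseteq> {..<n}" for b by (auto simp: noise_bin_def)
  have X: "deviation_bound G0 m \<tau> K B n (sd \<Sigma>) (U \<omega>) =
      (\<Sum>j<n. ?E j (U \<omega> j)) + (\<Sum>j<n. LINT x|?L j. ?E j x) + 4 * K / (2 * pi) * (\<Sum>b<B. bin_deviation \<tau> (?J b) \<omega>)" for \<omega>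
    unfolding deviation_bound_def bin_deviation_def ..
  have i1: "integrable P (\<lambda>\<omega>. ?E j (U \<omega> j))" if "j < n" for j
    by (rule integrable_U[OF that E_meas G0.integrable_smoothing_error[OF sd_pos[OF that] R \<tau>]])
  have i2: "integrable P (bin_deviation \<tau> (?J b))" for b by (rule bin_deviation_expectation(1)[OF J \<tau>])
  have i: "integrable P (\<lambda>\<omega>. \<Sum>j<n. ?E j (U \<omega> j))" "integrable P (\<lambda>\<omega>. (\<Sum>j<n. ?E j (U \<omega> j)) + (\<Sum>j<n. LINT x|?L j. ?E j x))"
    "integrable P (\<lambda>\<omega>. 4 * K / (2 * pi) * (\<Sum>b<B. bin_deviation \<tau> (?J b) \<omega>))"
    using i1 i2 by (auto intro!: Bochner_Integration.integrable_add Bochner_Integration.integrable_sum integrable_mult_right)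
  show "integrable P (\<lambda>\<omega>. deviation_bound G0 m \<tau> K B n (sd \<Sigma>) (U \<omega>))"
    unfolding X by (rule Bochner_Integration.integrable_add[OF i(2,3)])
  have E: "(LINT \<omega>|P. ?E j (U \<omega> j)) = (LINT x|?L j. ?E j x)" "(LINT x|?L j. ?E j x) \<le> ?e" if "j < n" for j
    by (rule integral_U[OF that E_meas], rule G0.smoothing_error_expectation[OF sd_pos[OF that] R \<tau> K A[OF that]])
  have "(LINT \<omega>|P. deviation_bound G0 m \<tau> K B n (sd \<Sigma>) (U \<omega>)) =
      (\<Sum>j<n. LINT \<omega>|P. ?E j (U \<omega> j)) + (\<Sum>j<n. LINT x|?L j. ?E j x) + 4 * K / (2 * pi) * (\<Sum>b<B. LINT \<omega>|P. bin_deviation \<tau> (?J b) \<omega>)"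
    unfolding X Bochner_Integration.integral_add[OF i(2,3)] Bochner_Integration.integral_add[OF i(1) P.integrable_const]
    using i1 i2 by (simp add: Bochner_Integration.integral_sum P.prob_space)
  also have "\<dots> \<le> (\<Sum>j<n. ?e) + (\<Sum>j<n. ?e) + 4 * K / (2 * pi) * (\<Sum>b<B. sqrt (2 * pi) / \<tau> * sqrt (2 * n * cor_norm))"
    using E bin_deviation_expectation(2)[OF J \<tau>] K by (intro add_mono sum_mono mult_left_mono) auto
  finally show "(LINT \<omega>|P. deviation_bound G0 m \<tau> K B n (sd \<Sigma>) (U \<omega>)) \<le> 2 * n * ?e + 4 * K / (2 * pi) * (B * (sqrt (2 * pi) / \<tau> * sqrt (2 * n * cor_norm)))"
    by simp
  show "0 \<le> deviation_bound G0 m \<tau> K B n (sd \<Sigma>) u"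
    unfolding deviation_bound_def using E_nonneg K
    by (intro add_nonneg_nonneg sum_nonneg mult_nonneg_nonneg divide_nonneg_nonneg integral_nonneg)
      (auto intro!: integral_nonneg_AE)
qed

definition nstar where "nstar = n / cor_norm"

lemma nstar_bounds: "1 \<le> nstar" "sqrt (2 * n * cor_norm) = n * sqrt (2 / nstar)"
proof -
  show "1 \<le> nstar" using cor_norm_ge_1 cor_norm_le_n by (simp add: nstar_def)
  have "2 * n * cor_norm = (real n)\<^sup>2 * (2 / nstar)" using cor_norm_ge_1 n_pos by (simp add: nstar_def power2_eq_square)
  then show "sqrt (2 * n * cor_norm) = n * sqrt (2 / nstar)" by (simp only: real_sqrt_mult real_sqrt_abs abs_of_nat)
qed

text \<open>The square root of 1 / nstar is k^32. Per coordinate, the Lipschitz error has order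
  \<tau> K = k^4, the truncation error order K^-2 = k^8, and the fluctuation order K \<tau>^-2 k^32
  = k^12, where one factor 1 / \<tau> counts the bins and the other is the mass of the Gaussian
  weight. The mean is thus of order n k^4, and Markov's inequality at the threshold n k^2 leaves
  k^2.\<close>

lemma deviation_probability:
  fixes k \<tau> K :: real
  assumes m: "0 < m" and m2: "1 / m\<^sup>2 = A" and A: "1 < A" "\<And>j. j < n \<Longrightarrow> (sd \<Sigma> j)\<^sup>2 \<le> A" and R: "AE u in G0. \<bar>u\<bar> \<le> R"
  defines "k \<equiv> nstar powr (-1/64)"
  defines "\<tau> \<equiv> k ^ 8" and "K \<equiv> 1 / k ^ 4"
  shows "P.prob {\<omega> \<in> space P. n * k\<^sup>2 \<le> deviation_bound G0 m \<tau> K (nat \<lceil>sqrt A / \<tau>\<rceil> + 1) n (sd \<Sigma>) (U \<omega>)}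
     \<le> (44 * A + 8 * R\<^sup>2 + 12) * k\<^sup>2"
proof -
  let ?B = "nat \<lceil>sqrt A / \<tau>\<rceil> + 1" and ?e = "16 * \<tau> / m\<^sup>2 * K + 2 * (R\<^sup>2 + A) / K\<^sup>2 + 2 * (R\<^sup>2 + A + \<tau>\<^sup>2) / K\<^sup>2"
  have k: "0 < k" "k \<le> 1" using nstar_bounds(1) powr_mono[of "-1/64" 0 nstar] by (auto simp: k_def)
  have k64: "1 / nstar = k ^ 64"
  proof -
    have "k ^ 64 = k powr real 64" using k(1) by (simp only: powr_realpow)
    also have "\<dots> = nstar powr ((-1/64) * real 64)" unfolding k_def by (rule powr_powr)
    also have "(-1/64) * real 64 = -1" by simp
    also have "nstar powr -1 = 1 / nstar" using nstar_bounds(1) by (simp add: powr_minus_divide)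
    finally show ?thesis by (rule sym)
  qed
  have \<tau>: "0 < \<tau>" "\<tau> \<le> 1" "0 < K" using k by (auto simp: \<tau>_def K_def power_le_one)
  have kp: "k ^ i \<le> k ^ 4" if "4 \<le> i" for i using k that by (intro power_decreasing) auto
  have sqrtA: "0 \<le> sqrt A" "sqrt A \<le> A"
    using A(1) sqrt_le_self[of A] by simp_all
  have B: "?B \<le> (A + 2) / \<tau>"
  proof -
    have "0 \<le> sqrt A / \<tau>" using sqrtA \<tau> by simp
    then have "real ?B \<le> sqrt A / \<tau> + 2" by linarith
    also have "\<dots> \<le> A / \<tau> + 2 / \<tau>"
    proof (rule add_mono)
      show "sqrt A / \<tau> \<le> A / \<tau>" by (rule divide_right_mono[OF sqrtA(2)]) (use \<tau> in simp)
      have "2 * 1 \<le> 2 * (1 / \<tau>)" by (rule mult_left_mono) (use \<tau> in simp_all)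
      then show "2 \<le> 2 / \<tau>" by simp
    qed
    finally show ?thesis by (simp add: add_divide_distrib)
  qed
  have cancel: "p * q * (1 / q) = p" if "q = k ^ i" for p q :: real and i using that k(1) by simp
  have e: "?e \<le> (20 * A + 4 * R\<^sup>2 + 2) * k ^ 4"
  proof -
    have "16 * \<tau> / m\<^sup>2 * K = 16 * A * k ^ 4"
    proof -
      have "k ^ 8 = k ^ 4 * k ^ 4" by (simp flip: power_add)
      then have "\<tau> * K = k ^ 4 * k ^ 4 * (1 / k ^ 4)" unfolding \<tau>_def K_def by (simp only:)
      then have "\<tau> * K = k ^ 4" by (simp only: cancel[OF refl])
      then show ?thesis unfolding m2[symmetric] by (simp add: mult.assoc)
    qed
    moreover have K8: "1 / K\<^sup>2 = k ^ 8" by (simp add: K_def power_divide power_mult[symmetric])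
    moreover have "2 * (R\<^sup>2 + A) * (1 / K\<^sup>2) \<le> 2 * (R\<^sup>2 + A) * k ^ 4"
      unfolding K8 using A(1) by (intro mult_left_mono kp) auto
    moreover have "2 * (R\<^sup>2 + A + \<tau>\<^sup>2) * (1 / K\<^sup>2) \<le> 2 * (R\<^sup>2 + A + 1) * k ^ 4"
      unfolding K8 using A(1) \<tau> by (intro mult_mono kp) (auto simp: power_le_one)
    moreover have "?e = 16 * \<tau> / m\<^sup>2 * K + 2 * (R\<^sup>2 + A) * (1 / K\<^sup>2) + 2 * (R\<^sup>2 + A + \<tau>\<^sup>2) * (1 / K\<^sup>2)"
      by simp
    ultimately have "?e \<le> 16 * A * k ^ 4 + 2 * (R\<^sup>2 + A) * k ^ 4 + 2 * (R\<^sup>2 + A + 1) * k ^ 4" by linarith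
    also have "\<dots> = (20 * A + 4 * R\<^sup>2 + 2) * k ^ 4" by (simp add: algebra_simps)
    finally show ?thesis .
  qed
  have b: "4 * K / (2 * pi) * (?B * (sqrt (2 * pi) / \<tau> * sqrt (2 * n * cor_norm))) \<le> n * ((4 * A + 8) * k ^ 4)"
  proof -
    have "4 * K / (2 * pi) * (?B * (sqrt (2 * pi) / \<tau> * sqrt (2 * n * cor_norm))) \<le>
        4 * K / (2 * pi) * ((A + 2) / \<tau> * (sqrt (2 * pi) / \<tau> * sqrt (2 * n * cor_norm)))"
      by (rule mult_left_mono[OF mult_right_mono[OF B]]) (use \<tau> cor_norm_ge_1 in simp_all)
    also have "\<dots> = n * ((4 * A + 8) * (K / \<tau>\<^sup>2 * sqrt (1 / nstar))) * (sqrt (2 * pi) * sqrt 2 / (2 * pi))"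
    proof -
      have alg: "4 * K / (2 * pi) * (a2 / \<tau> * (a / \<tau> * (x * (b * c)))) = x * ((4 * a2) * (K / \<tau>\<^sup>2 * c)) * (a * b / (2 * pi))"
        for a2 a b c x :: real
        by (simp only: divide_inverse power2_eq_square inverse_mult_distrib mult_ac)
      have "sqrt (2 / nstar) = sqrt 2 * sqrt (1 / nstar)" by (simp flip: real_sqrt_mult)
      moreover have "4 * A + 8 = 4 * (A + 2)" by simp
      ultimately show ?thesis unfolding nstar_bounds(2) by (simp only: alg)
    qed
    also have "sqrt (1 / nstar) = k ^ 32"
      unfolding k64 by (rule real_sqrt_unique) (use k in \<open>simp_all flip: power_mult\<close>)
    also have "K / \<tau>\<^sup>2 * k ^ 32 = k ^ 12"
    proof -
      have *: "k ^ 32 = k ^ 12 * k ^ 20" "k ^ 4 * (k ^ 8)\<^sup>2 = k ^ 20"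
        by (simp_all flip: power_add power_mult)
      have "K / \<tau>\<^sup>2 = 1 / k ^ 20"
        unfolding K_def \<tau>_def divide_divide_eq_left *(2) ..
      then have "K / \<tau>\<^sup>2 * k ^ 32 = k ^ 12 * k ^ 20 * (1 / k ^ 20)"
        unfolding *(1) by (simp only: mult.commute)
      also have "\<dots> = k ^ 12" by (rule cancel) (rule refl)
      finally show ?thesis .
    qed
    also have "n * ((4 * A + 8) * k ^ 12) * (sqrt (2 * pi) * sqrt 2 / (2 * pi)) \<le> n * ((4 * A + 8) * k ^ 4) * 1"
    proof (intro mult_mono mult_left_mono kp)
      have "sqrt (2 * pi) * sqrt 2 = 2 * sqrt pi" by (simp add: real_sqrt_mult)
      moreover have "sqrt pi \<le> pi" by (rule sqrt_le_self) (use pi_ge_two in linarith)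
      ultimately show "sqrt (2 * pi) * sqrt 2 / (2 * pi) \<le> 1" by simp
    qed (use A(1) k in auto)
    finally show ?thesis by simp
  qed
  note X = deviation_bound_expectation[OF m \<tau>(1,3) R A(2), where B="?B"]
  have "(LINT \<omega>|P. deviation_bound G0 m \<tau> K ?B n (sd \<Sigma>) (U \<omega>)) \<le> 2 * n * ((20 * A + 4 * R\<^sup>2 + 2) * k ^ 4) + n * ((4 * A + 8) * k ^ 4)"
    using X(2) b mult_left_mono[OF e, of "2 * real n"] by linarith
  \<comment> \<open>The constant is twice that of \<open>e\<close> plus the \<open>4 * A + 8\<close>
    of \<open>b\<close>.\<close>
  also have "\<dots> = n * k\<^sup>2 * ((44 * A + 8 * R\<^sup>2 + 12) * k\<^sup>2)"
    by (simp add: algebra_simps power2_eq_square power4_eq_xxxx)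
  finally have E: "(LINT \<omega>|P. deviation_bound G0 m \<tau> K ?B n (sd \<Sigma>) (U \<omega>)) \<le> n * k\<^sup>2 * ((44 * A + 8 * R\<^sup>2 + 12) * k\<^sup>2)" .
  have nk: "0 < n * k\<^sup>2" using n_pos k by simp
  have "P.prob {\<omega> \<in> space P. n * k\<^sup>2 \<le> deviation_bound G0 m \<tau> K ?B n (sd \<Sigma>) (U \<omega>)} \<le>
      (LINT \<omega>|P. deviation_bound G0 m \<tau> K ?B n (sd \<Sigma>) (U \<omega>)) / (n * k\<^sup>2)"
    by (rule integral_Markov_inequality_measure[OF X(1) sets.empty_sets]) (use X(3) nk in auto)
  also have "\<dots> \<le> (n * k\<^sup>2 * ((44 * A + 8 * R\<^sup>2 + 12) * k\<^sup>2)) / (n * k\<^sup>2)"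
    by (rule divide_right_mono[OF E]) (use nk in simp)
  also have "\<dots> = (44 * A + 8 * R\<^sup>2 + 12) * k\<^sup>2"
    by (rule nonzero_mult_div_cancel_left[OF less_imp_neq[OF nk, THEN not_sym]])
  finally show ?thesis .
qed

end

text \<open>Shrinking the exponent absorbs the factor \<open>C\<close> only when \<open>x\<close> is
  large: where \<open>C * x powr (-1/64) \<le> 1\<close>, half of the exponent is given up for it.
  For smaller \<open>x\<close> the trivial bound \<open>q < 1\<close> takes over.\<close>

lemma rate_absorption:
  fixes q C :: real
  assumes q: "0 < q" "q < 1" and C: "1 < C"
  shows "\<exists>c1>1. \<forall>x\<ge>1. \<forall>v. v \<le> q \<longrightarrow> v \<le> C * x powr (-1/32) \<longrightarrow> v \<le> x powr (- 1 / c1)"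
proof -
  \<comment> \<open>In the second regime ln x < 64 ln C, so the second entry makes
    \<open>x powr (- 1 / c1)\<close> at least \<open>q\<close> there; the first entry keeps 1 / c1
    at most 1/64 for the other regime.\<close>
  define c1 where "c1 = max 64 (64 * ln C / (- ln q))"
  have lq: "0 < - ln q" using q by simp
  have c1: "64 \<le> c1" "64 * ln C / c1 \<le> - ln q"
  proof -
    show "64 \<le> c1" by (simp add: c1_def)
    then have c0: "0 < c1" by simp
    have "64 * ln C / (- ln q) \<le> c1" by (simp add: c1_def)
    then have "64 * ln C \<le> c1 * (- ln q)" using lq by (simp only: pos_divide_le_eq)
    then show "64 * ln C / c1 \<le> - ln q" using c0 by (simp only: pos_divide_le_eq mult.commute)
  qed
  have "v \<le> x powr (- 1 / c1)" if x: "1 \<le> x" and v: "v \<le> q" "v \<le> C * x powr (-1/32)" for x v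
  proof (cases "C * x powr (-1/64) \<le> 1")
    case True
    have "x powr (-1/32) = x powr (-1/64) * x powr (-1/64)" using x by (simp flip: powr_add)
    then have "v \<le> (C * x powr (-1/64)) * x powr (-1/64)"
      using v(2) by (simp only: mult.assoc)
    also have "\<dots> \<le> 1 * x powr (-1/64)" by (rule mult_right_mono[OF True]) simp
    also have "\<dots> \<le> x powr (- 1 / c1)"
    proof -
      have "1 / c1 \<le> 1 / 64" by (rule divide_left_mono) (use c1(1) in auto)
      then have "x powr (-1/64) \<le> x powr (- 1 / c1)" by (intro powr_mono x) simp
      then show ?thesis by simp
    qed
    finally show ?thesis .
  next
    case False
    then have "0 < ln (C * x powr (-1/64))" by (simp add: not_le)
    then have "ln x < 64 * ln C" using C x by (simp add: ln_mult ln_powr)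
    then have "ln x / c1 \<le> 64 * ln C / c1" using c1(1) by (intro divide_right_mono) auto
    then have "ln q \<le> - 1 / c1 * ln x" using c1(2) by simp
    then have "exp (ln q) \<le> exp (- 1 / c1 * ln x)" by simp
    then show ?thesis using v(1) q x by (simp add: powr_def)
  qed
  moreover have "1 < c1" using c1(1) by simp
  ultimately show ?thesis by blast
qed

context gaussian_model
begin

lemma nstar_eq: "n_star \<Sigma> = nstar"
  using carrier(1) by (simp add: n_star_def nstar_def cor_norm_def)

text \<open>The last claim is the power in \<open>deconvolution_error\<close> at smoothing scale
  z^8. Since z^-32 = 1 + ln nstar, it equals exp (- w) up to a bounded factor, with \<open>w\<close>
  proportional to z^-16: the logarithm outweighs the small exponent. The bound 1 / w for exp (- w)
  is all that is needed.\<close>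

lemma deconvolution_rate:
  assumes A: "1 < A"
  defines "z \<equiv> ln (exp 1 * nstar) powr (-1/32)"
  shows "0 < z" "z \<le> 1" "(nstar powr (-1/64))\<^sup>2 \<le> z"
    "(nstar powr (-1/64)) powr ((z ^ 8)\<^sup>2 / (2 * A)) \<le> 384 * A * z ^ 16"
proof -
  define x where "x = ln (exp 1 * nstar)"
  have N: "1 \<le> nstar" by (rule nstar_bounds(1))
  have x_eq: "x = 1 + ln nstar" using N by (simp add: x_def ln_mult)
  have x: "1 \<le> x" "x \<le> nstar" using N ln_le_minus_one[of nstar] by (simp_all add: x_eq)
  have z_x: "z = x powr (-1/32)" by (simp add: z_def x_def)
  show z: "0 < z" "z \<le> 1" using x powr_mono[of "-1/32" 0 x] by (auto simp: z_x)
  have "(nstar powr (-1/64))\<^sup>2 = nstar powr (-1/32)"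
    using N by (simp add: power2_eq_square flip: powr_add)
  also have "\<dots> \<le> x powr (-1/32)" by (rule powr_mono2') (use x in auto)
  finally show "(nstar powr (-1/64))\<^sup>2 \<le> z" by (simp add: z_x)
  have z32: "x * z ^ 32 = 1"
  proof -
    have "z ^ 32 = z powr real 32" using z(1) by (simp only: powr_realpow)
    also have "\<dots> = x powr ((-1/32) * real 32)" unfolding z_x by (rule powr_powr)
    also have "(-1/32) * real 32 = -1" by simp
    also have "x powr -1 = 1 / x" using x(1) by (simp add: powr_minus_divide)
    finally show ?thesis using x(1) by simp
  qed
  have "z ^ 32 = z ^ 16 * z ^ 16" by (simp flip: power_add)
  then have xz: "x * z ^ 16 = 1 / z ^ 16" using z32 z(1) by (simp add: eq_divide_eq mult.assoc)
  define w where "w = 1 / z ^ 16 / (128 * A)"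
  have w: "0 < w" using z A by (simp add: w_def)
  have "(nstar powr (-1/64)) powr ((z ^ 8)\<^sup>2 / (2 * A)) = exp (ln nstar * (- (z ^ 16) / (128 * A)))"
    unfolding powr_powr using N by (simp add: powr_def flip: power_mult)
  also have "ln nstar * (- (z ^ 16) / (128 * A)) = z ^ 16 / (128 * A) + (- w)"
  proof -
    have "ln nstar * (- (z ^ 16) / (128 * A)) = (z ^ 16 - x * z ^ 16) / (128 * A)"
      unfolding x_eq by (simp add: diff_divide_distrib add_divide_distrib distrib_right)
    then show ?thesis unfolding xz w_def by (simp add: diff_divide_distrib)
  qed
  also have "exp (z ^ 16 / (128 * A) + (- w)) = exp (z ^ 16 / (128 * A)) * exp (- w)" by (rule exp_add)
  \<comment> \<open>The 3 dominates exp 1; with the 128 in \<open>w\<close> it makes the constant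
    384.\<close>
  also have "\<dots> \<le> 3 * (1 / w)"
  proof (rule mult_mono)
    have "z ^ 16 / (128 * A) \<le> 1 / 1" using z A by (intro frac_le) (auto simp: power_le_one)
    then have "exp (z ^ 16 / (128 * A)) \<le> exp 1" by simp
    then show "exp (z ^ 16 / (128 * A)) \<le> 3" using exp_le by linarith
    have "w \<le> exp w" using exp_ge_add_one_self[of w] by linarith
    then have "1 / exp w \<le> 1 / w" using w by (intro divide_left_mono) auto
    then show "exp (- w) \<le> 1 / w" by (simp add: exp_minus inverse_eq_divide)
  qed auto
  also have "\<dots> = 384 * A * z ^ 16" by (simp add: w_def)
  finally show "(nstar powr (-1/64)) powr ((z ^ 8)\<^sup>2 / (2 * A)) \<le> 384 * A * z ^ 16" .
qed

text \<open>\<open>\<tau>\<close> and \<open>K\<close> belong to the empirical step, whereas the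
  deconvolution uses smoothing scale z^8 and ramp width z^4. The error before division by the
  marginal density is then of order z^4. Outside an event on which that density is at most of order
  z^2, the posterior distribution functions differ by at most z^2. The exceptional events have
  probability of order z and determine the rate.\<close>

lemma coverage_bound:
  assumes mle: "is_composite_mle n \<Sigma> Ghat" and \<gamma>: "0 < \<gamma>" "\<gamma> < 1"
    and A: "1 < A" "\<And>j. j < n \<Longrightarrow> (sd \<Sigma> j)\<^sup>2 \<in> {1/A..A}"
    and R: "AE u in G0. \<bar>u\<bar> \<le> R" and atomless: "\<And>x. emeasure G0 {x} = 0"
    and dens: "\<And>a b. a \<le> b \<Longrightarrow> measure G0 {a<..b} \<le> A * (b - a)"
  shows "\<bar>coverage n G0 \<Sigma> S Ghat \<gamma> - (1 - \<gamma>)\<bar> \<le>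
     (16 + 46 * A + 10 * R\<^sup>2 + 4 * (771 * A + A\<^sup>2)) * ln (exp 1 * n_star \<Sigma>) powr (-1/32)"
proof -
  define m where "m = 1 / sqrt A"
  define k where "k = nstar powr (-1/64)"
  define \<tau> where "\<tau> = k ^ 8"
  define K where "K = 1 / k ^ 4"
  define B where "B = nat \<lceil>sqrt A / \<tau>\<rceil> + 1"
  define z where "z = ln (exp 1 * nstar) powr (-1/32)"
  define C where "C = 771 * A + A\<^sup>2"
  note rate = deconvolution_rate[OF A(1), folded k_def z_def]
  have k: "0 < k" using nstar_bounds(1) by (simp add: k_def)
  have \<tau>: "0 < \<tau>" "0 < K" using k by (auto simp: \<tau>_def K_def)
  have m: "0 < m" "1 / m\<^sup>2 = A" "1 / m = sqrt A" using A(1) by (auto simp: m_def power_divide)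
  have sqrtA: "sqrt A \<le> A" "0 < sqrt A" using A(1) sqrt_le_self[of A] by simp_all
  have C: "0 < C" using A(1) by (simp add: C_def add_pos_pos)
  have sd_m: "m \<le> sd \<Sigma> j" if "j < n" for j
  proof -
    have "m\<^sup>2 \<le> (sd \<Sigma> j)\<^sup>2" using A(2)[OF that] A(1) by (simp add: m_def power_divide)
    then show ?thesis by (rule power2_le_imp_le) (use sd_pos[OF that] in simp)
  qed
  have sd_A: "(sd \<Sigma> j)\<^sup>2 \<le> A" if "j < n" for j using A(2)[OF that] by simp
  have sd_B: "sd \<Sigma> j / \<tau> < real B" if "j < n" for j
  proof -
    have "sd \<Sigma> j \<le> sqrt A" by (rule real_le_rsqrt[OF sd_A[OF that]])
    then have "sd \<Sigma> j / \<tau> \<le> sqrt A / \<tau>" using \<tau> by (intro divide_right_mono) auto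
    also have "sqrt A / \<tau> < real B" unfolding B_def by linarith
    finally show ?thesis .
  qed
  have Gh: "Ghat \<in> Rn n \<rightarrow>\<^sub>M prob_algebra borel"
    and arg: "\<And>u. u \<in> space (Rn n) \<Longrightarrow> is_arg_max (composite_loglik n \<Sigma> u) (\<lambda>G. G \<in> prob_distributions) (Ghat u)"
    using mle by (auto simp: is_composite_mle_def)
  let ?X = "\<lambda>\<omega>. deviation_bound G0 m \<tau> K B n (sd \<Sigma>) (U \<omega>)"
  define B1 where "B1 = {\<omega> \<in> space P. n * k\<^sup>2 \<le> ?X \<omega>}"
  have [measurable]: "?X \<in> borel_measurable P"
    using deviation_bound_expectation(1)[OF m(1) \<tau> R sd_A] by simp
  have B1_sets [measurable]: "B1 \<in> sets P" unfolding B1_def by measurable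
  have B1: "P.prob B1 \<le> (44 * A + 8 * R\<^sup>2 + 12) * z"
  proof -
    have "P.prob B1 \<le> (44 * A + 8 * R\<^sup>2 + 12) * k\<^sup>2"
      using deviation_probability[OF m(1,2) A(1) sd_A R] unfolding B1_def B_def K_def \<tau>_def k_def .
    also have "\<dots> \<le> (44 * A + 8 * R\<^sup>2 + 12) * z" by (rule mult_left_mono[OF rate(3)]) (use A(1) in simp)
    finally show ?thesis .
  qed
  have z2: "z\<^sup>2 \<le> z" using rate(1,2) by (simp add: power2_eq_square mult_left_le)
  have each: "\<bar>P.prob (covered Ghat \<gamma> j) - (1 - \<gamma>)\<bar> \<le> (16 + 46 * A + 10 * R\<^sup>2 + 4 * C) * z" if j: "j < n" for j
  proof -
    let ?p = "mixture_density G0 (sd \<Sigma> j)"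
    have s: "0 < sd \<Sigma> j" by (rule sd_pos[OF j])
    have p: "0 < ?p x" for x using G0.mixture_density_pos[OF s] .
    \<comment> \<open>The density level below which the bound \<open>2 * (C * z ^ 4)\<close> over
      the density would exceed z^2. \<open>B2\<close> is the event that the density at the
      observation is at most \<open>c\<close>; the cap 2 brings it into the form of
      \<open>mixture_law_reciprocal_bound\<close>.\<close>
    define c where "c = 2 * C * z\<^sup>2"
    have c: "0 < c" using C rate(1) by (simp add: c_def)
    define B2 where "B2 = {\<omega> \<in> space P. 1 \<le> min 2 (c / ?p (U \<omega> j))}"
    let ?f = "\<lambda>x. min 2 (c / ?p x)"
    have f_meas: "?f \<in> borel_measurable borel" by measurable
    have f0: "0 \<le> ?f x" "norm (?f x) \<le> 2" for x
    proof -
      have "0 \<le> c / ?p x" using c p[of x] by (intro divide_nonneg_nonneg) auto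
      then show "0 \<le> ?f x" "norm (?f x) \<le> 2" by (auto simp: abs_le_iff min.coboundedI1)
    qed
    have f_int: "integrable (mixture_law G0 (sd \<Sigma> j)) ?f"
    proof -
      interpret L: real_distribution "mixture_law G0 (sd \<Sigma> j)" by (rule G0.real_distribution_mixture_law[OF s])
      show ?thesis using f0(2) by (intro L.integrable_const_bound[where B=2]) auto
    qed
    note fU = integrable_U[OF j f_meas f_int]
    have [measurable]: "(\<lambda>\<omega>. ?f (U \<omega> j)) \<in> borel_measurable P" by (rule borel_measurable_integrable[OF fU])
    have B2_sets [measurable]: "B2 \<in> sets P" unfolding B2_def by measurable
    have "P.prob B2 \<le> (LINT \<omega>|P. ?f (U \<omega> j)) / 1"
      unfolding B2_def by (rule integral_Markov_inequality_measure[OF fU sets.empty_sets]) (use f0(1) in auto)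
    also have "\<dots> = (LINT x|mixture_law G0 (sd \<Sigma> j). ?f x)" using integral_U[OF j f_meas] by simp
    \<comment> \<open>The window 1 / z turns \<open>c\<close>, of order z^2, into a term of order z,
      and leaves a tail of order z^2.\<close>
    also have "\<dots> \<le> 2 * c * (1 / z) + 2 * (R\<^sup>2 + (sd \<Sigma> j)\<^sup>2) / (1 / z)\<^sup>2"
      by (rule G0.mixture_law_reciprocal_bound[OF s R]) (use c rate(1) in auto)
    also have "\<dots> = 4 * C * z + 2 * (R\<^sup>2 + (sd \<Sigma> j)\<^sup>2) * z\<^sup>2"
      using rate(1) by (simp add: c_def power2_eq_square)
    also have "\<dots> \<le> 4 * C * z + 2 * (R\<^sup>2 + A) * z"
      by (intro add_left_mono mult_mono z2) (use sd_A[OF j] A(1) in auto)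
    finally have B2: "P.prob B2 \<le> 4 * C * z + 2 * (R\<^sup>2 + A) * z" .
    have "\<bar>P.prob (covered Ghat \<gamma> j) - (1 - \<gamma>)\<bar> \<le> 4 * z\<^sup>2 + P.prob (B1 \<union> B2)"
    proof (rule coverage_stability[OF j Gh \<gamma> atomless])
      show "0 < z\<^sup>2" using rate(1) by simp
      fix \<omega> t assume \<omega>: "\<omega> \<in> space P" "\<omega> \<notin> B1 \<union> B2"
      have Usp: "U \<omega> \<in> space (Rn n)"
      proof -
        have "U \<in> P \<rightarrow>\<^sub>M Rn n" by measurable
        from measurable_space[OF this \<omega>(1)] show ?thesis .
      qed
      have "real_distribution (Ghat (U \<omega>))"
        using arg[OF Usp] by (simp add: is_arg_max_def mem_prob_distributions_iff)
      then interpret T: two_distributions G0 "Ghat (U \<omega>)"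
        using G0.real_distribution_axioms by (intro two_distributions.intro)
      have close: "cmod (char (Ghat (U \<omega>)) w - char G0 w) \<le> 2 * k * exp (A * w\<^sup>2 / 2)" for w
        by (rule mle_char_bound[OF G0.real_distribution_axioms arg[OF Usp] n_pos m(1) sd_m \<tau> sd_B R sd_A])
          (use \<omega> k in \<open>auto simp: B1_def\<close>)
      have z8: "(z ^ 8)\<^sup>2 \<le> 2 * A"
      proof -
        have "(z ^ 8)\<^sup>2 \<le> 1" using rate(1,2) by (simp add: power_le_one)
        then show ?thesis using A(1) by linarith
      qed
      have "\<bar>posterior_cdf (Ghat (U \<omega>)) (sd \<Sigma> j) (U \<omega> j) t - posterior_cdf G0 (sd \<Sigma> j) (U \<omega> j) t\<bar> \<le>
        2 * (2 * (1 / m\<^sup>2 + 1 / (2 * m) / z ^ 4) * z ^ 8 + deconvolution_error k A (z ^ 8) + A * z ^ 4 / (2 * m)) / ?p (U \<omega> j)"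
        by (rule T.posterior_cdf_close[OF _ _ z8 k close m(1) sd_m[OF j] _ dens]) (use rate(1) A(1) in auto)
      also have "\<dots> \<le> 2 * (C * z ^ 4) / ?p (U \<omega> j)"
      proof (rule divide_right_mono[OF mult_left_mono])
        have z84: "z ^ 8 \<le> z ^ 4" using rate(1,2) by (intro power_decreasing) auto
        have pw: "z ^ 8 = z ^ 4 * z ^ 4" "z ^ 16 = z ^ 8 * z ^ 8" by (simp_all flip: power_add)
        have h: "1 / (2 * m) = sqrt A / 2" using m(3) by (simp add: field_simps)
        have "2 * (1 / m\<^sup>2 + 1 / (2 * m) / z ^ 4) * z ^ 8 = 2 * A * z ^ 8 + sqrt A * z ^ 4"
        proof -
          have gen: "2 * (A + sqrt A / 2 / q) * (q * q) = 2 * A * (q * q) + sqrt A * q" if "q \<noteq> 0" for q :: real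
            using that by (simp add: algebra_simps)
          show ?thesis unfolding m(2) h pw(1) by (rule gen) (use rate(1) in simp)
        qed
        also have "\<dots> \<le> 2 * A * z ^ 4 + A * z ^ 4"
          using z84 sqrtA A(1) rate(1) by (intro add_mono mult_left_mono mult_right_mono) auto
        finally have t1: "2 * (1 / m\<^sup>2 + 1 / (2 * m) / z ^ 4) * z ^ 8 \<le> 3 * A * z ^ 4" by simp
        have "deconvolution_error k A (z ^ 8) \<le> 2 * (384 * A * z ^ 16) / z ^ 8"
          unfolding deconvolution_error_def using rate(1,4) by (intro divide_right_mono mult_left_mono) auto
        also have "\<dots> = 768 * A * z ^ 8"
        proof -
          have gen: "2 * (384 * A * (q * q)) / q = 768 * A * q" if "q \<noteq> 0" for q :: real using that by simp
          show ?thesis unfolding pw(2) by (rule gen) (use rate(1) in simp)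
        qed
        also have "\<dots> \<le> 768 * A * z ^ 4" using z84 A(1) by (intro mult_left_mono) auto
        finally have t2: "deconvolution_error k A (z ^ 8) \<le> 768 * A * z ^ 4" .
        have "A * z ^ 4 / (2 * m) = A * z ^ 4 * (1 / (2 * m))" by simp
        also have "\<dots> = (A * sqrt A / 2) * z ^ 4" unfolding h by simp
        also have "\<dots> \<le> A\<^sup>2 * z ^ 4"
        proof (rule mult_right_mono)
          have "A * sqrt A \<le> A * A" using sqrtA A(1) by (intro mult_left_mono) auto
          moreover have "0 \<le> A * A" by simp
          ultimately show "A * sqrt A / 2 \<le> A\<^sup>2" unfolding power2_eq_square by linarith
        qed (use rate(1) in simp)
        finally have t3: "A * z ^ 4 / (2 * m) \<le> A\<^sup>2 * z ^ 4" .
        \<comment> \<open>\<open>C\<close> collects 3 A from the Lipschitz term, 768 A = 2 * 384 A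
          from the deconvolution, and A^2 from the density bound.\<close>
        show "2 * (1 / m\<^sup>2 + 1 / (2 * m) / z ^ 4) * z ^ 8 + deconvolution_error k A (z ^ 8) + A * z ^ 4 / (2 * m) \<le> C * z ^ 4"
          unfolding C_def distrib_right using t1 t2 t3 by linarith
      qed (use p[of "U \<omega> j"] in auto)
      also have "\<dots> = c / ?p (U \<omega> j) * z\<^sup>2"
      proof -
        have "z ^ 4 = z\<^sup>2 * z\<^sup>2" by (simp flip: power_add)
        then show ?thesis by (simp add: c_def)
      qed
      also have "\<dots> \<le> 1 * z\<^sup>2"
      proof (rule mult_right_mono)
        have "\<not> 1 \<le> min 2 (c / ?p (U \<omega> j))" using \<omega> by (auto simp: B2_def)
        then show "c / ?p (U \<omega> j) \<le> 1" by linarith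
      qed simp
      finally show "\<bar>posterior_cdf (Ghat (U \<omega>)) (sd \<Sigma> j) (U \<omega> j) t - posterior_cdf G0 (sd \<Sigma> j) (U \<omega> j) t\<bar> \<le> z\<^sup>2" by simp
    qed measurable
    also have "P.prob (B1 \<union> B2) \<le> P.prob B1 + P.prob B2" by (rule measure_Un_le) measurable
    also have "4 * z\<^sup>2 + (P.prob B1 + P.prob B2) \<le>
        4 * z + ((44 * A + 8 * R\<^sup>2 + 12) * z + (4 * C * z + 2 * (R\<^sup>2 + A) * z))"
      using z2 B1 B2 by (intro add_mono) auto
    also have "\<dots> = (16 + 46 * A + 10 * R\<^sup>2 + 4 * C) * z" by (simp add: algebra_simps)
    finally show ?thesis by simp
  qed
  let ?c = "(16 + 46 * A + 10 * R\<^sup>2 + 4 * C) * z"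
  have "(\<Sum>j<n. P.prob (covered Ghat \<gamma> j)) / n - (1 - \<gamma>) = (\<Sum>j<n. P.prob (covered Ghat \<gamma> j) - (1 - \<gamma>)) / n"
    using n_pos by (simp add: sum_subtractf diff_divide_distrib)
  also have "\<bar>\<dots>\<bar> \<le> (\<Sum>j<n. ?c) / n"
    unfolding abs_divide abs_of_nat
    by (intro divide_right_mono order_trans[OF sum_abs] sum_mono) (use each in auto)
  also have "\<dots> = ?c" using n_pos by simp
  finally show ?thesis
    unfolding coverage_average[OF Gh \<gamma>] nstar_eq z_def[symmetric] C_def .
qed

lemma coverage_range:
  assumes "is_composite_mle n \<Sigma> Ghat" "0 < \<gamma>" "\<gamma> < 1"
  shows "0 \<le> coverage n G0 \<Sigma> S Ghat \<gamma>" "coverage n G0 \<Sigma> S Ghat \<gamma> \<le> 1"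
proof -
  have "Ghat \<in> Rn n \<rightarrow>\<^sub>M prob_algebra borel" using assms by (simp add: is_composite_mle_def)
  then have c: "coverage n G0 \<Sigma> S Ghat \<gamma> = (\<Sum>j<n. P.prob (covered Ghat \<gamma> j)) / n"
    by (rule coverage_average[OF _ assms(2,3)])
  show "0 \<le> coverage n G0 \<Sigma> S Ghat \<gamma>" unfolding c by (intro divide_nonneg_nonneg sum_nonneg) auto
  have "(\<Sum>j<n. P.prob (covered Ghat \<gamma> j)) \<le> (\<Sum>j<n. 1)" by (intro sum_mono P.prob_le_1)
  then show "coverage n G0 \<Sigma> S Ghat \<gamma> \<le> 1" unfolding c using n_pos by simp
qed

end

lemma psd_diag_nonneg:
  assumes "psd_mat n A" "j < n" shows "0 \<le> A $$ (j, j)"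
proof -
  have A: "A \<in> carrier_mat n n" using assms(1) by (simp add: psd_mat_def)
  have "0 \<le> scalar_prod (unit_vec n j) (A *\<^sub>v unit_vec n j)"
    using assms(1) by (simp add: psd_mat_def)
  also have "\<dots> = A $$ (j, j)" using A assms(2) by (simp add: scalar_prod_left_unit scalar_prod_right_unit)
  finally show ?thesis .
qed

theorem proposition2p4:
  fixes \<gamma> M M0 :: real
  assumes "0 < \<gamma>" "\<gamma> < 1" and "1 < M"
  shows "\<exists>c1>1. \<forall>(n::nat) (\<Sigma>0::real mat) (S::real mat) (G0::real measure) (g0::real \<Rightarrow> real)
      (Ghat::(nat \<Rightarrow> real) \<Rightarrow> real measure).
    1 \<le> n \<longrightarrow>
    psd_mat n \<Sigma>0 \<longrightarrow> is_psd_sqrt n S \<Sigma>0 \<longrightarrow>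
    G0 \<in> prob_distributions \<longrightarrow>
    measure_support G0 \<subseteq> {-M..M} \<longrightarrow>
    (\<forall>j<n. (sd \<Sigma>0 j)\<^sup>2 \<in> {1/M..M}) \<longrightarrow>
    g0 \<in> borel_measurable borel \<longrightarrow>
    G0 = density lborel (\<lambda>x. ennreal (g0 x)) \<longrightarrow>
    (\<forall>x. x \<notin> {-M0..M0} \<longrightarrow> g0 x = 0) \<longrightarrow>
    (\<forall>x\<in>{-M0..M0}. g0 x \<in> {1/M..M}) \<longrightarrow>
    is_composite_mle n \<Sigma>0 Ghat \<longrightarrow>
    n_star \<Sigma>0 \<ge> ln (real n) powr c1 \<longrightarrow>
    \<bar>coverage n G0 \<Sigma>0 S Ghat \<gamma> - (1 - \<gamma>)\<bar>
      \<le> ln (exp 1 * n_star \<Sigma>0) powr (- 1 / c1)"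
proof -
  \<comment> \<open>The largest possible distance between a probability and 1 - \<gamma>. It
    supplies the trivial bound in \<open>rate_absorption\<close>, and through it \<open>c1\<close>
    depends on \<gamma>.\<close>
  define q where "q = max \<gamma> (1 - \<gamma>)"
  define C where "C = 16 + 46 * M + 10 * M0\<^sup>2 + 4 * (771 * M + M\<^sup>2)"
  have q: "0 < q" "q < 1" using assms by (auto simp: q_def)
  have "0 \<le> 46 * M" "0 \<le> 10 * M0\<^sup>2" "0 \<le> 4 * (771 * M + M\<^sup>2)" using assms(3) by simp_all
  then have "16 \<le> C" unfolding C_def by linarith
  then have "1 < C" by simp
  from rate_absorption[OF q this] obtain c1 where c1: "1 < c1"
    "\<And>x v. 1 \<le> x \<Longrightarrow> v \<le> q \<Longrightarrow> v \<le> C * x powr (-1/32) \<Longrightarrow> v \<le> x powr (- 1 / c1)"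
    by blast
  show ?thesis
  proof (intro exI[of _ c1] conjI allI impI c1(1))
    fix n \<Sigma>0 S G0 g0 Ghat
    assume n: "1 \<le> n" and psd: "psd_mat n \<Sigma>0" and S: "is_psd_sqrt n S \<Sigma>0" and G0: "G0 \<in> prob_distributions"
      and sd: "\<forall>j<n. (sd \<Sigma>0 j)\<^sup>2 \<in> {1/M..M}" and g0_meas [measurable]: "g0 \<in> borel_measurable borel"
      and G0_eq: "G0 = density lborel (\<lambda>x. ennreal (g0 x))"
      and g0_out: "\<forall>x. x \<notin> {-M0..M0} \<longrightarrow> g0 x = 0" and g0_in: "\<forall>x\<in>{-M0..M0}. g0 x \<in> {1/M..M}"
      and mle: "is_composite_mle n \<Sigma>0 Ghat"
    have sd_pos: "0 < sd \<Sigma>0 j" if "j < n" for j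
    proof -
      have "0 < 1 / M" using assms(3) by simp
      then have "0 < (sd \<Sigma>0 j)\<^sup>2" using sd that by fastforce
      \<comment> \<open>\<open>sqrt\<close> of a negative number is negative, so bounds on the
        square do not fix the sign; the diagonal of a positive semidefinite matrix does.\<close>
      moreover have "0 \<le> sd \<Sigma>0 j" using psd_diag_nonneg[OF psd that] by (simp add: sd_def)
      ultimately show ?thesis by (simp add: zero_less_power2 order_le_less)
    qed
    interpret G0: real_distribution G0 using G0 by (simp add: mem_prob_distributions_iff)
    interpret gaussian_model n \<Sigma>0 S G0 by unfold_locales (use n psd S sd_pos in auto)
    have g0_le: "g0 x \<le> M" for x using g0_out g0_in assms(3) by (cases "x \<in> {-M0..M0}") auto
    have AE: "AE u in G0. \<bar>u\<bar> \<le> M0"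
    proof -
      have "\<bar>x\<bar> \<le> M0" if "0 < g0 x" for x
        using that g0_out by (cases "x \<in> {-M0..M0}") (auto simp: abs_le_iff)
      then show ?thesis unfolding G0_eq by (subst AE_density) auto
    qed
    have atomless: "emeasure G0 {x} = 0" for x
      unfolding G0_eq by (subst emeasure_density) (auto intro!: nn_integral_null_set simp: null_sets_def)
    have dens: "measure G0 {a<..b} \<le> M * (b - a)" if "a \<le> b" for a b
    proof -
      have "emeasure G0 {a<..b} = (\<integral>\<^sup>+x. ennreal (g0 x) * indicator {a<..b} x \<partial>lborel)"
        unfolding G0_eq by (rule emeasure_density) auto
      also have "\<dots> \<le> (\<integral>\<^sup>+x. ennreal M * indicator {a<..b} x \<partial>lborel)"
        using g0_le by (intro nn_integral_mono mult_right_mono ennreal_leI) auto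
      also have "\<dots> = ennreal M * ennreal (b - a)"
        using that by (subst nn_integral_cmult_indicator) auto
      also have "\<dots> = ennreal (M * (b - a))" using assms(3) that by (simp add: ennreal_mult)
      finally show ?thesis using assms(3) that by (simp add: G0.emeasure_eq_measure ennreal_le_iff)
    qed
    have N: "1 \<le> ln (exp 1 * n_star \<Sigma>0)"
      unfolding nstar_eq using nstar_bounds(1) by (simp add: ln_mult)
    show "\<bar>coverage n G0 \<Sigma>0 S Ghat \<gamma> - (1 - \<gamma>)\<bar> \<le> ln (exp 1 * n_star \<Sigma>0) powr (- 1 / c1)"
    proof (rule c1(2)[OF N])
      show "\<bar>coverage n G0 \<Sigma>0 S Ghat \<gamma> - (1 - \<gamma>)\<bar> \<le> q"
        using coverage_range[OF mle assms(1,2)] unfolding q_def abs_le_iff max_def by auto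
      show "\<bar>coverage n G0 \<Sigma>0 S Ghat \<gamma> - (1 - \<gamma>)\<bar> \<le> C * ln (exp 1 * n_star \<Sigma>0) powr (-1/32)"
        unfolding C_def using sd by (intro coverage_bound[OF mle assms(1,2,3) _ AE atomless dens]) auto
    qed
  qed
qed

end
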